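(* Let $\nu\in\hat{\mathbb{F}}$ and let $\phi:\Sigma_\nu\to\mathcal{L}(\mathcal{H})$ be a positive definite function with $\phi(e)=I_{\mathcal{H}}$. Then $\phi$ has a positive definite extension $\Phi:\mathbb{F}\to\mathcal{L}(\mathcal{H})$. Moreover, there is a one-to-one correspondence, given by $\Phi\mapsto(\gamma_\mu(\Phi))_{\nu\prec\mu}$, between the set of all positive definite extensions $\Phi:\mathbb{F}\to\mathcal{L}(\mathcal{H})$ of $\phi$ and the set of sequences of contractions $(\gamma_\mu)_{\mu\in\hat{\mathbb{F}},\,\nu\prec\mu}$, where $\gamma_\mu:\boldsymbol{D}(\Phi|\Sigma_{\mu^-})\to\boldsymbol{R}(\Phi|\Sigma_{\mu^-})$. (Here $\Phi|\Sigma_{\mu}$ depends only on the $\gamma_{\mu'}$ with $\nu\prec\mu'\preceq\mu$, so the domain and range spaces of $\gamma_\mu$ are determined by $\phi$ and the previously chosen contractions $\gamma_{\mu'}$, $\nu\prec\mu'\prec\mu$, and at step $\mu$ the contraction $\gamma_\mu$ may be chosen arbitrarily between these spaces.)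
   Context: $\mathcal{H}$ is a Hilbert space, $\mathcal{L}(\mathcal{H})$ its bounded operators. $\mathbb{F}$ is the free group with finitely many generators $a_1,\dots,a_m$; $\mathcal{A}=\{a_1,\dots,a_m\}$; $e$ is the unit; words are written in reduced form over $\mathcal{A}\cup\mathcal{A}^{-1}$ and $|s|$ is the reduced length of $s$. $\mathrm{CB}(s,t)$ denotes the longest common initial segment of the reduced words $s,t$. A total order $\preceq$ on $\mathbb{F}$ is called lexicographic if $s_1\preceq s_2$ whenever either $|s_1|<|s_2|$, or $|s_1|=|s_2|$ and, with $t=\mathrm{CB}(s_1,s_2)$ and $b_i$ the first letter of $t^{-1}s_i$, one has $b_1\preceq b_2$. Such an order is fixed. $\hat{\mathbb{F}}$ is the set of classes $\hat s=\{s,s^{-1}\}$, ordered by $\hat s\preceq\hat t$ iff $\min\{s,s^{-1}\}\preceq\min\{t,t^{-1}\}$; $\prec$ means $\preceq$ and $\ne$; $\mu^-$ is the predecessor of $\mu$ in $\hat{\mathbb{F}}$. For $\mu\in\hat{\mathbb{F}}$ put $\Sigma_\mu=\bigcup_{\mu'\preceq\mu}\mu'\subset\mathbb{F}$. $\Gamma_\mu$ is the graph with vertex set $\mathbb{F}$ in which distinct $s,t$ are adjacent iff $\widehat{s^{-1}t}\preceq\mu$. For $\Sigma=\Sigma^{-1}\subset\mathbb{F}$, a function $\phi:\Sigma\to\mathcal{L}(\mathcal{H})$ is positive definite if for all $s_1,\dots,s_k\in\mathbb{F}$ with $s_i^{-1}s_j\in\Sigma$ for all $i,j$, the operator matrix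 $[\phi(s_i^{-1}s_j)]_{i,j=1}^k$ is positive semidefinite. For a finite $S\subset\mathbb{F}$ with $s^{-1}t\in\Sigma$ for all $s,t\in S$, $A(\phi;S)=[\phi(s^{-1}t)]_{s,t\in S}$. Realizations: for a positive semidefinite block operator matrix $A=(A_{ij})_{i,j\in I}$ with entries in $\mathcal{L}(\mathcal{H})$, $\mathcal{R}(A)$ is the (essentially unique) Hilbert space with operators $\omega_i:\mathcal{H}\to\mathcal{R}(A)$ (isometries if $A_{ii}=I$) such that $A_{ij}=\omega_i^*\omega_j$ and the ranges $\omega_i\mathcal{H}$ span a dense subspace of $\mathcal{R}(A)$; it is $\{0\}$ if $I=\emptyset$. For $J\subset I$, $\mathcal{R}(A|J)$ (with $A|J$ the submatrix with rows and columns in $J$) is identified with the closed span of $\omega_i\mathcal{H}$, $i\in J$, in $\mathcal{R}(A)$. For $\mu\neq\{e\}$ write $\mu=\{s_\mu,s_\mu^{-1}\}$ with $s_\mu\preceq s_\mu^{-1}$, and let $C_\mu$ be the (unique, finite) maximal clique of $\Gamma_\mu$ containing $e$ and $s_\mu$; $\{e,s_\mu\}$ is the only edge of $C_\mu$ which is not an edge of $\Gamma_{\mu^-}$. For a positive definite $\psi$ on $\Sigma_{\mu^-}$ set $$\boldsymbol{D}(\psi)=\mathcal{R}(A(\psi;C_\mu\setminus\{s_\mu\}))\ominus\mathcal{R}(A(\psi;C_\mu\setminus\{e,s_\mu\})),$$ $$\boldsymbol{R}(\psi)=\mathcal{R}(A(\psi;C_\mu\setminus\{e\}))\ominus\mathcal{R}(A(\psi;C_\mu\setminus\{e,s_\mu\})).$$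 If $\Phi$ is a positive definite function on $\mathbb{F}$ (or on $\Sigma_\mu$), both spaces for $\psi=\Phi|\Sigma_{\mu^-}$ are viewed as subspaces of $\mathcal{R}(A(\Phi;C_\mu))$, and $\gamma_\mu(\Phi)=P_{\boldsymbol{R}(\psi)}|_{\boldsymbol{D}(\psi)}$ is the compression to $\boldsymbol{R}(\psi)$ of the orthogonal projection restricted to $\boldsymbol{D}(\psi)$. *)

theory Defs
  imports "HOL-Analysis.Analysis" "HOL-Library.Sublist"
begin

type_synonym 'a letter = "'a \<times> bool"

definition inv_letter :: "'a letter \<Rightarrow> 'a letter" where
  "inv_letter l = (fst l, \<not> snd l)"

definition reduced_word :: "'a letter list \<Rightarrow> bool" where
  "reduced_word = successively (\<lambda>k l. l \<noteq> inv_letter k)"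

fun cons_letter :: "'a letter \<Rightarrow> 'a letter list \<Rightarrow> 'a letter list" where
  "cons_letter k [] = [k]"
| "cons_letter k (l # w) = (if l = inv_letter k then w else k # l # w)"

definition word_mult :: "'a letter list \<Rightarrow> 'a letter list \<Rightarrow> 'a letter list" where
  "word_mult u v = foldr cons_letter u v"

definition word_inv :: "'a letter list \<Rightarrow> 'a letter list" where
  "word_inv w = rev (map inv_letter w)"

lemma inv_letter_inv_letter [simp]: "inv_letter (inv_letter l) = l"
  by (simp add: inv_letter_def)

lemma inv_letter_neq [simp]: "inv_letter l \<noteq> l" "l \<noteq> inv_letter l"
  by (cases l; simp add: inv_letter_def)+

lemma reduced_Nil [simp]: "reduced_word []"
  and reduced_Cons: "reduced_word (k # w) \<longleftrightarrow> (w = [] \<or> hd w \<noteq> inv_letter k) \<and> reduced_word w"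
  by (auto simp: reduced_word_def successively_Cons)

lemma reduced_cons_letter: "reduced_word w \<Longrightarrow> reduced_word (cons_letter k w)"
  by (cases w) (auto simp: reduced_Cons)

lemma reduced_word_mult: "reduced_word v \<Longrightarrow> reduced_word (word_mult u v)"
  unfolding word_mult_def by (induction u) (auto intro: reduced_cons_letter)

lemma reduced_word_inv: "reduced_word w \<Longrightarrow> reduced_word (word_inv w)"
proof -
  assume "reduced_word w"
  then have "successively (\<lambda>k l. k \<noteq> inv_letter l) (map inv_letter w)"
    unfolding reduced_word_def successively_map
    by (rule successively_mono) (auto dest: arg_cong[of _ _ inv_letter])
  then show ?thesis
    unfolding reduced_word_def word_inv_def successively_rev by simp
qed

lemma cons_letter_cancel: "reduced_word w \<Longrightarrow> cons_letter (inv_letter k) (cons_letter k w) = w"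
  by (cases w; cases "tl w") (auto simp: reduced_Cons)

lemma word_mult_simps [simp]:
  "word_mult [] v = v" "word_mult (k # u) v = cons_letter k (word_mult u v)"
  by (simp_all add: word_mult_def)

lemma word_mult_cons_letter:
  assumes "reduced_word v"
  shows "word_mult (cons_letter k u) v = cons_letter k (word_mult u v)"
proof (cases u)
  case (Cons l w)
  then show ?thesis
    using cons_letter_cancel[OF reduced_word_mult[OF assms], of "inv_letter k" w] by auto
qed auto

lemma word_mult_assoc:
  assumes "reduced_word w"
  shows "word_mult (word_mult u v) w = word_mult u (word_mult v w)"
  by (induction u) (auto simp: word_mult_cons_letter[OF assms])

lemma word_mult_Nil_right: "reduced_word w \<Longrightarrow> word_mult w [] = w"
proof (induction w)
  case (Cons k w)
  then show ?case by (cases w) (auto simp: reduced_Cons)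
qed auto

lemma word_mult_append: "word_mult (u @ v) w = word_mult u (word_mult v w)"
  by (simp add: word_mult_def)

lemma word_mult_inv_left:
  assumes "reduced_word u"
  shows "word_mult (word_inv u) u = []"
proof -
  have "reduced_word v \<Longrightarrow> word_mult (word_inv u) (word_mult u v) = v" for v
  proof (induction u arbitrary: v)
    case (Cons k u)
    then show ?case
      by (simp add: word_inv_def word_mult_append cons_letter_cancel reduced_word_mult)
  qed (simp add: word_inv_def)
  from this[of "[]"] show ?thesis
    using assms by (simp add: word_mult_Nil_right)
qed

text \<open>The free group on the generators \<^typ>\<open>'a\<close>, as the group of reduced words; the letter
  \<open>(a, True)\<close> stands for \<open>a\<close> and \<open>(a, False)\<close> for its inverse.\<close>

typedef 'a free_group = "{w :: 'a letter list. reduced_word w}"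
  morphisms word of_word
  by (rule exI[of _ "[]"]) simp

setup_lifting type_definition_free_group

instantiation free_group :: (type) "{monoid_mult, inverse}"
begin

lift_definition one_free_group :: "'a free_group" is "[]" by simp
lift_definition times_free_group :: "'a free_group \<Rightarrow> 'a free_group \<Rightarrow> 'a free_group"
  is word_mult by (rule reduced_word_mult)
lift_definition inverse_free_group :: "'a free_group \<Rightarrow> 'a free_group"
  is word_inv by (rule reduced_word_inv)
definition divide_free_group :: "'a free_group \<Rightarrow> 'a free_group \<Rightarrow> 'a free_group" where
  "divide_free_group s t = s * inverse t"

instance
  by standard (transfer; simp add: word_mult_assoc word_mult_Nil_right)+

end

lemma free_group_left_inverse [simp]: "inverse s * s = 1" for s :: "'a free_group"
  by transfer (rule word_mult_inv_left)

text \<open>Complex Hilbert spaces; the inner product is antilinear in its first argument.\<close>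

class chilbert_space = real_inner + complete_space +
  fixes scaleC :: "complex \<Rightarrow> 'a \<Rightarrow> 'a"  (infixr \<open>*\<^sub>C\<close> 75)
    and cinner :: "'a \<Rightarrow> 'a \<Rightarrow> complex"
  assumes scaleC_add_right: "c *\<^sub>C (x + y) = c *\<^sub>C x + c *\<^sub>C y"
    and scaleC_add_left: "(c + d) *\<^sub>C x = c *\<^sub>C x + d *\<^sub>C x"
    and scaleC_scaleC: "c *\<^sub>C d *\<^sub>C x = (c * d) *\<^sub>C x"
    and scaleC_of_real: "complex_of_real r *\<^sub>C x = r *\<^sub>R x"
    and cinner_commute: "cinner x y = cnj (cinner y x)"
    and cinner_add_right: "cinner x (y + z) = cinner x y + cinner x z"
    and cinner_scaleC_right: "cinner x (c *\<^sub>C y) = c * cinner x y"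
    and Re_cinner: "Re (cinner x y) = inner x y"

global_interpretation complex_vector: vector_space "scaleC :: complex \<Rightarrow> 'a \<Rightarrow> 'a::chilbert_space"
  defines cspan = complex_vector.span
proof
  show "1 *\<^sub>C x = x" for x :: 'a
    using scaleC_of_real[of 1 x] by simp
qed (simp_all add: scaleC_add_right scaleC_add_left scaleC_scaleC)


lemma norm_scaleC: "norm (c *\<^sub>C x) = cmod c * norm (x :: 'a::chilbert_space)"
proof -
  have "cinner (c *\<^sub>C x) (c *\<^sub>C x) = c * cnj c * cinner x x"
    using cinner_commute[of "c *\<^sub>C x" x] cinner_commute[of x x]
    by (simp add: cinner_scaleC_right)
  also have "\<dots> = complex_of_real ((cmod c)\<^sup>2) * cinner x x"
    by (metis complex_norm_square)
  finally have "inner (c *\<^sub>C x) (c *\<^sub>C x) = (cmod c)\<^sup>2 * inner x x"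
    by (simp flip: Re_cinner)
  then show ?thesis
    by (simp add: norm_eq_sqrt_inner real_sqrt_mult)
qed

lemma cmod_cinner_le: "cmod (cinner x y) \<le> norm x * norm (y :: 'a::chilbert_space)"
proof (cases "cinner x y = 0")
  case False
  define u where "u = cnj (cinner x y) / cmod (cinner x y)"
  have u: "cmod u = 1"
    using False by (simp add: u_def norm_divide)
  have "cinner x (u *\<^sub>C y) = complex_of_real (cmod (cinner x y))"
    using False complex_norm_square[of "cinner x y"]
    by (simp add: cinner_scaleC_right u_def power2_eq_square mult.commute nonzero_divide_eq_eq)
  then have "cmod (cinner x y) = inner x (u *\<^sub>C y)"
    by (simp flip: Re_cinner)
  also have "\<dots> \<le> norm x * norm (u *\<^sub>C y)"
    by (rule norm_cauchy_schwarz)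
  finally show ?thesis
    by (simp add: norm_scaleC u)
qed simp

text \<open>Square-summable families in \<open>'h\<close>. With index type \<^typ>\<open>'a free_group\<close> this Hilbert space
  is large enough to contain, up to isomorphism, all the spaces \<open>\<R>(A)\<close> needed below:
  for \<open>A\<close> indexed by a finite set \<open>I\<close> of group elements one can take for \<open>\<omega>\<^sub>i\<close> the
  \<open>i\<close>-th column of the square root of \<open>A\<close>.\<close>

typedef (overloaded) ('i, 'h) ell2 =
  "{f :: 'i \<Rightarrow> 'h::real_inner. (\<lambda>i. (norm (f i))\<^sup>2) summable_on UNIV}"
  morphisms coord ell2_of
  by (rule exI[of _ "\<lambda>_. 0"]) simp

setup_lifting type_definition_ell2

lemma square_summable_add:
  fixes f g :: "'i \<Rightarrow> 'h::real_inner"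
  assumes "(\<lambda>i. (norm (f i))\<^sup>2) summable_on UNIV" "(\<lambda>i. (norm (g i))\<^sup>2) summable_on UNIV"
  shows "(\<lambda>i. (norm (f i + g i))\<^sup>2) summable_on UNIV"
proof (rule summable_on_comparison_test)
  show "(\<lambda>i. 2 * (norm (f i))\<^sup>2 + 2 * (norm (g i))\<^sup>2) summable_on UNIV"
    using assms by (intro summable_on_add summable_on_cmult_right)
  fix i
  have "(norm (f i + g i))\<^sup>2 \<le> (norm (f i) + norm (g i))\<^sup>2"
    by (intro power_mono norm_triangle_ineq) auto
  also have "\<dots> \<le> 2 * (norm (f i))\<^sup>2 + 2 * (norm (g i))\<^sup>2"
    using sum_squares_bound[of "norm (f i)" "norm (g i)"] by (simp add: power2_sum)
  finally show "(norm (f i + g i))\<^sup>2 \<le> 2 * (norm (f i))\<^sup>2 + 2 * (norm (g i))\<^sup>2" .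
qed auto

lemma summable_norm_bound_mult:
  fixes f g :: "'i \<Rightarrow> 'h::real_inner" and p :: "'i \<Rightarrow> 'b::banach"
  assumes "(\<lambda>i. (norm (f i))\<^sup>2) summable_on UNIV" "(\<lambda>i. (norm (g i))\<^sup>2) summable_on UNIV"
    and le: "\<And>i. norm (p i) \<le> norm (f i) * norm (g i)"
  shows "p summable_on UNIV"
proof (rule abs_summable_summable, rule summable_on_comparison_test)
  show "(\<lambda>i. (norm (f i))\<^sup>2 + (norm (g i))\<^sup>2) summable_on UNIV"
    using assms(1,2) by (rule summable_on_add)
  fix i
  have "norm (p i) \<le> 2 * norm (f i) * norm (g i)"
    using le[of i] mult_nonneg_nonneg[OF norm_ge_zero[of "f i"] norm_ge_zero[of "g i"]] by linarith
  also have "\<dots> \<le> (norm (f i))\<^sup>2 + (norm (g i))\<^sup>2"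
    by (rule sum_squares_bound)
  finally show "norm (p i) \<le> (norm (f i))\<^sup>2 + (norm (g i))\<^sup>2" .
qed auto

lemma summable_inner:
  fixes f g :: "'i \<Rightarrow> 'h::real_inner"
  assumes "(\<lambda>i. (norm (f i))\<^sup>2) summable_on UNIV" "(\<lambda>i. (norm (g i))\<^sup>2) summable_on UNIV"
  shows "(\<lambda>i. inner (f i) (g i)) summable_on UNIV"
  using assms by (rule summable_norm_bound_mult) (simp add: Cauchy_Schwarz_ineq2)

lemma summable_cinner:
  fixes f g :: "'i \<Rightarrow> 'h::chilbert_space"
  assumes "(\<lambda>i. (norm (f i))\<^sup>2) summable_on UNIV" "(\<lambda>i. (norm (g i))\<^sup>2) summable_on UNIV"
  shows "(\<lambda>i. cinner (f i) (g i)) summable_on UNIV"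
  using assms by (rule summable_norm_bound_mult) (rule cmod_cinner_le)

instantiation ell2 :: (type, real_inner) real_inner
begin

lift_definition zero_ell2 :: "('a, 'b) ell2" is "\<lambda>_. 0" by simp
lift_definition plus_ell2 :: "('a, 'b) ell2 \<Rightarrow> ('a, 'b) ell2 \<Rightarrow> ('a, 'b) ell2"
  is "\<lambda>f g i. f i + g i" by (rule square_summable_add)
lift_definition uminus_ell2 :: "('a, 'b) ell2 \<Rightarrow> ('a, 'b) ell2"
  is "\<lambda>f i. - f i" by simp
lift_definition minus_ell2 :: "('a, 'b) ell2 \<Rightarrow> ('a, 'b) ell2 \<Rightarrow> ('a, 'b) ell2"
  is "\<lambda>f g i. f i - g i"
  using square_summable_add[of _ "\<lambda>i. - g i" for g] by (auto simp: diff_conv_add_uminus simp del: add_uminus_conv_diff)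
lift_definition scaleR_ell2 :: "real \<Rightarrow> ('a, 'b) ell2 \<Rightarrow> ('a, 'b) ell2"
  is "\<lambda>r f i. r *\<^sub>R f i" by (simp add: power_mult_distrib summable_on_cmult_right)
lift_definition inner_ell2 :: "('a, 'b) ell2 \<Rightarrow> ('a, 'b) ell2 \<Rightarrow> real"
  is "\<lambda>f g. \<Sum>\<^sub>\<infinity>i. inner (f i) (g i)" .
definition norm_ell2 :: "('a, 'b) ell2 \<Rightarrow> real" where
  "norm_ell2 x = sqrt (inner x x)"
definition sgn_ell2 :: "('a, 'b) ell2 \<Rightarrow> ('a, 'b) ell2" where
  "sgn_ell2 x = inverse (norm x) *\<^sub>R x"
definition dist_ell2 :: "('a, 'b) ell2 \<Rightarrow> ('a, 'b) ell2 \<Rightarrow> real" where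
  "dist_ell2 x y = norm (x - y)"
definition uniformity_ell2 :: "(('a, 'b) ell2 \<times> ('a, 'b) ell2) filter" where
  "uniformity_ell2 = (INF e\<in>{0<..}. principal {(x, y). dist x y < e})"
definition open_ell2 :: "('a, 'b) ell2 set \<Rightarrow> bool" where
  "open_ell2 U \<longleftrightarrow> (\<forall>x\<in>U. \<forall>\<^sub>F (x', y) in uniformity. x' = x \<longrightarrow> y \<in> U)"

lemma inner_ell2_self: "inner x x = (\<Sum>\<^sub>\<infinity>i. (norm (coord x i))\<^sup>2)" for x :: "('a, 'b) ell2"
  by (simp add: inner_ell2.rep_eq power2_norm_eq_inner)

lemma sum_coord_le:
  fixes x :: "('a, 'b) ell2"
  assumes "finite F"
  shows "(\<Sum>i\<in>F. (norm (coord x i))\<^sup>2) \<le> (norm x)\<^sup>2"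
proof -
  have "(\<Sum>i\<in>F. (norm (coord x i))\<^sup>2) \<le> (\<Sum>\<^sub>\<infinity>i. (norm (coord x i))\<^sup>2)"
    using coord[of x] assms by (intro finite_sum_le_infsum) auto
  moreover have "0 \<le> (\<Sum>\<^sub>\<infinity>i. (norm (coord x i))\<^sup>2)"
    by (intro infsum_nonneg) auto
  ultimately show ?thesis
    by (simp add: norm_ell2_def inner_ell2_self)
qed

lemma norm_coord_le: "norm (coord x i) \<le> norm x" for x :: "('a, 'b) ell2"
proof (rule power2_le_imp_le)
  show "0 \<le> norm x"
    by (auto simp: norm_ell2_def inner_ell2_self intro!: infsum_nonneg)
qed (use sum_coord_le[of "{i}" x] in simp)

instance
proof
  fix x y z :: "('a, 'b) ell2" and r s :: real
  show "x + y + z = x + (y + z)"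
    by transfer (simp add: add.assoc)
  show "x + y = y + x"
    by transfer (simp add: add.commute)
  show "0 + x = x"
    by transfer simp
  show "- x + x = 0"
    by transfer simp
  show "x - y = x + - y"
    by transfer simp
  show "r *\<^sub>R (x + y) = r *\<^sub>R x + r *\<^sub>R y"
    by transfer (simp add: scaleR_add_right)
  show "(r + s) *\<^sub>R x = r *\<^sub>R x + s *\<^sub>R x"
    by transfer (simp add: scaleR_add_left)
  show "r *\<^sub>R s *\<^sub>R x = (r * s) *\<^sub>R x"
    by transfer simp
  show "1 *\<^sub>R x = x"
    by transfer simp
  show "sgn x = inverse (norm x) *\<^sub>R x"
    by (rule sgn_ell2_def)
  show "dist x y = norm (x - y)"
    by (rule dist_ell2_def)
  show "uniformity = (INF e\<in>{0<..}. principal {(x :: ('a, 'b) ell2, y). dist x y < e})"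
    by (rule uniformity_ell2_def)
  show "open U \<longleftrightarrow> (\<forall>x\<in>U. \<forall>\<^sub>F (x', y) in uniformity. x' = x \<longrightarrow> y \<in> U)"
    for U :: "('a, 'b) ell2 set"
    by (rule open_ell2_def)
  show "inner x y = inner y x"
    by transfer (simp add: inner_commute)
  show "inner (x + y) z = inner x z + inner y z"
    by transfer (simp add: inner_add_left infsum_add summable_inner)
  show "inner (r *\<^sub>R x) y = r * inner x y"
    by transfer (simp add: infsum_cmult_right')
  show "0 \<le> inner x x"
    unfolding inner_ell2_self by (intro infsum_nonneg) auto
  show "norm x = sqrt (inner x x)"
    by (rule norm_ell2_def)
  show "inner x x = 0 \<longleftrightarrow> x = 0"
  proof
    assume "inner x x = 0"
    then have "norm (coord x i) \<le> 0" for i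
      using norm_coord_le[of x i] by (simp add: norm_ell2_def)
    then show "x = 0"
      by (simp add: coord_inject[symmetric] zero_ell2.rep_eq fun_eq_iff)
  next
    assume "x = 0"
    then show "inner x x = 0"
      by (simp add: inner_ell2_self zero_ell2.rep_eq)
  qed
qed

end

lemma norm_ell2_le:
  fixes x :: "('a, 'b::real_inner) ell2"
  assumes "e \<ge> 0" "\<And>F. finite F \<Longrightarrow> (\<Sum>i\<in>F. (norm (coord x i))\<^sup>2) \<le> e\<^sup>2"
  shows "norm x \<le> e"
proof -
  have "(\<Sum>\<^sub>\<infinity>i. (norm (coord x i))\<^sup>2) \<le> e\<^sup>2"
    using coord[of x] assms(2) by (intro infsum_le_finite_sums) auto
  then show ?thesis
    using assms(1) by (simp add: norm_ell2_def inner_ell2_self real_le_lsqrt)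
qed

instantiation ell2 :: (type, chilbert_space) chilbert_space
begin

lift_definition scaleC_ell2 :: "complex \<Rightarrow> ('a, 'b) ell2 \<Rightarrow> ('a, 'b) ell2"
  is "\<lambda>c f i. c *\<^sub>C f i"
  by (simp add: norm_scaleC power_mult_distrib summable_on_cmult_right)
lift_definition cinner_ell2 :: "('a, 'b) ell2 \<Rightarrow> ('a, 'b) ell2 \<Rightarrow> complex"
  is "\<lambda>f g. \<Sum>\<^sub>\<infinity>i. cinner (f i) (g i)" .

instance
proof
  fix X :: "nat \<Rightarrow> ('a, 'b) ell2"
  assume X: "Cauchy X"
  have "Cauchy (\<lambda>n. coord (X n) i)" for i
  proof (rule CauchyI)
    fix e :: real assume "e > 0"
    then obtain N where "\<forall>m\<ge>N. \<forall>n\<ge>N. norm (X m - X n) < e"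
      using X CauchyD by blast
    moreover have "norm (coord (X m) i - coord (X n) i) \<le> norm (X m - X n)" for m n
      using norm_coord_le[of "X m - X n" i] by (simp add: minus_ell2.rep_eq)
    ultimately show "\<exists>N. \<forall>m\<ge>N. \<forall>n\<ge>N. norm (coord (X m) i - coord (X n) i) < e"
      by (meson le_less_trans)
  qed
  then have "\<forall>i. \<exists>l. (\<lambda>n. coord (X n) i) \<longlonglongrightarrow> l"
    using Cauchy_convergent convergent_def by blast
  then obtain f where f: "(\<lambda>n. coord (X n) i) \<longlonglongrightarrow> f i" for i
    by metis
  have tail: "\<exists>N. \<forall>m\<ge>N. \<forall>F. finite F \<longrightarrow> (\<Sum>i\<in>F. (norm (coord (X m) i - f i))\<^sup>2) \<le> e\<^sup>2"
    if "e > 0" for e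
  proof -
    obtain N where N: "\<And>m n. m \<ge> N \<Longrightarrow> n \<ge> N \<Longrightarrow> norm (X m - X n) < e"
      using CauchyD[OF X \<open>e > 0\<close>] by blast
    have "(\<Sum>i\<in>F. (norm (coord (X m) i - f i))\<^sup>2) \<le> e\<^sup>2" if "m \<ge> N" "finite F" for m F
    proof (rule tendsto_upperbound)
      show "(\<lambda>n. \<Sum>i\<in>F. (norm (coord (X m) i - coord (X n) i))\<^sup>2)
          \<longlonglongrightarrow> (\<Sum>i\<in>F. (norm (coord (X m) i - f i))\<^sup>2)"
        by (intro tendsto_intros f)
      have "(\<Sum>i\<in>F. (norm (coord (X m) i - coord (X n) i))\<^sup>2) \<le> e\<^sup>2" if "n \<ge> N" for n
        using sum_coord_le[OF \<open>finite F\<close>, of "X m - X n"]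
          power_mono[OF less_imp_le[OF N[OF \<open>m \<ge> N\<close> that]], of 2]
        by (simp add: minus_ell2.rep_eq)
      then show "\<forall>\<^sub>F n in sequentially. (\<Sum>i\<in>F. (norm (coord (X m) i - coord (X n) i))\<^sup>2) \<le> e\<^sup>2"
        unfolding eventually_sequentially by blast
    qed simp
    then show ?thesis
      by blast
  qed
  have f_mem: "(\<lambda>i. (norm (f i))\<^sup>2) summable_on UNIV"
  proof -
    obtain m where m: "\<And>F. finite F \<Longrightarrow> (\<Sum>i\<in>F. (norm (coord (X m) i - f i))\<^sup>2) \<le> 1\<^sup>2"
      using tail[of 1] by auto
    then have "(\<lambda>i. (norm (f i - coord (X m) i))\<^sup>2) summable_on UNIV"
      by (intro nonneg_bdd_above_summable_on bdd_aboveI[of _ 1]) (auto simp: norm_minus_commute)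
    from square_summable_add[OF this, of "coord (X m)"] show ?thesis
      using coord[of "X m"] by simp
  qed
  define x where "x = (ell2_of f :: ('a, 'b) ell2)"
  have coord_x: "coord x = f"
    using f_mem by (simp add: x_def ell2_of_inverse)
  have "X \<longlonglongrightarrow> x"
  proof (rule LIMSEQ_I)
    fix e :: real assume "e > 0"
    then obtain N where N: "\<And>m F. m \<ge> N \<Longrightarrow> finite F \<Longrightarrow>
        (\<Sum>i\<in>F. (norm (coord (X m) i - f i))\<^sup>2) \<le> (e / 2)\<^sup>2"
      using tail[of "e / 2"] by auto
    have "norm (X m - x) \<le> e / 2" if "m \<ge> N" for m
      using N[OF that] \<open>e > 0\<close> by (intro norm_ell2_le) (auto simp: minus_ell2.rep_eq coord_x)
    with \<open>e > 0\<close> show "\<exists>N. \<forall>m\<ge>N. norm (X m - x) < e"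
      by (intro exI[of _ N]) fastforce
  qed
  then show "convergent X"
    by (rule convergentI)
next
  fix x y z :: "('a, 'b) ell2" and c d :: complex and r :: real
  show "c *\<^sub>C (x + y) = c *\<^sub>C x + c *\<^sub>C y"
    by transfer (simp add: scaleC_add_right)
  show "(c + d) *\<^sub>C x = c *\<^sub>C x + d *\<^sub>C x"
    by transfer (simp add: scaleC_add_left)
  show "c *\<^sub>C d *\<^sub>C x = (c * d) *\<^sub>C x"
    by transfer (simp add: scaleC_scaleC)
  show "complex_of_real r *\<^sub>C x = r *\<^sub>R x"
    by transfer (simp add: scaleC_of_real)
  show "cinner x y = cnj (cinner y x)"
    by transfer (metis (no_types, lifting) cinner_commute infsum_cnj infsum_cong)
  show "cinner x (y + z) = cinner x y + cinner x z"
    by transfer (simp add: cinner_add_right infsum_add summable_cinner)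
  show "cinner x (c *\<^sub>C y) = c * cinner x y"
    by transfer (simp add: cinner_scaleC_right infsum_cmult_right')
  show "Re (cinner x y) = inner x y"
    by transfer (simp add: infsum_Re[symmetric] summable_cinner Re_cinner)
qed

end

definition bounded_clinear :: "('h::chilbert_space \<Rightarrow> 'k::chilbert_space) \<Rightarrow> bool" where
  "bounded_clinear T \<longleftrightarrow> bounded_linear T \<and> (\<forall>c x. T (c *\<^sub>C x) = c *\<^sub>C T x)"

definition orth_diff :: "'h::chilbert_space set \<Rightarrow> 'h set \<Rightarrow> 'h set"  (infixl \<open>\<ominus>\<close> 65) where
  "M \<ominus> N = {x \<in> M. \<forall>y\<in>N. cinner y x = 0}"

definition orth_proj :: "'h::chilbert_space set \<Rightarrow> 'h \<Rightarrow> 'h" where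
  "orth_proj M x = (THE y. y \<in> M \<and> (\<forall>z\<in>M. cinner z (x - y) = 0))"

text \<open>Contractions between the subspaces \<open>D\<close> and \<open>R\<close>; as operators with domain \<open>D\<close> they are
  functions that are \<^const>\<open>undefined\<close> outside \<open>D\<close>.\<close>

definition contractions :: "'h::chilbert_space set \<Rightarrow> 'k::chilbert_space set \<Rightarrow> ('h \<Rightarrow> 'k) set" where
  "contractions D R = {c \<in> D \<rightarrow>\<^sub>E R.
     (\<forall>x\<in>D. \<forall>y\<in>D. c (x + y) = c x + c y) \<and> (\<forall>a. \<forall>x\<in>D. c (a *\<^sub>C x) = a *\<^sub>C c x) \<and>
     (\<forall>x\<in>D. norm (c x) \<le> norm x)}"


definition word_length :: "'a free_group \<Rightarrow> nat" where
  "word_length s = length (word s)"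

definition common_begin :: "'a free_group \<Rightarrow> 'a free_group \<Rightarrow> 'a free_group" where
  "common_begin s t = of_word (longest_common_prefix (word s) (word t))"

text \<open>Only meaningful for \<open>s \<noteq> 1\<close>.\<close>

definition first_letter :: "'a free_group \<Rightarrow> 'a free_group" where
  "first_letter s = of_word [hd (word s)]"

type_synonym 'a ord = "'a free_group \<Rightarrow> 'a free_group \<Rightarrow> bool"

definition lexicographic :: "'a ord \<Rightarrow> bool" where
  "lexicographic le \<longleftrightarrow> reflp le \<and> transp le \<and> antisymp le \<and> totalp le \<and>
     (\<forall>s\<^sub>1 s\<^sub>2. word_length s\<^sub>1 < word_length s\<^sub>2 \<longrightarrow> le s\<^sub>1 s\<^sub>2) \<and>
     (\<forall>s\<^sub>1 s\<^sub>2. word_length s\<^sub>1 = word_length s\<^sub>2 \<and> s\<^sub>1 \<noteq> s\<^sub>2 \<and>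
        (let t = common_begin s\<^sub>1 s\<^sub>2
         in le (first_letter (inverse t * s\<^sub>1)) (first_letter (inverse t * s\<^sub>2)))
        \<longrightarrow> le s\<^sub>1 s\<^sub>2)"

definition hat :: "'a free_group \<Rightarrow> 'a free_group set" where
  "hat s = {s, inverse s}"

definition F_hat :: "'a free_group set set" where
  "F_hat = range hat"

text \<open>\<open>least le \<mu>\<close> is the element \<open>s\<^sub>\<mu>\<close> of \<open>\<mu> = {s\<^sub>\<mu>, s\<^sub>\<mu>\<^sup>-\<^sup>1}\<close>.\<close>

definition least :: "'a ord \<Rightarrow> 'a free_group set \<Rightarrow> 'a free_group" where
  "least le \<mu> = (THE s. s \<in> \<mu> \<and> (\<forall>t\<in>\<mu>. le s t))"

definition hat_le :: "'a ord \<Rightarrow> 'a free_group set \<Rightarrow> 'a free_group set \<Rightarrow> bool" where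
  "hat_le le \<mu> \<mu>' \<longleftrightarrow> le (least le \<mu>) (least le \<mu>')"

definition hat_less :: "'a ord \<Rightarrow> 'a free_group set \<Rightarrow> 'a free_group set \<Rightarrow> bool" where
  "hat_less le \<mu> \<mu>' \<longleftrightarrow> hat_le le \<mu> \<mu>' \<and> \<mu> \<noteq> \<mu>'"

definition hat_above :: "'a ord \<Rightarrow> 'a free_group set \<Rightarrow> 'a free_group set set" where
  "hat_above le \<nu> = {\<mu> \<in> F_hat. hat_less le \<nu> \<mu>}"

definition predecessor :: "'a ord \<Rightarrow> 'a free_group set \<Rightarrow> 'a free_group set" where
  "predecessor le \<mu> = (THE \<kappa>. \<kappa> \<in> F_hat \<and> hat_less le \<kappa> \<mu> \<and>
     (\<forall>\<kappa>'\<in>F_hat. hat_less le \<kappa>' \<mu> \<longrightarrow> hat_le le \<kappa>' \<kappa>))"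

definition Sig :: "'a ord \<Rightarrow> 'a free_group set \<Rightarrow> 'a free_group set" where
  "Sig le \<mu> = \<Union> {\<mu>' \<in> F_hat. hat_le le \<mu>' \<mu>}"

definition adjacent :: "'a ord \<Rightarrow> 'a free_group set \<Rightarrow> 'a free_group \<Rightarrow> 'a free_group \<Rightarrow> bool" where
  "adjacent le \<mu> s t \<longleftrightarrow> s \<noteq> t \<and> hat_le le (hat (inverse s * t)) \<mu>"

definition clique :: "'a ord \<Rightarrow> 'a free_group set \<Rightarrow> 'a free_group set \<Rightarrow> bool" where
  "clique le \<mu> K \<longleftrightarrow> (\<forall>s\<in>K. \<forall>t\<in>K. s \<noteq> t \<longrightarrow> adjacent le \<mu> s t)"

definition maximal_clique :: "'a ord \<Rightarrow> 'a free_group set \<Rightarrow> 'a free_group set \<Rightarrow> bool" where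
  "maximal_clique le \<mu> K \<longleftrightarrow> clique le \<mu> K \<and> (\<forall>K'. clique le \<mu> K' \<and> K \<subseteq> K' \<longrightarrow> K' = K)"

definition clique_of :: "'a ord \<Rightarrow> 'a free_group set \<Rightarrow> 'a free_group set" where
  "clique_of le \<mu> = (THE K. maximal_clique le \<mu> K \<and> 1 \<in> K \<and> least le \<mu> \<in> K)"


definition positive_semidefinite :: "'i set \<Rightarrow> ('i \<Rightarrow> 'i \<Rightarrow> 'h::chilbert_space \<Rightarrow> 'h) \<Rightarrow> bool" where
  "positive_semidefinite I A \<longleftrightarrow>
     (\<forall>h. (\<Sum>i\<in>I. \<Sum>j\<in>I. cinner (h i) (A i j (h j))) \<in> \<real>\<^sub>\<ge>\<^sub>0)"

text \<open>Functions \<open>\<Sigma> \<rightarrow> \<L>(\<H>)\<close> are represented by functions on the whole group, whose values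
  outside \<open>\<Sigma>\<close> are irrelevant.\<close>

definition positive_definite ::
    "'a free_group set \<Rightarrow> ('a free_group \<Rightarrow> 'h::chilbert_space \<Rightarrow> 'h) \<Rightarrow> bool" where
  "positive_definite \<Sigma> \<phi> \<longleftrightarrow> (\<forall>s\<in>\<Sigma>. bounded_clinear (\<phi> s)) \<and>
     (\<forall>k (s :: nat \<Rightarrow> 'a free_group). (\<forall>i<k. \<forall>j<k. inverse (s i) * s j \<in> \<Sigma>) \<longrightarrow>
        positive_semidefinite {..<k} (\<lambda>i j. \<phi> (inverse (s i) * s j)))"

definition kernel_matrix ::
    "('a free_group \<Rightarrow> 'h \<Rightarrow> 'h) \<Rightarrow> 'a free_group \<Rightarrow> 'a free_group \<Rightarrow> 'h \<Rightarrow> 'h" where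
  "kernel_matrix \<phi> s t = \<phi> (inverse s * t)"

text \<open>The identity \<open>A\<^sub>i\<^sub>j = \<omega>\<^sub>i\<^sup>* \<omega>\<^sub>j\<close>, spelled out with the inner product.\<close>

definition realizes :: "'i set \<Rightarrow> ('i \<Rightarrow> 'i \<Rightarrow> 'h \<Rightarrow> 'h) \<Rightarrow>
    ('i \<Rightarrow> 'h::chilbert_space \<Rightarrow> 'k::chilbert_space) \<Rightarrow> bool" where
  "realizes I A \<omega> \<longleftrightarrow> (\<forall>i\<in>I. bounded_clinear (\<omega> i)) \<and>
     (\<forall>i\<in>I. \<forall>j\<in>I. \<forall>h h'. cinner (\<omega> i h) (\<omega> j h') = cinner h (A i j h'))"

definition closed_range_span ::
    "'i set \<Rightarrow> ('i \<Rightarrow> 'h \<Rightarrow> 'k::chilbert_space) \<Rightarrow> 'k set" where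
  "closed_range_span J \<omega> = closure (cspan (\<Union>i\<in>J. range (\<omega> i)))"

text \<open>A choice of the operators \<open>\<omega>\<^sub>i\<close> for the matrix \<open>A\<close> on \<open>I\<close>. It depends only on the entries of
  \<open>A\<close> in \<open>I \<times> I\<close>. The space \<open>\<R>(A)\<close> is then \<open>closed_range_span I (realization I A)\<close>, and its
  subspace identified with \<open>\<R>(A|J)\<close> is \<open>closed_range_span J (realization I A)\<close>.\<close>

definition realization :: "'a free_group set \<Rightarrow>
    ('a free_group \<Rightarrow> 'a free_group \<Rightarrow> 'h \<Rightarrow> 'h) \<Rightarrow>
    'a free_group \<Rightarrow> 'h \<Rightarrow> ('a free_group, 'h::chilbert_space) ell2" where
  "realization I A = (SOME \<omega>. realizes I A \<omega>)"

text \<open>The canonical identification of the closed span of the \<open>\<omega>\<^sub>i \<H>\<close> with that of the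
  \<open>\<Omega>\<^sub>i \<H>\<close>, \<open>i \<in> J\<close>, where \<open>\<omega>\<^sub>i\<^sup>* \<omega>\<^sub>j = \<Omega>\<^sub>i\<^sup>* \<Omega>\<^sub>j\<close>: the operator mapping \<open>\<omega>\<^sub>i h\<close> to \<open>\<Omega>\<^sub>i h\<close>. It is
  unique and isometric on the closed span of the \<open>\<omega>\<^sub>i \<H>\<close>, and arbitrary elsewhere.\<close>

definition identification :: "'i set \<Rightarrow> ('i \<Rightarrow> 'h \<Rightarrow> 'k::chilbert_space) \<Rightarrow>
    ('i \<Rightarrow> 'h \<Rightarrow> 'k) \<Rightarrow> 'k \<Rightarrow> 'k" where
  "identification J \<omega> \<Omega> = (SOME U. bounded_clinear U \<and> (\<forall>i\<in>J. \<forall>h. U (\<omega> i h) = \<Omega> i h))"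


definition D_space :: "'a ord \<Rightarrow> 'a free_group set \<Rightarrow> ('a free_group \<Rightarrow> 'h \<Rightarrow> 'h) \<Rightarrow>
    ('a free_group, 'h::chilbert_space) ell2 set" where
  "D_space le \<mu> \<psi> =
     (let S = clique_of le \<mu> - {least le \<mu>}; \<omega> = realization S (kernel_matrix \<psi>)
      in closed_range_span S \<omega> \<ominus> closed_range_span (clique_of le \<mu> - {1, least le \<mu>}) \<omega>)"

definition R_space :: "'a ord \<Rightarrow> 'a free_group set \<Rightarrow> ('a free_group \<Rightarrow> 'h \<Rightarrow> 'h) \<Rightarrow>
    ('a free_group, 'h::chilbert_space) ell2 set" where
  "R_space le \<mu> \<psi> =
     (let S = clique_of le \<mu> - {1}; \<omega> = realization S (kernel_matrix \<psi>)
      in closed_range_span S \<omega> \<ominus> closed_range_span (clique_of le \<mu> - {1, least le \<mu>}) \<omega>)"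

text \<open>\<open>U\<^sub>D\<close> and \<open>U\<^sub>R\<close> embed \<open>D(\<psi>)\<close> and \<open>R(\<psi>)\<close> into \<open>\<R>(A(\<Phi>;C\<^sub>\<mu>))\<close>, where the projection is
  taken.\<close>

definition gamma :: "'a ord \<Rightarrow> 'a free_group set \<Rightarrow> ('a free_group \<Rightarrow> 'h \<Rightarrow> 'h) \<Rightarrow>
    ('a free_group, 'h::chilbert_space) ell2 \<Rightarrow> ('a free_group, 'h) ell2" where
  "gamma le \<mu> \<Phi> =
     (let \<psi> = restrict \<Phi> (Sig le (predecessor le \<mu>));
          S\<^sub>D = clique_of le \<mu> - {least le \<mu>};
          S\<^sub>R = clique_of le \<mu> - {1};
          \<Omega> = realization (clique_of le \<mu>) (kernel_matrix \<Phi>);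
          U\<^sub>D = identification S\<^sub>D (realization S\<^sub>D (kernel_matrix \<psi>)) \<Omega>;
          U\<^sub>R = identification S\<^sub>R (realization S\<^sub>R (kernel_matrix \<psi>)) \<Omega>
      in (\<lambda>d\<in>D_space le \<mu> \<psi>. THE r. r \<in> R_space le \<mu> \<psi> \<and>
           U\<^sub>R r = orth_proj (U\<^sub>R ` R_space le \<mu> \<psi>) (U\<^sub>D d)))"

text \<open>The positive definite extensions of \<open>\<phi>\<close> from \<open>\<Sigma>\<close> to \<open>\<Sigma>'\<close>, for \<open>\<Sigma> \<subseteq> \<Sigma>'\<close>.\<close>

definition extensions :: "'a free_group set \<Rightarrow> 'a free_group set \<Rightarrow>
    ('a free_group \<Rightarrow> 'h::chilbert_space \<Rightarrow> 'h) \<Rightarrow> ('a free_group \<Rightarrow> 'h \<Rightarrow> 'h) set" where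
  "extensions \<Sigma> \<Sigma>' \<phi> = {\<Phi>. positive_definite \<Sigma>' \<Phi> \<and> (\<forall>s\<in>\<Sigma>. \<Phi> s = \<phi> s)}"

text \<open>The sequences \<open>(\<gamma>\<^sub>\<mu>)\<close>, \<open>\<nu> \<prec> \<mu>\<close>, of contractions whose domain and range spaces are determined
  by \<open>\<phi>\<close> and the previously chosen contractions: \<open>\<gamma>\<^sub>\<mu>\<close> acts from \<open>D(\<psi>)\<close> to \<open>R(\<psi>)\<close>, where \<open>\<psi>\<close> is
  the extension of \<open>\<phi>\<close> to \<open>\<Sigma>\<close> of the predecessor of \<open>\<mu>\<close> having the parameters \<open>\<gamma>\<^sub>\<mu>\<^sub>'\<close>,
  \<open>\<nu> \<prec> \<mu>' \<prec> \<mu>\<close>. If there were no such \<open>\<psi>\<close>, there would be no restriction on \<open>\<gamma>\<^sub>\<mu>\<close>; so the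
  statement that every such sequence comes from an extension includes the existence of \<open>\<psi>\<close>.\<close>

definition contraction_sequences :: "'a ord \<Rightarrow> 'a free_group set \<Rightarrow>
    ('a free_group \<Rightarrow> 'h::chilbert_space \<Rightarrow> 'h) \<Rightarrow>
    ('a free_group set \<Rightarrow> ('a free_group, 'h) ell2 \<Rightarrow> ('a free_group, 'h) ell2) set" where
  "contraction_sequences le \<nu> \<phi> = {g \<in> extensional (hat_above le \<nu>).
     \<forall>\<mu>\<in>hat_above le \<nu>. \<forall>\<psi>\<in>extensions (Sig le \<nu>) (Sig le (predecessor le \<mu>)) \<phi>.
       (\<forall>\<mu>'\<in>hat_above le \<nu>. hat_less le \<mu>' \<mu> \<longrightarrow> gamma le \<mu>' \<psi> = g \<mu>') \<longrightarrow>
       g \<mu> \<in> contractions (D_space le \<mu> \<psi>) (R_space le \<mu> \<psi>)}"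

end

theory Submission
  imports Defs
begin

text \<open>
  The extension proceeds along the classes \<open>\<mu> \<succ> \<nu>\<close> in their order, one class at a time, because
  passing from \<open>\<Sigma>\<^sub>\<mu>\<^sub>-\<close> to \<open>\<Sigma>\<^sub>\<mu>\<close> amounts to filling in a single entry of a single operator matrix.

  The reason is combinatorial. Positive definiteness on \<open>\<Sigma>\<^sub>\<mu>\<close> means that the matrices indexed by the
  finite cliques of \<open>\<Gamma>\<^sub>\<mu>\<close> are positive semidefinite. A clique that uses a new edge can be translated
  so that this edge becomes \<open>{1, s\<^sub>\<mu>}\<close>. The vertices \<open>1\<close> and \<open>s\<^sub>\<mu>\<close> together with all their common
  neighbours form a clique, in which \<open>{1, s\<^sub>\<mu>}\<close> is the only new edge (\<open>common_neighbours_adjacent\<close>,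
  which is where the lexicographic order and the tree structure of the free group enter). So all
  these cliques lie in \<open>C\<^sub>\<mu>\<close>, and the only unknown entry there is the one at \<open>(1, s\<^sub>\<mu>)\<close> together with
  its adjoint (\<open>positive_definite_step\<close>).

  Filling in one entry is operator theory. Let \<open>C\<close> be the common part and \<open>p, q\<close> the two remaining
  indices. The submatrices on \<open>C \<union> {p}\<close> and \<open>C \<union> {q}\<close> have realizations \<open>\<omega>\<close> and \<open>\<rho>\<close>, which are
  identified on \<open>C\<close>. In a realization \<open>\<Omega>\<close> of a completion, \<open>\<Omega>\<^sub>p h\<close> and \<open>\<Omega>\<^sub>q h'\<close> have prescribed
  components in the common space, and the missing entry is determined by the inner products of
  their orthogonal components, that is, by the compression \<open>\<gamma>\<close> from \<open>D\<close> to \<open>R\<close>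
  (\<open>entry_eq_compression\<close>). Conversely, inserting an arbitrary contraction into this formula yields
  a quadratic form that is visibly nonnegative (\<open>positive_semidefinite_completion\<close>), and the
  contraction can be recovered from the entry (\<open>contraction_unique\<close>).

  The spaces \<open>\<R>(A)\<close> exist inside the square-summable families because \<open>A\<close>, viewed as a positive
  operator on such families, has a square root (\<open>exists_square_root\<close>), obtained from the binomial
  series of \<open>sqrt (1 - x)\<close>.
  Finally the single steps are iterated along the sequence of classes, which has order type
  \<open>\<omega>\<close>, and the union of the partial extensions is positive definite since finitely many quotients lie
  in one \<open>\<Sigma>\<^sub>\<mu>\<close> (\<open>exists_extension_with_gammas\<close>).
\<close>

section \<open>Words in the free group\<close>

interpretation free_group: group "(*)" 1 "inverse :: 'a free_group \<Rightarrow> 'a free_group"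
  by standard simp_all

lemma reduced_append:
  "reduced_word (u @ v) \<longleftrightarrow>
    reduced_word u \<and> reduced_word v \<and> (u = [] \<or> v = [] \<or> hd v \<noteq> inv_letter (last u))"
  by (auto simp: reduced_word_def successively_append_iff)

lemma word_inv_append: "word_inv (u @ v) = word_inv v @ word_inv u"
  by (simp add: word_inv_def)

lemma length_word_inv [simp]: "length (word_inv w) = length w"
  by (simp add: word_inv_def)

lemma word_inv_Nil [simp]: "word_inv [] = []"
  by (simp add: word_inv_def)

lemma reduced_word_word [simp]: "reduced_word (word s)"
  using word[of s] by simp

lemma word_of_word [simp]: "reduced_word w \<Longrightarrow> word (of_word w) = w"
  by (simp add: of_word_inverse)

lemma last_word_inv: "w \<noteq> [] \<Longrightarrow> last (word_inv w) = inv_letter (hd w)"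
  by (simp add: word_inv_def last_rev hd_map)

lemma word_one [simp]: "word 1 = []"
  by (rule one_free_group.rep_eq)

lemma word_eq_Nil_iff [simp]: "word s = [] \<longleftrightarrow> s = 1"
  by (metis word_inject word_one)

lemma word_inverse [simp]: "word (inverse s) = word_inv (word s)"
  by (rule inverse_free_group.rep_eq)

lemma word_length_inverse [simp]: "word_length (inverse s) = word_length s"
  by (simp add: word_length_def)

lemma word_mult_reduced_append: "reduced_word (u @ v) \<Longrightarrow> word_mult u v = u @ v"
  using word_mult_Nil_right[of "u @ v"] word_mult_Nil_right[of v]
  by (simp add: word_mult_append reduced_append)

lemma length_cons_letter:
  "length (cons_letter k w) \<le> Suc (length w)"
  "length (cons_letter k w) = Suc (length w) \<Longrightarrow> cons_letter k w = k # w"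
  by (cases w; auto split: if_splits)+

lemma length_word_mult: "length (word_mult u v) \<le> length u + length v"
  by (induction u) (auto intro: order_trans[OF length_cons_letter(1)])

text \<open>Every cancellation shortens the product, so a product of full length is the concatenation.\<close>

lemma word_mult_eq_append:
  "length (word_mult u v) = length u + length v \<Longrightarrow> word_mult u v = u @ v"
proof (induction u)
  case (Cons k u)
  have len: "length (cons_letter k (word_mult u v)) = Suc (length u + length v)"
    using Cons.prems by simp
  then have "length (word_mult u v) = length u + length v"
    using length_word_mult[of u v] length_cons_letter(1)[of k "word_mult u v"] by linarith
  with len have "cons_letter k (word_mult u v) = k # word_mult u v" "word_mult u v = u @ v"
    by (auto intro: length_cons_letter(2) Cons.IH)
  then show ?case by simp
qed simp

lemma word_inverse_mult_common_prefix:
  assumes s: "word s = w @ u" and t: "word t = w @ v"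
  shows "word (inverse s * t) = word_mult (word_inv u) v"
proof -
  have red: "reduced_word (w @ v)" "reduced_word w" "reduced_word v"
    using reduced_word_word[of t] by (auto simp: t reduced_append)
  have "word (inverse s * t) = word_mult (word_inv u) (word_mult (word_inv w) (word_mult w v))"
    by (simp add: times_free_group.rep_eq s t word_inv_append word_mult_append
        word_mult_reduced_append[OF red(1)])
  also have "word_mult (word_inv w) (word_mult w v) = v"
    by (simp add: word_mult_assoc[OF red(3), symmetric] word_mult_inv_left[OF red(2)])
  finally show ?thesis .
qed

lemma word_inverse_mult_first_difference:
  assumes s: "word s = w @ u" and t: "word t = w @ v" and diff: "u = [] \<or> v = [] \<or> hd u \<noteq> hd v"
  shows "word (inverse s * t) = word_inv u @ v"
proof -
  have "reduced_word u" "reduced_word v"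
    using reduced_word_word[of s] reduced_word_word[of t] by (simp_all add: s t reduced_append)
  then have "reduced_word (word_inv u @ v)"
    using diff by (cases "u = []") (auto simp: reduced_append reduced_word_inv last_word_inv)
  then show ?thesis
    unfolding word_inverse_mult_common_prefix[OF s t] by (rule word_mult_reduced_append)
qed

lemma obtain_common_prefix:
  obtains w u v where "xs = w @ u" "ys = w @ v" "u = [] \<or> v = [] \<or> hd u \<noteq> hd v"
proof -
  let ?w = "longest_common_prefix xs ys"
  obtain u v where uv: "xs = ?w @ u" "ys = ?w @ v"
    using longest_common_prefix_prefix1[of xs ys] longest_common_prefix_prefix2[of xs ys]
    by (auto elim!: prefixE)
  have "u = [] \<or> v = [] \<or> hd u \<noteq> hd v"
  proof (rule ccontr)
    assume "\<not> ?thesis"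
    then obtain k u' v' where "u = k # u'" "v = k # v'"
      by (cases u; cases v) auto
    then have "prefix (?w @ [k]) xs" "prefix (?w @ [k]) ys"
      using uv by (metis append.assoc append_Cons append_Nil prefixI)+
    then have "prefix (?w @ [k]) ?w"
      by (rule longest_common_prefix_max_prefix)
    then show False by simp
  qed
  with uv that show thesis by blast
qed

text \<open>If the first halves agreed, the letter in the middle of \<open>s\<close> would be its own inverse, or the two
  letters in the middle would cancel.\<close>

lemma inverse_prefix_neq:
  assumes "s \<noteq> 1" and m: "word_length s \<le> 2 * m"
  shows "take m (word s) \<noteq> take m (word (inverse s))"
proof
  assume eq: "take m (word s) = take m (word (inverse s))"
  let ?w = "word s" and ?n = "word_length s"
  define i where "i = (?n - 1) div 2"
  have n: "?n > 0" "length ?w = ?n"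
    using assms(1) by (simp_all add: word_length_def)
  then have i: "i < m" "i < ?n"
    using m unfolding i_def by linarith+
  then have "?w ! i = word_inv ?w ! i"
    using arg_cong[OF eq, of "\<lambda>l. l ! i"] by simp
  also have "\<dots> = inv_letter (?w ! (?n - 1 - i))"
    using i n by (simp add: word_inv_def rev_nth)
  finally have inv: "?w ! i = inv_letter (?w ! (?n - 1 - i))" .
  show False
  proof (cases "even ?n")
    case True
    then obtain k where "?n = 2 * k" ..
    then have "i = k - 1" "k > 0"
      using n unfolding i_def by presburger+
    then have "?n - 1 - i = Suc i" "Suc i < ?n"
      using \<open>?n = 2 * k\<close> by auto
    then have "?w ! Suc i = inv_letter (?w ! i)" "Suc i < length ?w"
      using inv n by simp_all
    moreover have "successively (\<lambda>k l. l \<noteq> inv_letter k) ?w"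
      using reduced_word_word[of s] by (simp add: reduced_word_def)
    ultimately show False
      by (simp add: successively_conv_nth)
  next
    case False
    then have "?n - 1 - i = i"
      using n by (auto simp: i_def elim!: oddE)
    then show False
      using inv inv_letter_neq by metis
  qed
qed

lemma finite_word_length_le: "finite {s :: 'a::finite free_group. word_length s \<le> n}"
proof (rule finite_imageD)
  show "inj_on word {s. word_length s \<le> n}"
    by (simp add: inj_on_def word_inject)
  have "word ` {s. word_length s \<le> n} \<subseteq> {w. set w \<subseteq> UNIV \<and> length w \<le> n}"
    by (auto simp: word_length_def)
  then show "finite (word ` {s :: 'a free_group. word_length s \<le> n})"
    by (rule finite_subset) (intro finite_lists_length_le, simp)
qed

lemma exists_word_length: "\<exists>s :: 'a free_group. word_length s = n"
proof -
  have "reduced_word (replicate n (undefined :: 'a, True))"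
    by (induction n) (auto simp: reduced_Cons inv_letter_def)
  then have "word_length (of_word (replicate n (undefined :: 'a, True))) = n"
    by (simp add: word_length_def)
  then show ?thesis by blast
qed

lemma hat_inverse [simp]: "hat (inverse s) = hat s"
  by (auto simp: hat_def)

lemma hat_eq_iff: "hat s = hat t \<longleftrightarrow> s = t \<or> s = inverse t"
  by (auto simp: hat_def doubleton_eq_iff)

lemma inverse_inverse_mult: "inverse (inverse s * t) = inverse t * s" for s t :: "'a free_group"
  by (simp add: free_group.inverse_distrib_swap)

lemma hat_in_F_hat [simp]: "hat s \<in> F_hat"
  by (simp add: F_hat_def)

section \<open>Lexicographic orders\<close>

locale lexicographic_order =
  fixes le :: "'a::finite ord"
  assumes lexicographic: "lexicographic le"
begin

lemma le_linear: "reflp le" "transp le" "antisymp le" "totalp le"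
  using lexicographic by (simp_all add: lexicographic_def)

lemmas le_refl [simp] = reflpD[OF le_linear(1)]
lemmas le_trans = transpD[OF le_linear(2)]
lemmas le_antisym = antisympD[OF le_linear(3)]

lemma le_total: "le s t \<or> le t s"
  using totalpD[OF le_linear(4), of s t] by (cases "s = t") auto

lemma le_if_shorter: "word_length s < word_length t \<Longrightarrow> le s t"
  using lexicographic by (simp add: lexicographic_def)

lemma word_length_mono: "le s t \<Longrightarrow> word_length s \<le> word_length t"
  by (metis le_antisym le_if_shorter linorder_not_less order_refl)

text \<open>For words of equal length the defining property of lexicographic orders is an equivalence,
  because the order is total and antisymmetric.\<close>

lemma le_iff_first_difference:
  assumes s: "word s = w @ k # u" and t: "word t = w @ l # v"
    and len: "length u = length v" and kl: "k \<noteq> l"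
  shows "le s t \<longleftrightarrow> le (of_word [k]) (of_word [l])"
proof -
  have imp: "le s t" if s: "word s = w @ k # u" and t: "word t = w @ l # v"
    and len: "length u = length v" and kl: "k \<noteq> l" and le: "le (of_word [k]) (of_word [l])"
    for s t k l u v
  proof -
    have "reduced_word w"
      using reduced_word_word[of s] by (simp add: s reduced_append)
    have "longest_common_prefix (word s) (word t) = w"
      unfolding s t using kl by (induction w) auto
    then have cb: "common_begin s t = of_word w"
      by (simp add: common_begin_def)
    have w: "word (of_word w) = w @ []"
      using \<open>reduced_word w\<close> by simp
    have "first_letter (inverse (of_word w) * s) = of_word [k]"
      "first_letter (inverse (of_word w) * t) = of_word [l]"
      by (simp_all add: first_letter_def word_inverse_mult_first_difference[OF w s]
          word_inverse_mult_first_difference[OF w t])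
    moreover have "word_length s = word_length t"
      by (simp add: word_length_def s t len)
    moreover have "s \<noteq> t"
      using kl s t by auto
    ultimately show ?thesis
      using lexicographic le unfolding lexicographic_def Let_def cb[symmetric] by metis
  qed
  show ?thesis
  proof
    assume st: "le s t"
    show "le (of_word [k]) (of_word [l])"
    proof (rule ccontr)
      assume "\<not> ?thesis"
      then have "le t s"
        using imp[OF t s len[symmetric]] kl le_total by blast
      then have "s = t"
        using st by (rule le_antisym[rotated])
      then show False
        using s t kl by simp
    qed
  qed (rule imp[OF s t len kl])
qed

text \<open>The comparison is decided inside different initial segments, so what follows them can be
  exchanged.\<close>

lemma le_prefix_cong:
  assumes ab: "length a = length b" "a \<noteq> b"
    and s: "word s = a @ u" and t: "word t = b @ v" "length u = length v"
    and s': "word s' = a @ u'" and t': "word t' = b @ v'" "length u' = length v'"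
  shows "le s t \<longleftrightarrow> le s' t'"
proof -
  obtain w k x l y where w: "a = w @ k # x" "b = w @ l # y" "k \<noteq> l"
    using same_length_different[OF ab(2,1)] by auto
  have len: "length x = length y"
    using ab(1) by (simp add: w)
  show ?thesis
    using le_iff_first_difference[of s w k "x @ u" t l "y @ v"]
      le_iff_first_difference[of s' w k "x @ u'" t' l "y @ v'"] assms w len by simp
qed

text \<open>If \<open>s\<close> had a different initial segment, it would be on the same side of \<open>r\<close> and of \<open>t\<close>.\<close>

lemma take_eq_of_between:
  assumes len: "word_length r = word_length s" "word_length s = word_length t"
    and le: "le r s" "le s t" and eq: "take m (word r) = take m (word t)"
  shows "take m (word s) = take m (word t)"
proof (rule ccontr)
  assume neq: "\<not> ?thesis"
  have r: "word r = take m (word t) @ drop m (word r)"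
    by (simp flip: eq)
  note split = append_take_drop_id[symmetric]
  have "le r s \<longleftrightarrow> le t s"
    by (rule le_prefix_cong[OF _ _ r split[of "word s" m] _ split split])
      (use neq len in \<open>auto simp: word_length_def\<close>)
  then show False
    using le le_antisym neq by blast
qed

subsection \<open>Classes of inverse pairs\<close>

lemma
  shows least_in: "least le (hat s) \<in> hat s" and least_le: "t \<in> hat s \<Longrightarrow> le (least le (hat s)) t"
proof -
  have "\<exists>!r. r \<in> hat s \<and> (\<forall>t\<in>hat s. le r t)"
    unfolding hat_def using le_total[of s "inverse s"] le_antisym by auto
  from theI'[OF this] show "least le (hat s) \<in> hat s" "t \<in> hat s \<Longrightarrow> le (least le (hat s)) t"
    unfolding least_def by auto
qed

lemma least_hat: "least le (hat s) = s \<or> least le (hat s) = inverse s"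
  using least_in[of s] by (auto simp: hat_def)

lemma least_hat_le: "le (least le (hat s)) s" "le (least le (hat s)) (inverse s)"
  by (intro least_le; simp add: hat_def)+

lemma hat_least: "\<mu> \<in> F_hat \<Longrightarrow> hat (least le \<mu>) = \<mu>"
  unfolding F_hat_def using least_hat by (metis hat_inverse imageE)

lemma word_length_least [simp]: "word_length (least le (hat s)) = word_length s"
  using least_hat[of s] by auto

lemma hat_le_refl [simp]: "hat_le le \<mu> \<mu>"
  by (simp add: hat_le_def)

lemma hat_le_trans: "hat_le le \<kappa> \<mu> \<Longrightarrow> hat_le le \<mu> \<nu> \<Longrightarrow> hat_le le \<kappa> \<nu>"
  unfolding hat_le_def by (rule le_trans)

lemma hat_le_total: "hat_le le \<kappa> \<mu> \<or> hat_le le \<mu> \<kappa>"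
  unfolding hat_le_def by (rule le_total)

lemma hat_le_antisym:
  "\<kappa> \<in> F_hat \<Longrightarrow> \<mu> \<in> F_hat \<Longrightarrow> hat_le le \<kappa> \<mu> \<Longrightarrow> hat_le le \<mu> \<kappa> \<Longrightarrow> \<kappa> = \<mu>"
  unfolding hat_le_def by (metis hat_least le_antisym)

lemma hat_less_iff: "\<kappa> \<in> F_hat \<Longrightarrow> \<mu> \<in> F_hat \<Longrightarrow> hat_less le \<kappa> \<mu> \<longleftrightarrow> \<not> hat_le le \<mu> \<kappa>"
  unfolding hat_less_def using hat_le_antisym hat_le_total by blast

lemma hat_le_word_length: "hat_le le (hat s) (hat t) \<Longrightarrow> word_length s \<le> word_length t"
  unfolding hat_le_def using word_length_mono by fastforce

lemma hat_less_if_shorter: "word_length s < word_length t \<Longrightarrow> hat_less le (hat s) (hat t)"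
  using hat_le_word_length[of t s] by (auto simp: hat_less_iff)

lemma hat_one_le: "\<mu> \<in> F_hat \<Longrightarrow> hat_le le (hat 1) \<mu>"
proof -
  assume "\<mu> \<in> F_hat"
  then obtain s where s: "\<mu> = hat s" by (auto simp: F_hat_def)
  show ?thesis
  proof (cases "s = 1")
    case False
    then have "hat_less le (hat 1) (hat s)"
      by (intro hat_less_if_shorter) (simp add: word_length_def)
    then show ?thesis by (simp add: hat_less_def s)
  qed (simp add: s)
qed

lemma mem_Sig_iff: "s \<in> Sig le \<mu> \<longleftrightarrow> hat_le le (hat s) \<mu>"
proof
  assume "s \<in> Sig le \<mu>"
  then obtain t where t: "s \<in> hat t" "hat_le le (hat t) \<mu>"
    by (auto simp: Sig_def F_hat_def)
  then have "hat s = hat t"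
    by (simp add: hat_eq_iff) (simp add: hat_def)
  with t show "hat_le le (hat s) \<mu>" by simp
next
  assume "hat_le le (hat s) \<mu>"
  moreover have "s \<in> hat s" by (simp add: hat_def)
  ultimately show "s \<in> Sig le \<mu>"
    unfolding Sig_def by (intro UnionI[of "hat s"]) simp_all
qed

lemma one_mem_Sig: "\<mu> \<in> F_hat \<Longrightarrow> 1 \<in> Sig le \<mu>"
  by (simp add: mem_Sig_iff hat_one_le)

lemma finite_Sig: "\<mu> \<in> F_hat \<Longrightarrow> finite (Sig le \<mu>)"
proof -
  assume "\<mu> \<in> F_hat"
  then obtain t where "\<mu> = hat t" by (auto simp: F_hat_def)
  then have "Sig le \<mu> \<subseteq> {s. word_length s \<le> word_length t}"
    using hat_le_word_length by (auto simp: mem_Sig_iff)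
  then show ?thesis
    using finite_word_length_le finite_subset by blast
qed

lemma Sig_mono: "hat_le le \<kappa> \<mu> \<Longrightarrow> Sig le \<kappa> \<subseteq> Sig le \<mu>"
  using hat_le_trans by (auto simp: mem_Sig_iff)

lemma card_Sig_less:
  assumes "\<kappa> \<in> F_hat" "\<mu> \<in> F_hat" "hat_less le \<kappa> \<mu>"
  shows "card (Sig le \<kappa>) < card (Sig le \<mu>)"
proof (rule psubset_card_mono[OF finite_Sig[OF assms(2)]])
  have "least le \<mu> \<in> Sig le \<mu>" "least le \<mu> \<notin> Sig le \<kappa>"
    using assms hat_less_iff by (simp_all add: mem_Sig_iff hat_least)
  moreover have "Sig le \<kappa> \<subseteq> Sig le \<mu>"
    using assms(3) by (intro Sig_mono) (simp add: hat_less_def)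
  ultimately show "Sig le \<kappa> \<subset> Sig le \<mu>" by blast
qed

lemma finite_hat_le: "\<mu> \<in> F_hat \<Longrightarrow> finite {\<kappa> \<in> F_hat. hat_le le \<kappa> \<mu>}"
  by (rule finite_subset[of _ "hat ` Sig le \<mu>"]) (auto simp: finite_Sig mem_Sig_iff F_hat_def)

lemma exists_hat_max:
  assumes "finite X" "X \<noteq> {}"
  shows "\<exists>\<kappa>\<in>X. \<forall>\<kappa>'\<in>X. hat_le le \<kappa>' \<kappa>"
  using assms
proof (induction rule: finite_ne_induct)
  case (insert \<mu> X)
  then show ?case using hat_le_total hat_le_trans hat_le_refl by (metis insert_iff)
qed simp

lemma exists_hat_min:
  assumes "finite X" "X \<noteq> {}"
  shows "\<exists>\<kappa>\<in>X. \<forall>\<kappa>'\<in>X. hat_le le \<kappa> \<kappa>'"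
  using assms
proof (induction rule: finite_ne_induct)
  case (insert \<mu> X)
  then show ?case using hat_le_total hat_le_trans hat_le_refl by (metis insert_iff)
qed simp

lemma predecessor_eqI:
  assumes "\<kappa> \<in> F_hat" "\<mu> \<in> F_hat" "hat_less le \<kappa> \<mu>"
    and "\<And>\<kappa>'. \<kappa>' \<in> F_hat \<Longrightarrow> hat_less le \<kappa>' \<mu> \<Longrightarrow> hat_le le \<kappa>' \<kappa>"
  shows "predecessor le \<mu> = \<kappa>"
  unfolding predecessor_def using assms hat_le_antisym by (intro the_equality) blast+

lemma
  assumes \<mu>: "\<mu> \<in> F_hat" and ne: "\<mu> \<noteq> hat 1"
  shows predecessor_in_F_hat: "predecessor le \<mu> \<in> F_hat"
    and predecessor_less: "hat_less le (predecessor le \<mu>) \<mu>"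
    and predecessor_greatest: "\<kappa> \<in> F_hat \<Longrightarrow> hat_less le \<kappa> \<mu> \<Longrightarrow> hat_le le \<kappa> (predecessor le \<mu>)"
proof -
  let ?X = "{\<kappa> \<in> F_hat. hat_less le \<kappa> \<mu>}"
  have "finite ?X"
    by (rule finite_subset[OF _ finite_hat_le[OF \<mu>]]) (auto simp: hat_less_def)
  moreover have "hat 1 \<in> ?X"
    using ne hat_one_le[OF \<mu>] by (auto simp: hat_less_def)
  ultimately obtain \<kappa> where "\<kappa> \<in> ?X" "\<forall>\<kappa>'\<in>?X. hat_le le \<kappa>' \<kappa>"
    using exists_hat_max[of ?X] by blast
  then have \<kappa>: "\<kappa> \<in> F_hat" "hat_less le \<kappa> \<mu>"
    "\<And>\<kappa>'. \<kappa>' \<in> F_hat \<Longrightarrow> hat_less le \<kappa>' \<mu> \<Longrightarrow> hat_le le \<kappa>' \<kappa>" by auto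
  then show "predecessor le \<mu> \<in> F_hat" "hat_less le (predecessor le \<mu>) \<mu>"
    "\<kappa> \<in> F_hat \<Longrightarrow> hat_less le \<kappa> \<mu> \<Longrightarrow> hat_le le \<kappa> (predecessor le \<mu>)" for \<kappa>
    using predecessor_eqI[OF \<kappa>(1) \<mu> \<kappa>(2,3)] by auto
qed

lemma mem_Sig_predecessor_iff:
  assumes "\<mu> \<in> F_hat" "\<mu> \<noteq> hat 1"
  shows "s \<in> Sig le (predecessor le \<mu>) \<longleftrightarrow> s \<in> Sig le \<mu> \<and> s \<notin> \<mu>"
proof -
  have "s \<in> \<mu> \<longleftrightarrow> hat s = \<mu>"
    using assms(1) by (auto simp: F_hat_def hat_def)
  then show ?thesis
    using predecessor_less[OF assms] predecessor_greatest[OF assms, of "hat s"]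
      hat_less_iff[OF predecessor_in_F_hat[OF assms] assms(1)]
      hat_le_trans unfolding mem_Sig_iff hat_less_def by (metis hat_in_F_hat)
qed

subsection \<open>The maximal clique containing the new edge\<close>

text \<open>In the Cayley tree, with \<open>s = s\<^sub>\<mu>\<close>, both \<open>t\<close> and \<open>u\<close> hang off the geodesic from \<open>1\<close> to \<open>s\<close>; \<open>a\<close> and \<open>b\<close> lead to
  the branching points. The length bounds give \<open>|t\<^sup>-\<^sup>1 u| \<le> |s|\<close>. In case of equality the words of
  \<open>s\<close> and \<open>t\<^sup>-\<^sup>1 s\<close> differ only in the initial segments \<open>a\<close> and \<open>x\<^sup>-\<^sup>1\<close> of equal length, and replacing
  the common remainder shows that \<open>t\<^sup>-\<^sup>1 u\<close> strictly precedes \<open>s\<close>, unless \<open>t = 1\<close>.\<close>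

lemma common_neighbours_adjacent_aux:
  assumes \<mu>: "\<mu> \<in> F_hat" "\<mu> \<noteq> hat 1" and s_def: "s = least le \<mu>"
    and t: "hat_le le (hat t) \<mu>" "hat_le le (hat (inverse t * s)) \<mu>"
    and u: "hat_le le (hat u) \<mu>" "hat_le le (hat (inverse u * s)) \<mu>"
    and wt: "word t = a @ x" and wsa: "word s = a @ s'" and ax: "x = [] \<or> s' = [] \<or> hd x \<noteq> hd s'"
    and wu: "word u = b @ y" and wsb: "word s = b @ s''" and bx: "y = [] \<or> s'' = [] \<or> hd y \<noteq> hd s''"
    and ab: "length a \<le> length b"
  shows "hat_le le (hat (inverse t * u)) \<mu> \<and> (hat (inverse t * u) = \<mu> \<longrightarrow> t = 1 \<and> u = s)"
proof -
  have \<mu>_eq: "\<mu> = hat s"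
    using hat_least[OF \<mu>(1)] by (simp add: s_def)
  have s1: "s \<noteq> 1"
    using \<mu>(2) \<mu>_eq by auto
  have s_le: "le s (inverse s)"
    using least_hat_le(2)[of s] by (simp only: \<mu>_eq[symmetric] s_def[symmetric])
  let ?n = "word_length s"
  have n: "?n = length a + length s'" "?n = length b + length s''"
    using arg_cong[OF wsa, of length] arg_cong[OF wsb, of length] by (simp_all add: word_length_def)
  obtain b' where b: "b = a @ b'" and s': "s' = b' @ s''"
    using wsa wsb ab by (auto simp: append_eq_append_conv2)
  have word_ts: "word (inverse t * s) = word_inv x @ s'"
    by (rule word_inverse_mult_first_difference[OF wt wsa ax])
  have word_us: "word (inverse u * s) = word_inv y @ s''"
    by (rule word_inverse_mult_first_difference[OF wu wsb bx])
  have x_le: "length x \<le> length a" "length a + length x \<le> ?n"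
    using hat_le_word_length[of "inverse t * s" s] hat_le_word_length[of t s] t n
    by (simp_all add: \<mu>_eq word_length_def word_ts wt)
  have y_le: "length y \<le> length b" "length b + length y \<le> ?n"
    using hat_le_word_length[of "inverse u * s" s] hat_le_word_length[of u s] u n
    by (simp_all add: \<mu>_eq word_length_def word_us wu)
  have word_tu: "word (inverse t * u) = word_mult (word_inv x) (b' @ y)"
    by (rule word_inverse_mult_common_prefix[OF wt]) (simp add: wu b)
  have tu_le: "word_length (inverse t * u) \<le> length x + (length b' + length y)"
    unfolding word_length_def word_tu using length_word_mult[of "word_inv x" "b' @ y"] by simp
  have len_b: "length b = length a + length b'"
    by (simp add: b)
  show ?thesis
  proof (cases "word_length (inverse t * u) < ?n")
    case True
    from hat_less_if_shorter[OF this] show ?thesis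
      by (simp add: \<mu>_eq hat_less_def)
  next
    case False
    then have eqs: "length x = length a" "length b + length y = ?n"
      "word_length (inverse t * u) = length x + (length b' + length y)"
      using tu_le x_le y_le len_b by linarith+
    then have word_tu': "word (inverse t * u) = word_inv x @ b' @ y"
      using word_mult_eq_append[of "word_inv x" "b' @ y"] word_tu by (simp add: word_length_def)
    show ?thesis
    proof (cases "a = []")
      case True
      then have "t = 1"
        using eqs(1) wt by simp
      moreover have "u \<noteq> inverse s"
      proof
        assume "u = inverse s"
        then have "word (inverse s) = b @ y"
          using wu by simp
        moreover have "take (length b) (word s) \<noteq> take (length b) (word (inverse s))"
          using y_le(1) eqs(2) by (intro inverse_prefix_neq[OF s1]) simp
        ultimately show False
          using wsb by simp
      qed
      moreover have "inverse t * u = u"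
        using \<open>t = 1\<close> by simp
      ultimately show ?thesis
        using u(1) by (auto simp: \<mu>_eq hat_eq_iff)
    next
      case False
      then have "t \<noteq> 1"
        using wt by auto
      have neq: "word_inv x \<noteq> a"
      proof
        assume "word_inv x = a"
        then have "word (inverse t * s) = word s"
          by (simp add: word_ts wsa)
        then have "inverse t * s = 1 * s"
          by (simp add: word_inject)
        then have "inverse t = 1"
          by (simp only: free_group.right_cancel)
        then show False
          using \<open>t \<noteq> 1\<close> by (metis free_group.inverse_inverse free_group.inverse_neutral)
      qed
      \<comment> \<open>Otherwise \<open>s\<^sup>-\<^sup>1 t\<close> precedes \<open>s\<close>, which precedes \<open>s\<^sup>-\<^sup>1\<close>. As \<open>s\<^sup>-\<^sup>1 t\<close> and \<open>s\<^sup>-\<^sup>1\<close> agree on at least the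
        first half, so do \<open>s\<close> and \<open>s\<^sup>-\<^sup>1\<close>.\<close>
      have ts_le: "le (inverse t * s) s"
      proof (rule ccontr)
        assume "\<not> ?thesis"
        moreover have "le (least le (hat (inverse t * s))) s"
          using t(2) by (simp add: hat_le_def s_def)
        ultimately have ts: "le (inverse (inverse t * s)) s"
          using least_hat[of "inverse t * s"] by auto
        have pre: "take (length s') (word (inverse (inverse t * s)))
            = take (length s') (word (inverse s))"
          unfolding word_inverse word_ts by (simp add: wsa word_inv_append)
        have len: "word_length (inverse t * s) = ?n"
          using eqs(1) n(1) by (simp add: word_length_def word_ts)
        have "take (length s') (word s) = take (length s') (word (inverse s))"
          by (rule take_eq_of_between[OF _ _ ts s_le pre]) (simp_all only: word_length_inverse len)
        moreover have "?n \<le> 2 * length s'"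
          using x_le(2) eqs(1) n(1) by simp
        ultimately show False
          using inverse_prefix_neq[OF s1] by blast
      qed
      have "le (inverse t * u) s \<longleftrightarrow> le (inverse t * s) s"
        by (rule le_prefix_cong[OF _ neq word_tu' wsa _ word_ts wsa refl])
          (use eqs n(1) len_b in \<open>auto\<close>)
      then have tu_s: "le (inverse t * u) s"
        using ts_le by simp
      moreover have "inverse t * u \<noteq> s"
      proof
        assume "inverse t * u = s"
        then have "word_inv x @ b' @ y = a @ s'"
          using word_tu' wsa by simp
        then show False
          using neq eqs(1) by (simp add: append_eq_append_conv)
      qed
      moreover have "inverse t * u \<noteq> inverse s"
        using tu_s s_le calculation(2) le_antisym by metis
      moreover have "hat_le le (hat (inverse t * u)) \<mu>"
        unfolding hat_le_def s_def[symmetric] using le_trans[OF least_hat_le(1) tu_s] .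
      ultimately show ?thesis
        by (simp add: \<mu>_eq hat_eq_iff)
    qed
  qed
qed

text \<open>By the symmetry between \<open>t\<close> and \<open>u\<close> it may be assumed that \<open>t\<close> branches off first.\<close>

lemma common_neighbours_adjacent:
  assumes \<mu>: "\<mu> \<in> F_hat" "\<mu> \<noteq> hat 1" and s_def: "s = least le \<mu>"
    and t: "hat_le le (hat t) \<mu>" "hat_le le (hat (inverse t * s)) \<mu>"
    and u: "hat_le le (hat u) \<mu>" "hat_le le (hat (inverse u * s)) \<mu>"
  shows "hat_le le (hat (inverse t * u)) \<mu> \<and> (hat (inverse t * u) = \<mu> \<longrightarrow> {t, u} = {1, s})"
proof -
  obtain a x s' where t': "word t = a @ x" "word s = a @ s'" "x = [] \<or> s' = [] \<or> hd x \<noteq> hd s'"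
    by (rule obtain_common_prefix)
  obtain b y s'' where u': "word u = b @ y" "word s = b @ s''" "y = [] \<or> s'' = [] \<or> hd y \<noteq> hd s''"
    by (rule obtain_common_prefix)
  have swap: "hat (inverse u * t) = hat (inverse t * u)"
    by (metis hat_inverse inverse_inverse_mult)
  show ?thesis
  proof (cases "length a \<le> length b")
    case True
    then show ?thesis
      using common_neighbours_adjacent_aux[OF \<mu> s_def t u t' u'] by blast
  next
    case False
    then show ?thesis
      using common_neighbours_adjacent_aux[OF \<mu> s_def u t u' t'] unfolding swap
      by auto
  qed
qed

lemma clique_of_eq:
  assumes \<mu>: "\<mu> \<in> F_hat" "\<mu> \<noteq> hat 1"
  shows "clique_of le \<mu> = {t. hat_le le (hat t) \<mu> \<and> hat_le le (hat (inverse t * least le \<mu>)) \<mu>}"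
    (is "_ = ?K")
proof -
  let ?s = "least le \<mu>"
  have s: "?s \<noteq> 1"
    using \<mu> hat_least by metis
  have mem: "1 \<in> ?K" "?s \<in> ?K"
    using hat_one_le[OF \<mu>(1)] by (simp_all add: hat_least[OF \<mu>(1)] free_group.inverse_neutral)
  have K: "clique le \<mu> ?K"
    using common_neighbours_adjacent[OF \<mu> refl] by (auto simp: clique_def adjacent_def)
  have sub: "L \<subseteq> ?K" if L: "clique le \<mu> L" "1 \<in> L" "?s \<in> L" for L
  proof
    fix t assume t: "t \<in> L"
    have "hat_le le (hat t) \<mu>"
      using L t mem(1) by (cases "t = 1") (auto simp: clique_def adjacent_def free_group.inverse_neutral
          dest: bspec[of L _ 1])
    moreover have "hat_le le (hat (inverse t * ?s)) \<mu>"
      using L t mem(1) by (cases "t = ?s") (auto simp: clique_def adjacent_def)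
    ultimately show "t \<in> ?K" by simp
  qed
  show ?thesis
    unfolding clique_of_def
  proof (rule the_equality)
    show "maximal_clique le \<mu> ?K \<and> 1 \<in> ?K \<and> ?s \<in> ?K"
      unfolding maximal_clique_def
    proof (intro conjI K mem allI impI)
      fix L assume L: "clique le \<mu> L \<and> ?K \<subseteq> L"
      have "L \<subseteq> ?K"
        by (intro sub conjunct1[OF L] subsetD[OF conjunct2[OF L]] mem)
      then show "L = ?K"
        by (rule equalityI[OF _ conjunct2[OF L]])
    qed
    fix L assume L: "maximal_clique le \<mu> L \<and> 1 \<in> L \<and> ?s \<in> L"
    have clique: "clique le \<mu> L" and max: "\<And>L'. clique le \<mu> L' \<Longrightarrow> L \<subseteq> L' \<Longrightarrow> L' = L"
      using conjunct1[OF L] unfolding maximal_clique_def by blast+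
    have "?K = L"
      by (rule max[OF K sub[OF clique conjunct1[OF conjunct2[OF L]] conjunct2[OF conjunct2[OF L]]]])
    then show "L = ?K" by (rule sym)
  qed
qed

end

section \<open>Complex Hilbert spaces\<close>

lemma cinner_add_left: "cinner (x + y) z = cinner x z + cinner y z"
  by (metis cinner_add_right cinner_commute complex_cnj_add)

lemma cinner_scaleC_left: "cinner (c *\<^sub>C x) y = cnj c * cinner x y"
  by (metis cinner_commute cinner_scaleC_right complex_cnj_mult)

lemma bounded_bilinear_cinner: "bounded_bilinear (cinner :: 'a::chilbert_space \<Rightarrow> 'a \<Rightarrow> complex)"
proof
  fix x y z :: 'a and r :: real
  show "cinner (x + y) z = cinner x z + cinner y z" by (rule cinner_add_left)
  show "cinner x (y + z) = cinner x y + cinner x z" by (rule cinner_add_right)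
  show "cinner (r *\<^sub>R x) y = r *\<^sub>R cinner x y"
    by (simp add: cinner_scaleC_left scaleR_conv_of_real flip: scaleC_of_real)
  show "cinner x (r *\<^sub>R y) = r *\<^sub>R cinner x y"
    by (simp add: cinner_scaleC_right scaleR_conv_of_real flip: scaleC_of_real)
  show "\<exists>K. \<forall>x y :: 'a. norm (cinner x y) \<le> norm x * norm y * K"
    using cmod_cinner_le by (metis mult.right_neutral)
qed

interpretation cinner: bounded_bilinear cinner
  by (rule bounded_bilinear_cinner)

lemma cinner_self: "cinner x x = complex_of_real ((norm x)\<^sup>2)"
proof (rule complex_eqI)
  show "Im (cinner x x) = Im (complex_of_real ((norm x)\<^sup>2))"
    using arg_cong[OF cinner_commute[of x x], of Im] by simp
qed (simp add: Re_cinner power2_norm_eq_inner)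

lemma cinner_eq_zero_iff [simp]: "cinner x x = 0 \<longleftrightarrow> x = 0"
  by (simp add: cinner_self)

lemma cinner_ext: "x = y" if "\<And>z. cinner z x = cinner z y"
  using that[of "x - y"] cinner_eq_zero_iff[of "x - y"] by (simp add: cinner.diff_right)

lemma cinner_zero_commute: "cinner x y = 0 \<longleftrightarrow> cinner y x = 0"
  by (metis cinner_commute complex_cnj_zero)

lemma norm_add_orthogonal:
  assumes "cinner x y = 0"
  shows "(norm (x + y))\<^sup>2 = (norm x)\<^sup>2 + (norm y)\<^sup>2"
proof -
  have "inner x y = 0"
    using assms by (simp flip: Re_cinner)
  then show ?thesis
    by (simp add: power2_norm_eq_inner inner_add_left inner_add_right inner_commute)
qed

lemma bounded_clinearI:
  assumes "\<And>x y. T (x + y) = T x + T y" "\<And>c x. T (c *\<^sub>C x) = c *\<^sub>C T x"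
    and "\<And>x. norm (T x) \<le> K * norm x"
  shows "bounded_clinear T"
  unfolding bounded_clinear_def
proof (intro conjI allI assms(2) bounded_linear_intro[where K = K] assms(1))
  show "T (r *\<^sub>R x) = r *\<^sub>R T x" for r x
    using assms(2)[of "complex_of_real r" x] by (simp add: scaleC_of_real)
  show "norm (T x) \<le> norm x * K" for x
    using assms(3)[of x] by (simp add: mult.commute)
qed

lemma bounded_clinear_linear: "bounded_clinear T \<Longrightarrow> bounded_linear T"
  by (simp add: bounded_clinear_def)

lemmas bounded_clinear_add = bounded_linear.linear[OF bounded_clinear_linear, THEN linear_add]
lemmas bounded_clinear_zero = bounded_linear.linear[OF bounded_clinear_linear, THEN linear_0]
lemmas bounded_clinear_diff = bounded_linear.linear[OF bounded_clinear_linear, THEN linear_diff]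
lemmas bounded_clinear_sum = bounded_linear.linear[OF bounded_clinear_linear, THEN linear_sum]

lemmas bounded_clinear_scaleR = bounded_linear.linear[OF bounded_clinear_linear, THEN linear_scale]

lemma bounded_clinear_scaleC: "bounded_clinear T \<Longrightarrow> T (c *\<^sub>C x) = c *\<^sub>C T x"
  by (simp add: bounded_clinear_def)

lemma bounded_clinear_compose:
  assumes "bounded_clinear S" "bounded_clinear T"
  shows "bounded_clinear (\<lambda>x. S (T x))"
  using assms bounded_linear_compose[of S T] by (simp add: bounded_clinear_def)

lemma bounded_clinear_plus:
  assumes "bounded_clinear S" "bounded_clinear T"
  shows "bounded_clinear (\<lambda>x. S x + T x)"
  using assms bounded_linear_add[of S T] by (simp add: bounded_clinear_def scaleC_add_right)

lemma bounded_clinear_bound: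
  assumes "bounded_clinear T"
  obtains K where "K > 0" "\<And>x. norm (T x) \<le> norm x * K"
  using bounded_linear.pos_bounded[OF bounded_clinear_linear[OF assms]] by blast

definition closed_csubspace :: "'a::chilbert_space set \<Rightarrow> bool" where
  "closed_csubspace M \<longleftrightarrow> complex_vector.subspace M \<and> closed M"

lemma closed_csubspace_zero: "closed_csubspace M \<Longrightarrow> 0 \<in> M"
  and closed_csubspace_add: "closed_csubspace M \<Longrightarrow> x \<in> M \<Longrightarrow> y \<in> M \<Longrightarrow> x + y \<in> M"
  and closed_csubspace_diff: "closed_csubspace M \<Longrightarrow> x \<in> M \<Longrightarrow> y \<in> M \<Longrightarrow> x - y \<in> M"
  and closed_csubspace_scaleC: "closed_csubspace M \<Longrightarrow> x \<in> M \<Longrightarrow> c *\<^sub>C x \<in> M"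
  by (simp_all add: closed_csubspace_def complex_vector.subspace_0 complex_vector.subspace_add
      complex_vector.subspace_diff complex_vector.subspace_scale)

lemma closed_csubspace_scaleR: "closed_csubspace M \<Longrightarrow> x \<in> M \<Longrightarrow> r *\<^sub>R x \<in> M"
  using closed_csubspace_scaleC[of M x "complex_of_real r"] by (simp add: scaleC_of_real)

lemma bounded_clinear_scaleC_right: "bounded_clinear (\<lambda>x :: 'a::chilbert_space. c *\<^sub>C x)"
  by (rule bounded_clinearI[where K = "cmod c"])
    (simp_all add: scaleC_add_right scaleC_scaleC norm_scaleC mult.commute)

lemma closure_sequentialI:
  fixes x :: "'a::metric_space"
  shows "(\<And>n. f n \<in> M) \<Longrightarrow> f \<longlonglongrightarrow> x \<Longrightarrow> x \<in> closure M"
  unfolding closure_sequential by (intro exI[of _ f]) simp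

lemma closed_csubspace_closure:
  assumes "complex_vector.subspace M"
  shows "closed_csubspace (closure M)"
  unfolding closed_csubspace_def
proof (intro conjI closed_closure complex_vector.subspaceI)
  show "0 \<in> closure M"
    using complex_vector.subspace_0[OF assms] closure_subset by blast
next
  fix x y assume "x \<in> closure M" "y \<in> closure M"
  then obtain f g where "\<And>n. f n \<in> M" "f \<longlonglongrightarrow> x" "\<And>n. g n \<in> M" "g \<longlonglongrightarrow> y"
    unfolding closure_sequential by metis
  then have "\<forall>n. f n + g n \<in> M" "(\<lambda>n. f n + g n) \<longlonglongrightarrow> x + y"
    using complex_vector.subspace_add[OF assms] by (auto intro: tendsto_add)
  then show "x + y \<in> closure M"
    by (intro closure_sequentialI) auto
next
  fix c and x assume "x \<in> closure M"
  then obtain f where "\<And>n. f n \<in> M" "f \<longlonglongrightarrow> x"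
    unfolding closure_sequential by metis
  then have "\<forall>n. c *\<^sub>C f n \<in> M" "(\<lambda>n. c *\<^sub>C f n) \<longlonglongrightarrow> c *\<^sub>C x"
    using complex_vector.subspace_scale[OF assms]
      bounded_linear.tendsto[OF bounded_clinear_linear[OF bounded_clinear_scaleC_right]] by auto
  then show "c *\<^sub>C x \<in> closure M"
    by (intro closure_sequentialI) auto
qed

lemma closed_csubspace_orth: "closed_csubspace {x. \<forall>y\<in>S. cinner y x = 0}"
proof -
  have "{x. \<forall>y\<in>S. cinner y x = 0} = (\<Inter>y\<in>S. {x. cinner y x = 0})" by auto
  moreover have "closed {x. cinner y x = 0}" for y :: 'a
    by (intro closed_Collect_eq continuous_intros cinner.continuous_on)
  ultimately have "closed {x. \<forall>y\<in>S. cinner y x = 0}" by auto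
  then show ?thesis
    unfolding closed_csubspace_def
    by (auto intro!: complex_vector.subspaceI
        simp: cinner_add_right cinner_scaleC_right cinner.zero_right)
qed

lemma closed_csubspace_Int: "closed_csubspace M \<Longrightarrow> closed_csubspace N \<Longrightarrow> closed_csubspace (M \<inter> N)"
  by (auto simp: closed_csubspace_def complex_vector.subspace_inter)

lemma closed_csubspace_orth_diff: "closed_csubspace M \<Longrightarrow> closed_csubspace (M \<ominus> N)"
  using closed_csubspace_Int[OF _ closed_csubspace_orth[of N], of M]
  by (simp add: orth_diff_def Int_def)

text \<open>By the parallelogram law a sequence in \<open>M\<close> minimizing the distance to \<open>x\<close> is Cauchy. Its limit \<open>y\<close>
  is a nearest point, and perturbing \<open>y\<close> in a direction \<open>z \<in> M\<close> shows that \<open>x - y\<close> is orthogonal to \<open>z\<close>.\<close>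

lemma exists_orthogonal_projection:
  assumes M: "closed_csubspace M"
  shows "\<exists>y\<in>M. \<forall>z\<in>M. cinner z (x - y) = 0"
proof -
  define \<delta> where "\<delta> = (INF y\<in>M. (norm (x - y))\<^sup>2)"
  have bdd: "bdd_below ((\<lambda>y. (norm (x - y))\<^sup>2) ` M)"
    by (rule bdd_belowI[of _ 0]) auto
  have \<delta>_le: "\<delta> \<le> (norm (x - y))\<^sup>2" if "y \<in> M" for y
    unfolding \<delta>_def using bdd that by (rule cINF_lower)
  have "\<exists>y\<in>M. (norm (x - y))\<^sup>2 < \<delta> + 1 / Suc n" for n
  proof -
    have "Inf ((\<lambda>y. (norm (x - y))\<^sup>2) ` M) < \<delta> + 1 / Suc n"
      by (simp add: \<delta>_def)
    then show ?thesis
      using closed_csubspace_zero[OF M] bdd by (subst (asm) cINF_less_iff) auto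
  qed
  then obtain Y where Y: "Y n \<in> M" "(norm (x - Y n))\<^sup>2 < \<delta> + 1 / Suc n" for n
    by metis
  have par: "(norm (Y m - Y n))\<^sup>2 \<le> 2 * (1 / Suc m) + 2 * (1 / Suc n)" for m n
  proof -
    define z where "z = (1/2) *\<^sub>R (Y m + Y n)"
    have "z \<in> M"
      unfolding z_def by (intro closed_csubspace_scaleR closed_csubspace_add M Y)
    have "(norm (Y m - Y n))\<^sup>2
        = 2 * (norm (x - Y m))\<^sup>2 + 2 * (norm (x - Y n))\<^sup>2 - 4 * (norm (x - z))\<^sup>2"
      by (simp add: z_def power2_norm_eq_inner inner_add_left inner_add_right inner_diff_left
          inner_diff_right inner_commute algebra_simps)
    then show ?thesis
      using \<delta>_le[OF \<open>z \<in> M\<close>] Y(2)[of m] Y(2)[of n] by linarith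
  qed
  have "Cauchy Y"
  proof (rule CauchyI)
    fix e :: real assume "e > 0"
    then obtain N :: nat where N: "inverse (Suc N) < e\<^sup>2 / 4"
      using reals_Archimedean[of "e\<^sup>2 / 4"] by auto
    have "norm (Y m - Y n) < e" if "m \<ge> N" "n \<ge> N" for m n
    proof (rule power_less_imp_less_base)
      have "1 / Suc m \<le> 1 / Suc N" "1 / Suc n \<le> 1 / Suc N"
        using that by (auto intro!: divide_left_mono)
      then show "(norm (Y m - Y n))\<^sup>2 < e\<^sup>2"
        using par[of m n] N unfolding inverse_eq_divide by linarith
    qed (use \<open>e > 0\<close> in auto)
    then show "\<exists>N. \<forall>m\<ge>N. \<forall>n\<ge>N. norm (Y m - Y n) < e" by blast
  qed
  then obtain y where y: "Y \<longlonglongrightarrow> y"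
    using Cauchy_convergent convergent_def by blast
  have "y \<in> M"
    using closed_sequentially[OF _ Y(1) y] M by (simp add: closed_csubspace_def)
  have "(norm (x - y))\<^sup>2 \<le> \<delta>"
  proof (rule LIMSEQ_le)
    show "(\<lambda>n. (norm (x - Y n))\<^sup>2) \<longlonglongrightarrow> (norm (x - y))\<^sup>2"
      by (intro tendsto_intros y)
    show "(\<lambda>n. \<delta> + 1 / Suc n) \<longlonglongrightarrow> \<delta>"
      using tendsto_add[OF tendsto_const[of \<delta>] LIMSEQ_inverse_real_of_nat]
      by (simp add: inverse_eq_divide)
  qed (use Y(2) less_imp_le in blast)
  have re0: "inner z (x - y) = 0" if "z \<in> M" for z
  proof (cases "z = 0")
    case False
    \<comment> \<open>\<open>y + t z\<close> is the point nearest to \<open>x\<close> on the line through \<open>y\<close> in direction \<open>z\<close>\<close>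
    define t where "t = inner z (x - y) / (norm z)\<^sup>2"
    have "y + t *\<^sub>R z \<in> M"
      by (intro closed_csubspace_add closed_csubspace_scaleR M \<open>y \<in> M\<close> that)
    then have "(norm (x - y))\<^sup>2 \<le> (norm ((x - y) - t *\<^sub>R z))\<^sup>2"
      unfolding diff_diff_eq by (intro order_trans[OF \<open>(norm (x - y))\<^sup>2 \<le> \<delta>\<close>] \<delta>_le)
    also have "\<dots> = (norm (x - y))\<^sup>2 - 2 * t * inner z (x - y) + t * t * (norm z)\<^sup>2"
      unfolding power2_norm_eq_inner
      by (simp only: inner_diff_left inner_diff_right inner_scaleR_left inner_scaleR_right)
        (simp add: inner_commute algebra_simps)
    finally have "2 * t * inner z (x - y) \<le> t * (t * (norm z)\<^sup>2)"
      by simp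
    also have "t * (norm z)\<^sup>2 = inner z (x - y)"
      using False by (simp add: t_def)
    finally have "t * inner z (x - y) \<le> 0"
      by simp
    then have "(inner z (x - y))\<^sup>2 / (norm z)\<^sup>2 \<le> 0"
      by (simp add: t_def power2_eq_square)
    then show ?thesis
      using False by (simp add: divide_le_0_iff)
  qed simp
  have "cinner z (x - y) = 0" if "z \<in> M" for z
  proof (rule complex_eqI)
    show "Re (cinner z (x - y)) = Re 0"
      using re0[OF that] by (simp add: Re_cinner)
    show "Im (cinner z (x - y)) = Im 0"
      using re0[OF closed_csubspace_scaleC[OF M that, of \<i>]]
      by (simp add: cinner_scaleC_left flip: Re_cinner)
  qed
  with \<open>y \<in> M\<close> show ?thesis by blast
qed

lemma orth_proj_eqI:
  assumes "closed_csubspace M" "y \<in> M" "\<And>z. z \<in> M \<Longrightarrow> cinner z (x - y) = 0"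
  shows "orth_proj M x = y"
  unfolding orth_proj_def
proof (rule the_equality)
  fix y' assume y': "y' \<in> M \<and> (\<forall>z\<in>M. cinner z (x - y') = 0)"
  have "y' - y \<in> M"
    using y' assms(1,2) by (intro closed_csubspace_diff) auto
  then have "cinner (y' - y) ((x - y) - (x - y')) = 0"
    using assms(3) y' by (subst cinner.diff_right) simp
  then show "y' = y" by simp
qed (use assms in auto)

lemma
  assumes "closed_csubspace M"
  shows orth_proj_in: "orth_proj M x \<in> M"
    and cinner_orth_proj_diff: "z \<in> M \<Longrightarrow> cinner z (x - orth_proj M x) = 0"
proof -
  obtain y where "y \<in> M" "\<forall>z\<in>M. cinner z (x - y) = 0"
    using exists_orthogonal_projection[OF assms] by blast
  with orth_proj_eqI[OF assms this(1)] show "orth_proj M x \<in> M"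
    "z \<in> M \<Longrightarrow> cinner z (x - orth_proj M x) = 0" by auto
qed

lemma cinner_orth_proj: "closed_csubspace M \<Longrightarrow> z \<in> M \<Longrightarrow> cinner z (orth_proj M x) = cinner z x"
  using cinner_orth_proj_diff[of M z x] by (simp add: cinner.diff_right)

lemma orth_proj_ident: "closed_csubspace M \<Longrightarrow> x \<in> M \<Longrightarrow> orth_proj M x = x"
  by (rule orth_proj_eqI) (auto simp: cinner.zero_right)

lemma norm_orth_proj_le:
  assumes "closed_csubspace M"
  shows "norm (orth_proj M x) \<le> norm x"
proof (rule power2_le_imp_le)
  have "(norm (orth_proj M x + (x - orth_proj M x)))\<^sup>2
      = (norm (orth_proj M x))\<^sup>2 + (norm (x - orth_proj M x))\<^sup>2"
    by (intro norm_add_orthogonal cinner_orth_proj_diff orth_proj_in assms)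
  then show "(norm (orth_proj M x))\<^sup>2 \<le> (norm x)\<^sup>2" by simp
qed simp

lemma bounded_clinear_orth_proj:
  assumes M: "closed_csubspace M"
  shows "bounded_clinear (orth_proj M)"
proof (rule bounded_clinearI[where K = 1])
  note [simp] = cinner_orth_proj[OF M]
  show "orth_proj M (x + y) = orth_proj M x + orth_proj M y" for x y
    by (rule orth_proj_eqI)
      (auto intro!: closed_csubspace_add M orth_proj_in simp: cinner.diff_right cinner_add_right)
  show "orth_proj M (c *\<^sub>C x) = c *\<^sub>C orth_proj M x" for c x
    by (rule orth_proj_eqI)
      (auto intro!: closed_csubspace_scaleC M orth_proj_in
        simp: cinner.diff_right cinner_scaleC_right)
  show "norm (orth_proj M x) \<le> 1 * norm x" for x
    using norm_orth_proj_le[OF M] by simp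
qed

lemma orth_proj_add_orth_diff:
  assumes M: "closed_csubspace M" and N: "closed_csubspace N" "N \<subseteq> M" and "x \<in> M"
  shows "orth_proj N x + orth_proj (M \<ominus> N) x = x"
proof -
  have "orth_proj (M \<ominus> N) x = x - orth_proj N x"
  proof (rule orth_proj_eqI)
    show "closed_csubspace (M \<ominus> N)"
      using M by (rule closed_csubspace_orth_diff)
    show "x - orth_proj N x \<in> M \<ominus> N"
      using orth_proj_in[OF N(1), of x] N \<open>x \<in> M\<close>
      by (auto simp: orth_diff_def cinner_orth_proj_diff intro!: closed_csubspace_diff M)
    show "cinner z (x - (x - orth_proj N x)) = 0" if "z \<in> M \<ominus> N" for z
      using that orth_proj_in[OF N(1), of x] by (simp add: orth_diff_def cinner_zero_commute[of z "orth_proj N x"])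
  qed
  then show ?thesis by simp
qed

text \<open>Riesz representation for the functional \<open>h \<mapsto> \<langle>k, W h\<rangle>\<close>, applied to every \<open>k\<close>: the vector
  representing it is a multiple of any vector orthogonal to its kernel.\<close>

lemma exists_adjoint:
  fixes W :: "'h::chilbert_space \<Rightarrow> 'k::chilbert_space"
  assumes W: "bounded_clinear W"
  shows "\<exists>W'. bounded_clinear W' \<and> (\<forall>h k. cinner (W h) k = cinner h (W' k))"
proof -
  have "\<exists>y. \<forall>h. cinner k (W h) = cinner y h" for k
  proof -
    define N where "N = {h. cinner k (W h) = 0}"
    have N: "closed_csubspace N"
    proof -
      have "closed N"
        unfolding N_def
        by (intro closed_Collect_eq continuous_intros cinner.continuous_on
            linear_continuous_on bounded_clinear_linear W)
      then show ?thesis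
        unfolding closed_csubspace_def
        by (auto intro!: complex_vector.subspaceI simp: N_def bounded_clinear_zero[OF W]
            bounded_clinear_add[OF W] bounded_clinear_scaleC[OF W] cinner.zero_right
            cinner_add_right cinner_scaleC_right)
    qed
    show ?thesis
    proof (cases "N = UNIV")
      case True
      then show ?thesis
        by (intro exI[of _ 0]) (auto simp: N_def cinner.zero_left)
    next
      case False
      then obtain x where x: "x \<notin> N" by blast
      define z where "z = x - orth_proj N x"
      have "z \<notin> N"
        using x closed_csubspace_add[OF N _ orth_proj_in[OF N, of x], of z] by (auto simp: z_def)
      then have kz: "cinner k (W z) \<noteq> 0"
        by (simp add: N_def)
      then have zz: "cinner z z \<noteq> 0"
        by (auto simp: bounded_clinear_zero[OF W] cinner.zero_right)
      define y where "y = cnj (cinner k (W z) / cinner z z) *\<^sub>C z"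
      have "cinner k (W h) = cinner y h" for h
      proof -
        define n where "n = h - (cinner k (W h) / cinner k (W z)) *\<^sub>C z"
        have "n \<in> N"
          using kz by (simp add: N_def n_def bounded_clinear_diff[OF W] bounded_clinear_scaleC[OF W]
              cinner.diff_right cinner_scaleC_right)
        then have "cinner z n = 0"
          unfolding z_def using cinner_orth_proj_diff[OF N] cinner_zero_commute by blast
        then show ?thesis
          using kz zz by (simp add: n_def y_def cinner.diff_right cinner_scaleC_right
              cinner_scaleC_left field_simps)
      qed
      then show ?thesis by blast
    qed
  qed
  then obtain W' where W': "\<And>k h. cinner k (W h) = cinner (W' k) h" by metis
  then have adj: "cinner (W h) k = cinner h (W' k)" for h k
    by (metis cinner_commute)
  obtain K where K: "K > 0" "\<And>x. norm (W x) \<le> norm x * K"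
    using bounded_clinear_bound[OF W] by blast
  have "bounded_clinear W'"
  proof (rule bounded_clinearI[where K = K])
    show "W' (x + y) = W' x + W' y" for x y
      by (rule cinner_ext) (simp add: cinner_add_right flip: adj)
    show "W' (c *\<^sub>C x) = c *\<^sub>C W' x" for c x
      by (rule cinner_ext) (simp add: cinner_scaleC_right flip: adj)
    fix x
    have "(norm (W' x))\<^sup>2 = cmod (cinner (W' x) (W' x))"
      by (simp add: cinner_self norm_power)
    also have "\<dots> = cmod (cinner (W (W' x)) x)" by (simp add: adj)
    also have "\<dots> \<le> norm (W (W' x)) * norm x" by (rule cmod_cinner_le)
    also have "\<dots> \<le> norm (W' x) * K * norm x" by (intro mult_right_mono K) simp
    finally have "norm (W' x) * norm (W' x) \<le> norm (W' x) * (K * norm x)"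
      by (simp add: power2_eq_square mult.assoc)
    then show "norm (W' x) \<le> K * norm x"
      using K(1) by (cases "W' x = 0") auto
  qed
  with adj show ?thesis by blast
qed

text \<open>By uniform continuity the map extends to the closure, and composing with the orthogonal
  projection extends it to the whole space.\<close>

lemma bounded_clinear_extension:
  fixes f :: "'h::chilbert_space \<Rightarrow> 'k::chilbert_space"
  assumes V: "complex_vector.subspace V"
    and add: "\<And>x y. x \<in> V \<Longrightarrow> y \<in> V \<Longrightarrow> f (x + y) = f x + f y"
    and scale: "\<And>c x. x \<in> V \<Longrightarrow> f (c *\<^sub>C x) = c *\<^sub>C f x"
    and bound: "\<And>x. x \<in> V \<Longrightarrow> norm (f x) \<le> K * norm x"
  shows "\<exists>g. bounded_clinear g \<and> (\<forall>x\<in>V. g x = f x)"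
proof -
  have cl: "closed_csubspace (closure V)"
    by (rule closed_csubspace_closure[OF V])
  have diff: "f x - f y = f (x - y)" if "x \<in> V" "y \<in> V" for x y
    using add[OF complex_vector.subspace_diff[OF V that] that(2)] by simp
  have "\<bar>K\<bar>-lipschitz_on V f"
  proof (rule lipschitz_onI)
    fix x y assume "x \<in> V" "y \<in> V"
    then have "norm (f (x - y)) \<le> K * norm (x - y)"
      by (intro bound complex_vector.subspace_diff[OF V])
    also have "\<dots> \<le> \<bar>K\<bar> * norm (x - y)" by (intro mult_right_mono) auto
    finally show "dist (f x) (f y) \<le> \<bar>K\<bar> * dist x y"
      using \<open>x \<in> V\<close> \<open>y \<in> V\<close> by (simp add: dist_norm diff)
  qed auto
  then obtain g where g: "uniformly_continuous_on (closure V) g"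
    "\<And>x. x \<in> V \<Longrightarrow> f x = g x"
    using uniformly_continuous_on_extension_on_closure[OF lipschitz_on_uniformly_continuous] by metis
  have lim: "(\<lambda>n. f (X n)) \<longlonglongrightarrow> g x" if "\<And>n. X n \<in> V" "X \<longlonglongrightarrow> x" for X x
  proof -
    have "x \<in> closure V" "\<And>n. X n \<in> closure V"
      using that closure_subset[of V] by (auto intro: closure_sequentialI)
    then have "(\<lambda>n. g (X n)) \<longlonglongrightarrow> g x"
      using continuous_on_tendsto_compose[OF uniformly_continuous_imp_continuous[OF g(1)] that(2)]
      by simp
    then show ?thesis
      using g(2) that(1) by simp
  qed
  have g_add: "g (x + y) = g x + g y" if xy: "x \<in> closure V" "y \<in> closure V" for x y
  proof -
    obtain X Y where X: "\<And>n. X n \<in> V" "X \<longlonglongrightarrow> x" and Y: "\<And>n. Y n \<in> V" "Y \<longlonglongrightarrow> y"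
      using xy unfolding closure_sequential by metis
    have "(\<lambda>n. f (X n + Y n)) \<longlonglongrightarrow> g (x + y)"
      by (intro lim complex_vector.subspace_add[OF V] X Y tendsto_add)
    moreover have "(\<lambda>n. f (X n + Y n)) \<longlonglongrightarrow> g x + g y"
      using tendsto_add[OF lim[OF X] lim[OF Y]] by (simp add: add X Y)
    ultimately show ?thesis by (rule LIMSEQ_unique)
  qed
  have g_scale: "g (c *\<^sub>C x) = c *\<^sub>C g x" if x: "x \<in> closure V" for c x
  proof -
    note sc = bounded_linear.tendsto[OF bounded_clinear_linear[OF bounded_clinear_scaleC_right]]
    obtain X where X: "\<And>n. X n \<in> V" "X \<longlonglongrightarrow> x"
      using x unfolding closure_sequential by metis
    have "(\<lambda>n. f (c *\<^sub>C X n)) \<longlonglongrightarrow> g (c *\<^sub>C x)"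
      by (intro lim complex_vector.subspace_scale[OF V] X sc)
    moreover have "(\<lambda>n. f (c *\<^sub>C X n)) \<longlonglongrightarrow> c *\<^sub>C g x"
      using sc[OF lim[OF X]] by (simp add: scale X)
    ultimately show ?thesis by (rule LIMSEQ_unique)
  qed
  have g_bound: "norm (g x) \<le> K * norm x" if x: "x \<in> closure V" for x
  proof -
    obtain X where X: "\<And>n. X n \<in> V" "X \<longlonglongrightarrow> x"
      using x unfolding closure_sequential by metis
    show ?thesis
      by (rule LIMSEQ_le[OF tendsto_norm[OF lim[OF X]] tendsto_mult_left[OF tendsto_norm[OF X(2)]]])
        (use bound X in blast)
  qed
  note P = bounded_clinear_orth_proj[OF cl] and P_in = orth_proj_in[OF cl]
  have "bounded_clinear (\<lambda>x. g (orth_proj (closure V) x))"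
  proof (rule bounded_clinearI[where K = "\<bar>K\<bar>"])
    fix x
    have "norm (g (orth_proj (closure V) x)) \<le> K * norm (orth_proj (closure V) x)"
      by (rule g_bound[OF P_in])
    also have "\<dots> \<le> \<bar>K\<bar> * norm (orth_proj (closure V) x)" by (intro mult_right_mono) auto
    also have "\<dots> \<le> \<bar>K\<bar> * norm x" by (intro mult_left_mono norm_orth_proj_le[OF cl]) auto
    finally show "norm (g (orth_proj (closure V) x)) \<le> \<bar>K\<bar> * norm x" .
  qed (simp_all add: bounded_clinear_add[OF P] bounded_clinear_scaleC[OF P] g_add g_scale P_in)
  moreover have "g (orth_proj (closure V) x) = f x" if "x \<in> V" for x
    using that closure_subset[of V] by (subst orth_proj_ident[OF cl]) (auto simp: g(2))
  ultimately show ?thesis by blast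
qed

section \<open>Square roots of positive operators\<close>

instance chilbert_space \<subseteq> banach ..

text \<open>The coefficients of \<open>sqrt (1 - x)\<close>.\<close>

definition sqrt_coeff :: "nat \<Rightarrow> real" where
  "sqrt_coeff n = (1/2 gchoose n) * (-1) ^ n"

lemma sqrt_coeff_pochhammer: "sqrt_coeff n = pochhammer (- 1/2) n / fact n"
  by (simp add: sqrt_coeff_def gbinomial_pochhammer flip: power_mult_distrib)

lemma sqrt_coeff_nonpos: "n > 0 \<Longrightarrow> sqrt_coeff n \<le> 0"
  by (cases n) (simp_all add: sqrt_coeff_pochhammer pochhammer_rec divide_nonpos_pos
      pochhammer_nonneg mult_nonpos_nonneg)

text \<open>The partial sums are the coefficients of \<open>sqrt (1 - x) / (1 - x) = (1 - x) powr (-1/2)\<close>.\<close>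

lemma sum_sqrt_coeff_nonneg: "0 \<le> (\<Sum>n\<le>N. sqrt_coeff n)"
proof -
  have "(\<Sum>n\<le>N. sqrt_coeff n) = (- 1) ^ N * (- 1/2 gchoose N)"
    unfolding sqrt_coeff_def by (subst gbinomial_sum_lower_neg) simp
  also have "\<dots> = pochhammer (1/2) N / fact N"
    by (simp add: gbinomial_pochhammer flip: power_mult_distrib)
  finally show ?thesis
    by (simp add: pochhammer_nonneg)
qed

text \<open>Only the constant coefficient is positive, so the sums of absolute values are at most twice
  this coefficient minus the nonnegative partial sums.\<close>

lemma summable_abs_sqrt_coeff: "summable (\<lambda>n. \<bar>sqrt_coeff n\<bar>)"
proof (rule bounded_imp_summable[where B = 2])
  fix N
  have "(\<Sum>n\<le>N. \<bar>sqrt_coeff n\<bar>) = (\<Sum>n\<le>N. (if n = 0 then 2 else 0) - sqrt_coeff n)"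
    using sqrt_coeff_nonpos by (intro sum.cong) (auto simp: sqrt_coeff_def abs_of_nonpos)
  also have "\<dots> \<le> 2"
    using sum_sqrt_coeff_nonneg[of N] by (simp add: sum_subtractf)
  finally show "(\<Sum>n\<le>N. \<bar>sqrt_coeff n\<bar>) \<le> 2" .
qed auto

text \<open>The square of \<open>sqrt (1 - x)\<close> is \<open>1 - x\<close>.\<close>

lemma sqrt_coeff_convolution:
  "(\<Sum>i\<le>n. sqrt_coeff i * sqrt_coeff (n - i)) = (if n = 0 then 1 else if n = 1 then -1 else 0)"
proof -
  have "(\<Sum>i\<le>n. sqrt_coeff i * sqrt_coeff (n - i))
      = (\<Sum>i\<le>n. (1/2 gchoose i) * (1/2 gchoose (n - i)) * (-1) ^ n)"
    by (intro sum.cong refl) (simp add: sqrt_coeff_def mult_ac flip: power_add)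
  also have "\<dots> = ((1/2 + 1/2 :: real) gchoose n) * (-1) ^ n"
    by (simp only: gbinomial_Vandermonde[of "1/2 :: real" "1/2" n, symmetric] atMost_atLeast0
        sum_distrib_right)
  also have "((1/2 + 1/2 :: real) gchoose n) = of_nat (1 choose n)"
    by (simp add: binomial_gbinomial)
  also have "of_nat (1 choose n) * (-1) ^ n = (if n = 0 then 1 else if n = 1 then -1 else 0 :: real)"
    by (auto simp: binomial_eq_0)
  finally show ?thesis .
qed

text \<open>The truncated double series is compared with the Cauchy product, which collapses by
  \<open>sqrt_coeff_convolution\<close> to its first two terms. The difference is a sum over \<open>T N\<close>, which is small
  because the double series of the absolute values converges.\<close>

lemma sqrt_coeff_double_sum_tendsto:
  fixes u :: "nat \<Rightarrow> complex"
  assumes u: "\<And>n. cmod (u n) \<le> C"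
  shows "(\<lambda>N. \<Sum>m\<le>N. \<Sum>n\<le>N. of_real (sqrt_coeff m * sqrt_coeff n) * u (m + n))
    \<longlonglongrightarrow> u 0 - u 1"
proof -
  let ?a = sqrt_coeff and ?b = "\<lambda>n. \<bar>sqrt_coeff n\<bar>"
  define T where "T N = {(m, n). m \<le> N \<and> n \<le> N \<and> m + n > N}" for N :: nat
  have finT: "finite (T N)" for N
    by (rule finite_subset[of _ "{..N} \<times> {..N}"]) (auto simp: T_def)
  have split: "(\<Sum>m\<le>N. \<Sum>n\<le>N. f m n) = (\<Sum>k\<le>N. \<Sum>i\<le>k. f i (k - i)) + (\<Sum>(m, n)\<in>T N. f m n)"
    for f :: "nat \<Rightarrow> nat \<Rightarrow> 'b::comm_monoid_add" and N
  proof -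
    have "(\<Sum>m\<le>N. \<Sum>n\<le>N. f m n) = (\<Sum>(m, n)\<in>{(m, n). m + n \<le> N} \<union> T N. f m n)"
      unfolding sum.cartesian_product by (intro sum.cong) (auto simp: T_def)
    also have "\<dots> = (\<Sum>(m, n)\<in>{(m, n). m + n \<le> N}. f m n) + (\<Sum>(m, n)\<in>T N. f m n)"
      by (intro sum.union_disjoint finT finite_subset[of "{(m, n). m + n \<le> N}" "{..N} \<times> {..N}"])
        (auto simp: T_def)
    finally show ?thesis
      by (simp only: sum.triangle_reindex_eq)
  qed
  have sums: "?b sums suminf ?b"
    using summable_abs_sqrt_coeff by (rule summable_sums)
  have "(\<lambda>N. (\<Sum>m\<le>N. ?b m) * (\<Sum>n\<le>N. ?b n)) \<longlonglongrightarrow> suminf ?b * suminf ?b"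
    using sums unfolding sums_def_le by (intro tendsto_mult)
  moreover have "(\<lambda>N. \<Sum>k\<le>N. \<Sum>i\<le>k. ?b i * ?b (k - i)) \<longlonglongrightarrow> suminf ?b * suminf ?b"
    using Cauchy_product_sums[of ?b ?b] summable_abs_sqrt_coeff unfolding sums_def_le by simp
  ultimately have "(\<lambda>N. (\<Sum>m\<le>N. ?b m) * (\<Sum>n\<le>N. ?b n) - (\<Sum>k\<le>N. \<Sum>i\<le>k. ?b i * ?b (k - i)))
      \<longlonglongrightarrow> suminf ?b * suminf ?b - suminf ?b * suminf ?b"
    by (rule tendsto_diff)
  then have "(\<lambda>N. \<Sum>(m, n)\<in>T N. ?b m * ?b n) \<longlonglongrightarrow> 0"
    by (simp add: sum_product split)
  then have lim0: "(\<lambda>N. (\<Sum>(m, n)\<in>T N. ?b m * ?b n) * C) \<longlonglongrightarrow> 0"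
    by (rule tendsto_mult_left_zero)
  have zero: "(\<lambda>N. \<Sum>(m, n)\<in>T N. of_real (?a m * ?a n) * u (m + n)) \<longlonglongrightarrow> 0"
  proof (rule Lim_null_comparison[OF always_eventually lim0], rule allI)
    fix N
    have "norm (\<Sum>(m, n)\<in>T N. of_real (?a m * ?a n) * u (m + n))
        \<le> (\<Sum>(m, n)\<in>T N. ?b m * ?b n * C)"
      by (rule order_trans[OF norm_sum], rule sum_mono)
        (auto simp: norm_mult abs_mult intro!: mult_left_mono u)
    also have "\<dots> = (\<Sum>(m, n)\<in>T N. ?b m * ?b n) * C"
      by (simp add: sum_distrib_right case_prod_unfold)
    finally show "norm (\<Sum>(m, n)\<in>T N. of_real (?a m * ?a n) * u (m + n))
        \<le> (\<Sum>(m, n)\<in>T N. ?b m * ?b n) * C" .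
  qed
  have "(\<Sum>k\<le>N. \<Sum>i\<le>k. of_real (?a i * ?a (k - i)) * u (i + (k - i))) = u 0 - u 1"
    if "N \<ge> 1" for N
  proof -
    have "(\<Sum>k\<le>N. \<Sum>i\<le>k. of_real (?a i * ?a (k - i)) * u (i + (k - i)))
        = (\<Sum>k\<le>N. of_real (\<Sum>i\<le>k. ?a i * ?a (k - i)) * u k)"
      by (simp add: sum_distrib_right)
    also have "\<dots> = (\<Sum>k\<le>N. if k \<in> {0, 1} then (if k = 0 then u 0 else - u 1) else 0)"
      unfolding sqrt_coeff_convolution by (intro sum.cong) auto
    also have "\<dots> = (\<Sum>k\<in>{0, 1 :: nat}. if k = 0 then u 0 else - u 1)"
      using that by (intro sum.mono_neutral_cong_right) auto
    also have "\<dots> = u 0 - u 1" by simp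
    finally show ?thesis .
  qed
  then have "\<forall>\<^sub>F N in sequentially.
      (\<Sum>k\<le>N. \<Sum>i\<le>k. of_real (?a i * ?a (k - i)) * u (i + (k - i))) = u 0 - u 1"
    by (auto simp: eventually_sequentially)
  from tendsto_add[OF tendsto_eventually[OF this] zero] show ?thesis
    by (simp only: split add_0_right)
qed

text \<open>The estimate comes from the positivity of the form of \<open>B\<close> at \<open>x - B x\<close>.\<close>

lemma contraction_of_between_zero_and_one:
  assumes B: "bounded_clinear B" and sa: "\<And>x y. cinner (B x) y = cinner x (B y)"
    and ge: "\<And>x. 0 \<le> inner x (B x)" and le: "\<And>x. inner x (B x) \<le> (norm x)\<^sup>2"
  shows "norm (B x) \<le> norm x"
proof (rule power2_le_imp_le)
  have "inner (x - B x) (B (x - B x)) = inner x (B x) - 2 * (norm (B x))\<^sup>2 + inner (B x) (B (B x))"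
    using arg_cong[OF sa[of x "B x"], of Re]
    by (simp add: bounded_clinear_diff[OF B] inner_diff_left inner_diff_right power2_norm_eq_inner
        Re_cinner)
  then show "(norm (B x))\<^sup>2 \<le> (norm x)\<^sup>2"
    using ge[of "x - B x"] le[of x] le[of "B x"] by linarith
qed simp

text \<open>After scaling, \<open>T = 1 - B\<close> with \<open>0 \<le> B \<le> 1\<close>. Hence \<open>\<parallel>B\<parallel> \<le> 1\<close>, and the binomial series of
  \<open>sqrt (1 - x)\<close>, whose coefficients are absolutely summable, can be evaluated at \<open>B\<close>.\<close>

lemma exists_square_root:
  fixes T :: "'k::chilbert_space \<Rightarrow> 'k"
  assumes T: "bounded_clinear T" and sa: "\<And>x y. cinner (T x) y = cinner x (T y)"
    and pos: "\<And>x. 0 \<le> inner x (T x)"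
  shows "\<exists>S :: 'k \<Rightarrow> 'k. bounded_clinear S \<and> (\<forall>x y. cinner (S x) (S y) = cinner x (T y))"
proof -
  obtain K where K: "K > 0" "\<And>x. norm (T x) \<le> norm x * K"
    using bounded_clinear_bound[OF T] by blast
  define B where "B x = x - of_real (1 / K) *\<^sub>C T x" for x
  have B: "bounded_clinear B"
  proof (rule bounded_clinearI[where K = 2])
    fix x
    have "norm (B x) \<le> norm x + norm (of_real (1 / K) *\<^sub>C T x)"
      unfolding B_def by (rule norm_triangle_ineq4)
    also have "\<dots> \<le> 2 * norm x"
      using K(1) K(2)[of x] by (simp add: norm_scaleC norm_divide divide_simps mult.commute)
    finally show "norm (B x) \<le> 2 * norm x" .
  qed (simp_all add: B_def bounded_clinear_add[OF T] bounded_clinear_scaleC[OF T]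
      complex_vector.scale_right_diff_distrib scaleC_add_right mult.commute)
  have sa_B: "cinner (B x) y = cinner x (B y)" for x y
    by (simp add: B_def cinner.diff_left cinner.diff_right cinner_scaleC_left cinner_scaleC_right sa)
  have inner_B: "inner x (B x) = (norm x)\<^sup>2 - inner x (T x) / K" for x
    by (simp add: B_def inner_diff_right scaleC_of_real power2_norm_eq_inner del: of_real_divide)
  have B_le: "norm (B x) \<le> norm x" for x
  proof (rule contraction_of_between_zero_and_one[OF B sa_B])
    fix x :: 'k
    have "inner x (T x) \<le> norm x * norm (T x)" by (rule norm_cauchy_schwarz)
    also have "\<dots> \<le> norm x * (norm x * K)" by (intro mult_left_mono K) simp
    finally show "0 \<le> inner x (B x)"
      using K(1) by (simp add: inner_B divide_simps power2_eq_square mult_ac)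
    show "inner x (B x) \<le> (norm x)\<^sup>2"
      using K(1) pos by (simp add: inner_B)
  qed
  have Bn: "bounded_clinear (B ^^ n)" for n
    by (induction n)
      (use bounded_clinear_compose[OF B] bounded_clinear_scaleC_right[of 1] in \<open>simp_all add: id_def comp_def\<close>)
  have Bn_le: "norm ((B ^^ n) x) \<le> norm x" for n x
    by (induction n) (use B_le order_trans in auto)
  have sa_Bn: "cinner ((B ^^ n) x) y = cinner x ((B ^^ n) y)" for n x y
    by (induction n arbitrary: x y) (simp_all add: sa_B funpow_swap1)
  define a where "a = sqrt_coeff"
  have sm_norm: "summable (\<lambda>n. norm (a n *\<^sub>R (B ^^ n) x))" for x
  proof (rule summable_comparison_test'[where N = 0])
    show "summable (\<lambda>n. \<bar>a n\<bar> * norm x)"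
      unfolding a_def by (intro summable_mult2 summable_abs_sqrt_coeff)
  qed (simp add: mult_left_mono Bn_le)
  then have sm: "summable (\<lambda>n. a n *\<^sub>R (B ^^ n) x)" for x
    by (rule summable_norm_cancel)
  define R where "R x = (\<Sum>n. a n *\<^sub>R (B ^^ n) x)" for x
  have R: "bounded_clinear R"
  proof (rule bounded_clinearI[where K = "suminf (\<lambda>n. \<bar>a n\<bar>)"])
    show "R (x + y) = R x + R y" for x y
      unfolding R_def by (simp add: suminf_add[OF sm sm] bounded_clinear_add[OF Bn] scaleR_add_right)
    show "R (c *\<^sub>C x) = c *\<^sub>C R x" for c x
    proof -
      have "R (c *\<^sub>C x) = (\<Sum>n. c *\<^sub>C (a n *\<^sub>R (B ^^ n) x))"
        unfolding R_def
        by (simp add: bounded_clinear_scaleC[OF Bn] scaleC_scaleC mult.commute flip: scaleC_of_real)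
      also have "\<dots> = c *\<^sub>C R x"
        unfolding R_def
        using bounded_linear.suminf[OF bounded_clinear_linear[OF bounded_clinear_scaleC_right[of c]] sm, of x]
        by simp
      finally show ?thesis .
    qed
    fix x
    have "norm (R x) \<le> (\<Sum>n. norm (a n *\<^sub>R (B ^^ n) x))"
      unfolding R_def by (rule summable_norm[OF sm_norm])
    also have "\<dots> \<le> (\<Sum>n. \<bar>a n\<bar> * norm x)"
      by (intro suminf_le sm_norm summable_mult2)
        (simp_all add: mult_left_mono Bn_le a_def summable_abs_sqrt_coeff)
    also have "\<dots> = (\<Sum>n. \<bar>a n\<bar>) * norm x"
      by (simp add: suminf_mult2[OF summable_abs_sqrt_coeff] a_def)
    finally show "norm (R x) \<le> (\<Sum>n. \<bar>a n\<bar>) * norm x" .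
  qed
  have RR: "cinner (R x) (R y) = of_real (1 / K) * cinner x (T y)" for x y
  proof -
    have lim: "(\<lambda>N. \<Sum>n\<le>N. a n *\<^sub>R (B ^^ n) x) \<longlonglongrightarrow> R x" for x
      using summable_sums[OF sm] unfolding sums_def_le R_def .
    have "(\<lambda>N. cinner (\<Sum>m\<le>N. a m *\<^sub>R (B ^^ m) x) (\<Sum>n\<le>N. a n *\<^sub>R (B ^^ n) y))
        \<longlonglongrightarrow> cinner (R x) (R y)"
      by (intro cinner.tendsto lim)
    moreover have "cinner (\<Sum>m\<le>N. a m *\<^sub>R (B ^^ m) x) (\<Sum>n\<le>N. a n *\<^sub>R (B ^^ n) y)
        = (\<Sum>m\<le>N. \<Sum>n\<le>N. of_real (a m * a n) * cinner x ((B ^^ (m + n)) y))" for N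
      unfolding cinner.sum_left cinner.scaleR_left sa_Bn
      by (intro sum.cong refl)
        (simp add: bounded_clinear_sum[OF Bn] cinner.sum_right bounded_clinear_scaleR[OF Bn]
          cinner.scaleR_right funpow_add scaleR_conv_of_real sum_distrib_left mult.assoc)
    moreover have "cmod (cinner x ((B ^^ n) y)) \<le> norm x * norm y" for n
      by (rule order_trans[OF cmod_cinner_le mult_left_mono[OF Bn_le]]) simp
    then have "(\<lambda>N. \<Sum>m\<le>N. \<Sum>n\<le>N. of_real (a m * a n) * cinner x ((B ^^ (m + n)) y))
        \<longlonglongrightarrow> cinner x ((B ^^ 0) y) - cinner x ((B ^^ 1) y)"
      unfolding a_def by (rule sqrt_coeff_double_sum_tendsto)
    ultimately have "cinner (R x) (R y) = cinner x y - cinner x (B y)"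
      using LIMSEQ_unique by fastforce
    then show ?thesis
      by (simp add: B_def cinner.diff_right cinner_scaleC_right)
  qed
  define S where "S x = of_real (sqrt K) *\<^sub>C R x" for x
  have "bounded_clinear S"
    unfolding S_def by (intro bounded_clinear_compose[OF bounded_clinear_scaleC_right R])
  moreover have "cinner (S x) (S y) = cinner x (T y)" for x y
  proof -
    have "cinner (S x) (S y) = of_real (sqrt K * sqrt K * (1 / K)) * cinner x (T y)"
      by (simp only: S_def cinner_scaleC_left cinner_scaleC_right RR complex_cnj_complex_of_real
          of_real_mult mult.assoc)
    also have "sqrt K * sqrt K * (1 / K) = 1"
      using K(1) by simp
    finally show ?thesis by simp
  qed
  ultimately show ?thesis by blast
qed

section \<open>Realizations of positive semidefinite operator matrices\<close>

lift_definition single :: "'i \<Rightarrow> 'h \<Rightarrow> ('i, 'h::real_inner) ell2" is "\<lambda>i h j. if j = i then h else 0"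
proof -
  fix i :: 'i and h :: 'h
  have "(\<lambda>j. (norm (if j = i then h else 0))\<^sup>2) summable_on {i}"
    by simp
  then show "(\<lambda>j. (norm (if j = i then h else 0))\<^sup>2) summable_on UNIV"
    by (rule summable_on_cong_neutral[THEN iffD1, rotated -1]) auto
qed

lemma cinner_single_left: "cinner (single i h) x = cinner h (coord x i)"
proof -
  have "cinner (single i h) x = (\<Sum>\<^sub>\<infinity>j. cinner (if j = i then h else 0) (coord x j))"
    by (simp add: cinner_ell2.rep_eq single.rep_eq)
  also have "\<dots> = (\<Sum>\<^sub>\<infinity>j\<in>{i}. cinner h (coord x j))"
    by (intro infsum_cong_neutral) (auto simp: cinner.zero_left)
  finally show ?thesis by simp
qed

lemma bounded_clinear_single: "bounded_clinear (single i :: 'h::chilbert_space \<Rightarrow> ('i, 'h) ell2)"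
proof (rule bounded_clinearI[where K = 1])
  show "single i (x + y) = single i x + single i y" for x y :: 'h
    by transfer auto
  show "single i (c *\<^sub>C x) = c *\<^sub>C single i x" for c and x :: 'h
    by transfer auto
  fix x :: 'h
  have "complex_of_real ((norm (single i x))\<^sup>2) = complex_of_real ((norm x)\<^sup>2)"
    by (simp only: cinner_self[symmetric] cinner_single_left) (simp add: single.rep_eq)
  then have "(norm (single i x))\<^sup>2 = (norm x)\<^sup>2"
    by (simp only: of_real_eq_iff)
  then show "norm (single i x) \<le> 1 * norm x"
    by simp
qed

lemma bounded_clinear_coord: "bounded_clinear (\<lambda>x :: ('i, 'h::chilbert_space) ell2. coord x i)"
  by (rule bounded_clinearI[where K = 1])
    (simp_all add: plus_ell2.rep_eq scaleC_ell2.rep_eq norm_coord_le)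

lemma bounded_clinear_zero_fun: "bounded_clinear (\<lambda>x. 0)"
  by (rule bounded_clinearI[where K = 0]) auto

lemma bounded_clinear_setsum:
  "(\<And>i. i \<in> I \<Longrightarrow> bounded_clinear (T i)) \<Longrightarrow> bounded_clinear (\<lambda>x. \<Sum>i\<in>I. T i x)"
  by (induction I rule: infinite_finite_induct)
    (simp_all add: bounded_clinear_zero_fun bounded_clinear_plus)

text \<open>Polarization with \<open>x + y\<close> and \<open>x + \<i> y\<close>.\<close>

lemma self_adjoint_of_real_form:
  assumes T: "bounded_clinear T" and re: "\<And>x. Im (cinner x (T x)) = 0"
  shows "cinner (T x) y = cinner x (T y)"
proof -
  have eq: "Im (c * cinner x (T y) + cnj c * cinner y (T x)) = 0" for c
  proof -
    have "cinner (x + c *\<^sub>C y) (T (x + c *\<^sub>C y)) = cinner x (T x)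
        + (c * cinner x (T y) + cnj c * cinner y (T x)) + of_real ((cmod c)\<^sup>2) * cinner y (T y)"
      unfolding complex_norm_square
      by (simp add: bounded_clinear_add[OF T] bounded_clinear_scaleC[OF T] cinner_add_left
          cinner_add_right cinner_scaleC_left cinner_scaleC_right algebra_simps)
    from arg_cong[OF this, of Im] show ?thesis
      by (simp add: re del: of_real_power)
  qed
  have "cinner x (T y) = cnj (cinner y (T x))"
    using eq[of 1] eq[of \<i>] by (intro complex_eqI) simp_all
  then show ?thesis
    using cinner_commute[of "T x" y] by simp
qed

text \<open>The matrix acts as a positive operator \<open>T\<close> on the square-summable families, by zero outside \<open>I\<close>.
  If \<open>T = S\<^sup>* S\<close>, the columns of \<open>S\<close> are the required operators.\<close>

lemma exists_realization:
  fixes A :: "'i \<Rightarrow> 'i \<Rightarrow> 'h::chilbert_space \<Rightarrow> 'h"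
  assumes fin: "finite I" and A: "\<And>i j. i \<in> I \<Longrightarrow> j \<in> I \<Longrightarrow> bounded_clinear (A i j)"
    and psd: "positive_semidefinite I A"
  shows "\<exists>\<omega> :: 'i \<Rightarrow> 'h \<Rightarrow> ('i, 'h) ell2. realizes I A \<omega>"
proof -
  define T :: "('i, 'h) ell2 \<Rightarrow> ('i, 'h) ell2" where
    "T x = (\<Sum>i\<in>I. single i (\<Sum>j\<in>I. A i j (coord x j)))" for x
  have T: "bounded_clinear T"
    unfolding T_def
    by (intro bounded_clinear_setsum bounded_clinear_compose[OF bounded_clinear_single]
        bounded_clinear_compose[OF A bounded_clinear_coord])
  have form: "cinner y (T x) = (\<Sum>i\<in>I. \<Sum>j\<in>I. cinner (coord y i) (A i j (coord x j)))" for x y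
  proof -
    have "cinner y (T x) = (\<Sum>i\<in>I. cnj (cinner (single i (\<Sum>j\<in>I. A i j (coord x j))) y))"
      unfolding T_def cinner.sum_right by (intro sum.cong refl cinner_commute)
    also have "\<dots> = (\<Sum>i\<in>I. cinner (coord y i) (\<Sum>j\<in>I. A i j (coord x j)))"
      unfolding cinner_single_left by (intro sum.cong refl) (rule cinner_commute[symmetric])
    finally show ?thesis by (simp only: cinner.sum_right)
  qed
  have nonneg: "cinner x (T x) \<in> \<real>\<^sub>\<ge>\<^sub>0" for x
    using psd unfolding positive_semidefinite_def form by blast
  obtain S :: "('i, 'h) ell2 \<Rightarrow> ('i, 'h) ell2" where S: "bounded_clinear S"
    "\<And>x y. cinner (S x) (S y) = cinner x (T y)"
    using exists_square_root[OF T self_adjoint_of_real_form[OF T]] nonneg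
    by (auto simp: complex_nonneg_Reals_iff simp flip: Re_cinner)
  have "realizes I A (\<lambda>i h. S (single i h))"
    unfolding realizes_def
  proof (intro conjI ballI allI)
    show "bounded_clinear (\<lambda>h. S (single i h))" for i
      by (rule bounded_clinear_compose[OF S(1) bounded_clinear_single])
    fix i j h h' assume ij: "i \<in> I" "j \<in> I"
    have zero: "A i' j' 0 = 0" if "i' \<in> I" "j' \<in> I" for i' j'
      using bounded_clinear_zero[OF A[OF that]] .
    have "cinner (S (single i h)) (S (single j h'))
      = (\<Sum>i'\<in>I. \<Sum>j'\<in>I. if j' = j then if i' = i then cinner h (A i j h') else 0 else 0)"
      unfolding S(2) form by (intro sum.cong) (auto simp: single.rep_eq zero cinner.zero_left cinner.zero_right)
    then show "cinner (S (single i h)) (S (single j h')) = cinner h (A i j h')"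
      using fin ij by simp
  qed
  then show ?thesis by blast
qed

subsection \<open>Closed spans\<close>

lemma closed_csubspace_crs: "closed_csubspace (closed_range_span J \<omega>)"
  unfolding closed_range_span_def
  by (intro closed_csubspace_closure complex_vector.subspace_span)

lemma in_closed_range_span: "i \<in> J \<Longrightarrow> \<omega> i h \<in> closed_range_span J \<omega>"
  unfolding closed_range_span_def
  by (intro subsetD[OF closure_subset] complex_vector.span_base) blast

lemma closed_range_span_subset:
  assumes "closed_csubspace Q" "\<And>i h. i \<in> J \<Longrightarrow> \<omega> i h \<in> Q"
  shows "closed_range_span J \<omega> \<subseteq> Q"
  unfolding closed_range_span_def
  using assms unfolding closed_csubspace_def
  by (intro closure_minimal complex_vector.span_minimal) auto

lemma closed_range_span_mono: "J \<subseteq> J' \<Longrightarrow> closed_range_span J \<omega> \<subseteq> closed_range_span J' \<omega>"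
  by (intro closed_range_span_subset closed_csubspace_crs in_closed_range_span) auto

lemma closed_csubspace_vimage:
  assumes U: "bounded_clinear U" and Q: "closed_csubspace Q"
  shows "closed_csubspace (U -` Q)"
proof -
  have "closed (U -` Q)"
    using Q bounded_clinear_linear[OF U]
    by (intro continuous_closed_vimage) (auto simp: closed_csubspace_def linear_continuous_at)
  then show ?thesis
    using closed_csubspace_zero[OF Q] closed_csubspace_add[OF Q] closed_csubspace_scaleC[OF Q]
    unfolding closed_csubspace_def
    by (auto intro!: complex_vector.subspaceI simp: bounded_clinear_zero[OF U]
        bounded_clinear_add[OF U] bounded_clinear_scaleC[OF U])
qed

lemma image_closed_range_span_subset:
  assumes "bounded_clinear U" "closed_csubspace Q" "\<And>i h. i \<in> J \<Longrightarrow> U (\<omega> i h) \<in> Q"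
  shows "U ` closed_range_span J \<omega> \<subseteq> Q"
  using closed_range_span_subset[OF closed_csubspace_vimage[OF assms(1,2)], of J \<omega>] assms(3)
  by blast

lemma orthogonal_closed_range_span:
  assumes "\<And>i h. i \<in> J \<Longrightarrow> cinner x (\<omega> i h) = 0" "y \<in> closed_range_span J \<omega>"
  shows "cinner x y = 0"
  using closed_range_span_subset[OF closed_csubspace_orth[of "{x}"], of J \<omega>] assms by blast

lemma closed_csubspace_singleton_zero: "closed_csubspace {0}"
  by (auto simp: closed_csubspace_def intro!: complex_vector.subspaceI)

lemma bounded_clinear_minus_fun:
  assumes "bounded_clinear S" "bounded_clinear T"
  shows "bounded_clinear (\<lambda>x. S x - T x)"
  using assms bounded_linear_sub[of S T]
  by (simp add: bounded_clinear_def complex_vector.scale_right_diff_distrib)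

lemma eq_on_closed_range_span:
  assumes S: "bounded_clinear S" and T: "bounded_clinear T"
    and eq: "\<And>i h. i \<in> J \<Longrightarrow> S (\<omega> i h) = T (\<omega> i h)" and x: "x \<in> closed_range_span J \<omega>"
  shows "S x = T x"
  using image_closed_range_span_subset[OF bounded_clinear_minus_fun[OF S T]
      closed_csubspace_singleton_zero, of J \<omega>] eq x by auto

text \<open>With the adjoint \<open>U'\<close> of \<open>U\<close> the claim is that \<open>U' U y - y\<close> is orthogonal to the closed span, which
  is checked on the generators in one variable at a time.\<close>

lemma isometric_on_closed_range_span:
  assumes U: "bounded_clinear U"
    and gram: "\<And>i j h k. i \<in> J \<Longrightarrow> j \<in> J \<Longrightarrow> cinner (U (\<omega> i h)) (U (\<omega> j k)) = cinner (\<omega> i h) (\<omega> j k)"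
    and x: "x \<in> closed_range_span J \<omega>" and y: "y \<in> closed_range_span J \<omega>"
  shows "cinner (U x) (U y) = cinner x y"
proof -
  obtain U' where U': "bounded_clinear U'" "\<And>h k. cinner (U h) k = cinner h (U' k)"
    using exists_adjoint[OF U] by blast
  have "cinner (U' (U (\<omega> i h)) - \<omega> i h) y = 0" if "i \<in> J" for i h
  proof (rule orthogonal_closed_range_span[OF _ y])
    fix j k assume "j \<in> J"
    have "cinner (\<omega> j k) (U' (U (\<omega> i h)) - \<omega> i h) = 0"
      using gram[OF \<open>j \<in> J\<close> that] by (simp add: cinner.diff_right flip: U'(2))
    then show "cinner (U' (U (\<omega> i h)) - \<omega> i h) (\<omega> j k) = 0"
      by (simp only: cinner_zero_commute)
  qed
  then have gen: "cinner (U' (U (\<omega> i h))) y = cinner (\<omega> i h) y" if "i \<in> J" for i h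
    using that by (simp add: cinner.diff_left)
  have "cinner (U' (U y) - y) x = 0"
  proof (rule orthogonal_closed_range_span[OF _ x])
    fix i h assume "i \<in> J"
    have "cinner (\<omega> i h) (U' (U y)) = cinner (U' (U (\<omega> i h))) y"
      by (metis U'(2) cinner_commute)
    then have "cinner (\<omega> i h) (U' (U y) - y) = 0"
      by (simp add: gen[OF \<open>i \<in> J\<close>] cinner.diff_right)
    then show "cinner (U' (U y) - y) (\<omega> i h) = 0"
      by (simp only: cinner_zero_commute)
  qed
  then have "cinner x (U' (U y) - y) = 0"
    by (simp only: cinner_zero_commute)
  then show ?thesis
    by (simp add: cinner.diff_right U'(2))
qed

text \<open>On the span of the \<open>\<omega>\<^sub>i \<H>\<close> the operator has to send \<open>\<Sum>\<^sub>i \<omega>\<^sub>i h\<^sub>i\<close> to \<open>\<Sum>\<^sub>i \<Omega>\<^sub>i h\<^sub>i\<close>; it is well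
  defined because both vectors have the same norm.\<close>

lemma exists_identification:
  fixes \<omega> :: "'i \<Rightarrow> 'h::chilbert_space \<Rightarrow> 'k::chilbert_space" and \<Omega> :: "'i \<Rightarrow> 'h \<Rightarrow> 'l::chilbert_space"
  assumes fin: "finite J" and \<omega>: "realizes J A \<omega>" and \<Omega>: "realizes J A \<Omega>"
  shows "\<exists>U. bounded_clinear U \<and> (\<forall>i\<in>J. \<forall>h. U (\<omega> i h) = \<Omega> i h)"
proof -
  define s where "s h = (\<Sum>i\<in>J. \<omega> i (h i))" for h
  define S where "S h = (\<Sum>i\<in>J. \<Omega> i (h i))" for h
  have bc: "bounded_clinear (\<omega> i)" "bounded_clinear (\<Omega> i)" if "i \<in> J" for i
    using \<omega> \<Omega> that by (auto simp: realizes_def)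
  have norm_eq: "norm (S h) = norm (s h)" for h
  proof -
    have "cinner (S h) (S h) = cinner (s h) (s h)"
      using \<omega> \<Omega> by (simp add: s_def S_def cinner.sum_left cinner.sum_right realizes_def)
    then show ?thesis
      by (simp add: cinner_self flip: of_real_power)
  qed
  have s_add: "s (\<lambda>i. g i + h i) = s g + s h" and S_add: "S (\<lambda>i. g i + h i) = S g + S h"
    and s_diff: "s (\<lambda>i. g i - h i) = s g - s h" and S_diff: "S (\<lambda>i. g i - h i) = S g - S h"
    and s_scale: "s (\<lambda>i. c *\<^sub>C h i) = c *\<^sub>C s h" and S_scale: "S (\<lambda>i. c *\<^sub>C h i) = c *\<^sub>C S h"
    for g h c
    by (simp_all add: s_def S_def bc bounded_clinear_add bounded_clinear_diff bounded_clinear_scaleC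
        sum.distrib sum_subtractf complex_vector.scale_sum_right)
  have well: "S g = S h" if "s g = s h" for g h
    using norm_eq[of "\<lambda>i. g i - h i"] that by (simp add: s_diff S_diff)
  define f where "f x = S (SOME h. s h = x)" for x
  have f: "f (s h) = S h" for h
    unfolding f_def by (rule well) (rule someI[of _ h], simp)
  have "\<exists>U. bounded_clinear U \<and> (\<forall>x\<in>range s. U x = f x)"
  proof (rule bounded_clinear_extension[where K = 1])
    show "complex_vector.subspace (range s)"
    proof (rule complex_vector.subspaceI)
      have "s (\<lambda>_. 0) = 0"
        by (simp add: s_def bc bounded_clinear_zero)
      then show "0 \<in> range s" by (metis rangeI)
      show "x + y \<in> range s" if "x \<in> range s" "y \<in> range s" for x y
        using that by (auto simp flip: s_add)
      show "c *\<^sub>C x \<in> range s" if "x \<in> range s" for c x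
        using that by (auto simp flip: s_scale)
    qed
    show "f (x + y) = f x + f y" if "x \<in> range s" "y \<in> range s" for x y
      using that by (auto simp: f S_add simp flip: s_add)
    show "f (c *\<^sub>C x) = c *\<^sub>C f x" if "x \<in> range s" for c x
      using that by (auto simp: f S_scale simp flip: s_scale)
    show "norm (f x) \<le> 1 * norm x" if "x \<in> range s" for x
      using that by (auto simp: f norm_eq)
  qed
  then obtain U where U: "bounded_clinear U" "\<And>h. U (s h) = S h"
    using f by auto
  have "U (\<omega> i h) = \<Omega> i h" if "i \<in> J" for i h
  proof -
    have "s (\<lambda>j. if j = i then h else 0) = (\<Sum>j\<in>J. if j = i then \<omega> i h else 0)"
      "S (\<lambda>j. if j = i then h else 0) = (\<Sum>j\<in>J. if j = i then \<Omega> i h else 0)"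
      unfolding s_def S_def
      by (auto intro!: sum.cong simp: bounded_clinear_zero[OF bc(1)] bounded_clinear_zero[OF bc(2)])
    then show ?thesis
      using U(2)[of "\<lambda>j. if j = i then h else 0"] fin that by simp
  qed
  with U(1) show ?thesis by blast
qed

lemma
  assumes "finite J" "realizes J A \<omega>" "realizes J A \<Omega>"
  shows bounded_clinear_identification: "bounded_clinear (identification J \<omega> \<Omega>)"
    and identification_generator: "i \<in> J \<Longrightarrow> identification J \<omega> \<Omega> (\<omega> i h) = \<Omega> i h"
proof -
  from someI_ex[OF exists_identification[OF assms]]
  show "bounded_clinear (identification J \<omega> \<Omega>)"
    "i \<in> J \<Longrightarrow> identification J \<omega> \<Omega> (\<omega> i h) = \<Omega> i h"
    unfolding identification_def by blast+
qed

lemma identification_isometric: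
  assumes "finite J" "realizes J A \<omega>" "realizes J A \<Omega>"
    and "x \<in> closed_range_span J \<omega>" "y \<in> closed_range_span J \<omega>"
  shows "cinner (identification J \<omega> \<Omega> x) (identification J \<omega> \<Omega> y) = cinner x y"
proof (rule isometric_on_closed_range_span[OF bounded_clinear_identification[OF assms(1-3)] _ assms(4,5)])
  fix i j h k assume "i \<in> J" "j \<in> J"
  then show "cinner (identification J \<omega> \<Omega> (\<omega> i h)) (identification J \<omega> \<Omega> (\<omega> j k))
      = cinner (\<omega> i h) (\<omega> j k)"
    using assms(2,3) by (simp add: identification_generator[OF assms(1-3)] realizes_def)
qed

lemma closed_csubspace_isometric_image:
  assumes U: "bounded_clinear U" and R: "closed_csubspace R"
    and iso: "\<And>x y. x \<in> R \<Longrightarrow> y \<in> R \<Longrightarrow> cinner (U x) (U y) = cinner x y"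
  shows "closed_csubspace (U ` R)"
proof -
  have norm: "norm (U x) = norm x" if "x \<in> R" for x
    using iso[OF that that] by (simp add: cinner_self flip: of_real_power)
  have "complete (U ` R)"
  proof (rule complete_isometric_image[where e = 1])
    show "subspace R"
      using R by (auto intro!: subspaceI closed_csubspace_zero closed_csubspace_add closed_csubspace_scaleR)
    show "complete R"
      using R by (simp add: closed_csubspace_def complete_eq_closed)
  qed (use norm bounded_clinear_linear[OF U] in auto)
  moreover have "complex_vector.subspace (U ` R)"
  proof (rule complex_vector.subspaceI)
    show "0 \<in> U ` R"
      using closed_csubspace_zero[OF R] bounded_clinear_zero[OF U] by force
    show "x + y \<in> U ` R" if "x \<in> U ` R" "y \<in> U ` R" for x y
      using that closed_csubspace_add[OF R] bounded_clinear_add[OF U] by (auto simp: image_iff) metis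
    show "c *\<^sub>C x \<in> U ` R" if "x \<in> U ` R" for c x
      using that closed_csubspace_scaleC[OF R] bounded_clinear_scaleC[OF U] by (auto simp: image_iff) metis
  qed
  ultimately show ?thesis
    by (simp add: closed_csubspace_def complete_imp_closed)
qed

section \<open>Completing one missing entry\<close>

lemma norm_eq_of_cinner_eq: "cinner x x = cinner y y \<Longrightarrow> norm x = norm y"
  for x :: "'a::chilbert_space" and y :: "'b::chilbert_space"
  by (simp add: cinner_self flip: of_real_power)

lemma bounded_clinear_contraction_proj:
  assumes D: "closed_csubspace D" and c: "c \<in> contractions D R"
  shows "bounded_clinear (\<lambda>x. c (orth_proj D x))"
proof (rule bounded_clinearI[where K = 1])
  note P = bounded_clinear_orth_proj[OF D] and P_in = orth_proj_in[OF D]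
  show "c (orth_proj D (x + y)) = c (orth_proj D x) + c (orth_proj D y)" for x y
    using c P_in by (simp add: bounded_clinear_add[OF P] contractions_def)
  show "c (orth_proj D (a *\<^sub>C x)) = a *\<^sub>C c (orth_proj D x)" for a x
    using c P_in by (simp add: bounded_clinear_scaleC[OF P] contractions_def)
  show "norm (c (orth_proj D x)) \<le> 1 * norm x" for x
    using c P_in[of x] norm_orth_proj_le[OF D, of x] by (force simp: contractions_def)
qed

text \<open>A positive semidefinite matrix on \<open>C \<union> {p, q}\<close> is sought of which all entries except those at
  \<open>(p, q)\<close> and \<open>(q, p)\<close> are known. The known entries are encoded in the realizations \<open>\<omega>\<close> and \<open>\<rho>\<close> of
  two overlapping submatrices; the values of \<open>A\<close> at the two missing places are left open.\<close>

locale realization_pair =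
  fixes C :: "'i set" and p q :: 'i and A :: "'i \<Rightarrow> 'i \<Rightarrow> 'h::chilbert_space \<Rightarrow> 'h"
    and \<omega> \<rho> :: "'i \<Rightarrow> 'h \<Rightarrow> 'k::chilbert_space"
  assumes fin: "finite C" and p: "p \<notin> C" and q: "q \<notin> C" and pq: "p \<noteq> q"
    and \<omega>: "realizes (insert p C) A \<omega>" and \<rho>: "realizes (insert q C) A \<rho>"
begin

text \<open>\<open>M\<close> and \<open>N\<close> are two copies of \<open>\<R>(A|C)\<close>, identified by \<open>V\<close>, and \<open>D\<close> and \<open>R\<close> are their orthogonal
  complements in \<open>\<R>(A|C \<union> {p})\<close> and \<open>\<R>(A|C \<union> {q})\<close>.\<close>

definition "M = closed_range_span C \<omega>"
definition "N = closed_range_span C \<rho>"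
definition "D = closed_range_span (insert p C) \<omega> \<ominus> M"
definition "R = closed_range_span (insert q C) \<rho> \<ominus> N"
definition "V = identification C \<omega> \<rho>"

text \<open>\<open>W c\<close> is \<open>\<omega>\<^sub>p\<close> seen from \<open>\<R>(A|C \<union> {q})\<close>: the component in the common part \<open>\<R>(A|C)\<close> is kept,
  and the orthogonal component is mapped by \<open>c\<close>.\<close>

definition W :: "('k \<Rightarrow> 'k) \<Rightarrow> 'h \<Rightarrow> 'k" where
  "W c h = V (orth_proj M (\<omega> p h)) + c (orth_proj D (\<omega> p h))"

lemma closed [simp]: "closed_csubspace M" "closed_csubspace N" "closed_csubspace D" "closed_csubspace R"
  by (simp_all add: M_def N_def D_def R_def closed_csubspace_crs closed_csubspace_orth_diff)

lemma realizes_C: "realizes C A \<omega>" "realizes C A \<rho>"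
  using \<omega> \<rho> by (auto simp: realizes_def)

lemma V: "bounded_clinear V" and V_generator: "i \<in> C \<Longrightarrow> V (\<omega> i h) = \<rho> i h"
  using bounded_clinear_identification[OF fin realizes_C]
    identification_generator[OF fin realizes_C] by (simp_all add: V_def)

lemma V_isometric: "x \<in> M \<Longrightarrow> y \<in> M \<Longrightarrow> cinner (V x) (V y) = cinner x y"
  unfolding V_def M_def by (rule identification_isometric[OF fin realizes_C])

lemma V_in_N: "x \<in> M \<Longrightarrow> V x \<in> N"
  using image_closed_range_span_subset[OF V closed(2), of C \<omega>]
  by (auto simp: M_def N_def V_generator in_closed_range_span)

lemma bounded_clinear_\<omega>_p: "bounded_clinear (\<omega> p)"
  using \<omega> by (simp add: realizes_def)

lemma bounded_clinear_W: "c \<in> contractions D R \<Longrightarrow> bounded_clinear (W c)"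
  unfolding W_def
  by (intro bounded_clinear_plus bounded_clinear_compose[OF V] bounded_clinear_\<omega>_p
      bounded_clinear_compose[OF bounded_clinear_orth_proj[OF closed(1)]]
      bounded_clinear_compose[OF bounded_clinear_contraction_proj[OF closed(3)]])

lemma M_subset: "M \<subseteq> closed_range_span (insert p C) \<omega>"
  and N_subset: "N \<subseteq> closed_range_span (insert q C) \<rho>"
  unfolding M_def N_def by (auto intro!: closed_range_span_mono)

lemma split_\<omega>_p: "orth_proj M (\<omega> p h) + orth_proj D (\<omega> p h) = \<omega> p h"
  unfolding D_def
  by (rule orth_proj_add_orth_diff[OF closed_csubspace_crs closed(1) M_subset in_closed_range_span]) simp

lemma split_\<rho>_q: "orth_proj N (\<rho> q h) + orth_proj R (\<rho> q h) = \<rho> q h"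
  unfolding R_def
  by (rule orth_proj_add_orth_diff[OF closed_csubspace_crs closed(2) N_subset in_closed_range_span]) simp

lemma orth_D: "x \<in> M \<Longrightarrow> d \<in> D \<Longrightarrow> cinner x d = 0"
  and orth_R: "x \<in> N \<Longrightarrow> r \<in> R \<Longrightarrow> cinner x r = 0"
  by (simp_all add: D_def R_def orth_diff_def)

lemma contraction_in: "c \<in> contractions D R \<Longrightarrow> c (orth_proj D x) \<in> R"
  using orth_proj_in[OF closed(3)] by (auto simp: contractions_def)

lemma W_on_C:
  assumes c: "c \<in> contractions D R" and j: "j \<in> C"
  shows "cinner (W c h) (\<rho> j h') = cinner h (A p j h')"
proof -
  have "cinner (\<rho> j h') (c (orth_proj D (\<omega> p h))) = 0"
    using contraction_in[OF c] in_closed_range_span[OF j, of \<rho> h'] by (intro orth_R) (auto simp: N_def)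
  then have "cinner (W c h) (\<rho> j h') = cinner (V (orth_proj M (\<omega> p h))) (V (\<omega> j h'))"
    by (simp add: W_def cinner_add_left V_generator[OF j] cinner_zero_commute[of "c _"])
  also have "\<dots> = cinner (orth_proj M (\<omega> p h)) (\<omega> j h')"
    using in_closed_range_span[OF j, of \<omega> h'] by (intro V_isometric orth_proj_in closed) (simp add: M_def)
  also have "\<dots> = cinner (\<omega> p h) (\<omega> j h')"
    using cinner_orth_proj[OF closed(1), of "\<omega> j h'" "\<omega> p h"] in_closed_range_span[OF j, of \<omega> h']
      cinner_commute by (metis M_def)
  also have "\<dots> = cinner h (A p j h')"
    using \<omega> j by (simp add: realizes_def)
  finally show ?thesis .
qed

lemma
  assumes c: "c \<in> contractions D R"
  shows norm_W: "(norm (W c h))\<^sup>2 = (norm (orth_proj M (\<omega> p h)))\<^sup>2 + (norm (c (orth_proj D (\<omega> p h))))\<^sup>2"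
    and norm_\<omega>_p: "(norm (\<omega> p h))\<^sup>2 = (norm (orth_proj M (\<omega> p h)))\<^sup>2 + (norm (orth_proj D (\<omega> p h)))\<^sup>2"
proof -
  have "norm (V (orth_proj M (\<omega> p h))) = norm (orth_proj M (\<omega> p h))"
    by (intro norm_eq_of_cinner_eq V_isometric orth_proj_in closed)
  moreover have "cinner (V (orth_proj M (\<omega> p h))) (c (orth_proj D (\<omega> p h))) = 0"
    by (intro orth_R V_in_N orth_proj_in closed contraction_in c)
  ultimately show "(norm (W c h))\<^sup>2
      = (norm (orth_proj M (\<omega> p h)))\<^sup>2 + (norm (c (orth_proj D (\<omega> p h))))\<^sup>2"
    unfolding W_def by (simp add: norm_add_orthogonal)
  have "cinner (orth_proj M (\<omega> p h)) (orth_proj D (\<omega> p h)) = 0"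
    by (intro orth_D orth_proj_in closed)
  then show "(norm (\<omega> p h))\<^sup>2 = (norm (orth_proj M (\<omega> p h)))\<^sup>2 + (norm (orth_proj D (\<omega> p h)))\<^sup>2"
    using norm_add_orthogonal[of "orth_proj M (\<omega> p h)" "orth_proj D (\<omega> p h)"] by (simp add: split_\<omega>_p)
qed

text \<open>With \<open>d\<close> the component of \<open>\<omega>\<^sub>p h\<^sub>p\<close> in \<open>D\<close>, the quadratic form of the completed matrix is
  \<open>\<parallel>W h\<^sub>p + \<Sum>\<^sub>i \<rho>\<^sub>i h\<^sub>i\<parallel>\<^sup>2 + \<parallel>d\<parallel>\<^sup>2 - \<parallel>c d\<parallel>\<^sup>2\<close>.\<close>

lemma positive_semidefinite_completion:
  assumes c: "c \<in> contractions D R"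
    and pq_entry: "\<And>h h'. cinner h (A p q h') = cinner (W c h) (\<rho> q h')"
    and qp_entry: "\<And>h h'. cinner h' (A q p h) = cinner (A p q h') h"
  shows "positive_semidefinite (insert p (insert q C)) A"
  unfolding positive_semidefinite_def
proof
  fix f :: "'i \<Rightarrow> 'h"
  let ?J = "insert q C"
  define w where "w = W c (f p)"
  define v where "v = (\<Sum>i\<in>?J. \<rho> i (f i))"
  define d where "d = orth_proj D (\<omega> p (f p))"
  have finJ: "finite ?J" and pJ: "p \<notin> ?J"
    using fin p pq by auto
  have row: "cinner (f p) (A p j (f j)) = cinner w (\<rho> j (f j))" if "j \<in> ?J" for j
    using that pq_entry W_on_C[OF c] by (auto simp: w_def)
  have col: "cinner (f i) (A i p (f p)) = cinner (\<rho> i (f i)) w" if "i \<in> ?J" for i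
  proof (cases "i = q")
    case True
    then show ?thesis
      using row[of q] qp_entry[of "f q" "f p"] cinner_commute by (metis insertI1)
  next
    case False
    then have "cinner (f i) (A i p (f p)) = cinner (\<omega> i (f i)) (\<omega> p (f p))"
      "cinner (f p) (A p i (f i)) = cinner (\<omega> p (f p)) (\<omega> i (f i))"
      using \<omega> that by (auto simp: realizes_def)
    then show ?thesis
      using row[OF that] cinner_commute by metis
  qed
  have diag: "cinner (f p) (A p p (f p)) = cinner w w + of_real ((norm d)\<^sup>2 - (norm (c d))\<^sup>2)"
  proof -
    have "cinner (f p) (A p p (f p)) = cinner (\<omega> p (f p)) (\<omega> p (f p))"
      using \<omega> by (simp add: realizes_def)
    then show ?thesis
      unfolding w_def d_def cinner_self norm_W[OF c] norm_\<omega>_p[OF c] by simp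
  qed
  have block: "(\<Sum>i\<in>?J. \<Sum>j\<in>?J. cinner (f i) (A i j (f j))) = cinner v v"
    unfolding v_def cinner.sum_left
    by (intro sum.cong refl) (use \<rho> in \<open>auto simp: cinner.sum_right realizes_def intro!: sum.cong\<close>)
  have "(\<Sum>i\<in>insert p ?J. \<Sum>j\<in>insert p ?J. cinner (f i) (A i j (f j)))
      = cinner (f p) (A p p (f p)) + (\<Sum>j\<in>?J. cinner (f p) (A p j (f j)))
        + ((\<Sum>i\<in>?J. cinner (f i) (A i p (f p))) + (\<Sum>i\<in>?J. \<Sum>j\<in>?J. cinner (f i) (A i j (f j))))"
    by (simp only: sum.insert[OF finJ pJ] sum.distrib add_ac)
  also have "(\<Sum>j\<in>?J. cinner (f p) (A p j (f j))) = cinner w v"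
    unfolding v_def cinner.sum_right by (intro sum.cong refl row)
  also have "(\<Sum>i\<in>?J. cinner (f i) (A i p (f p))) = cinner v w"
    unfolding v_def cinner.sum_left by (intro sum.cong refl col)
  also note block
  also note diag
  also have "cinner w w + of_real ((norm d)\<^sup>2 - (norm (c d))\<^sup>2) + cinner w v + (cinner v w + cinner v v)
      = of_real ((norm (w + v))\<^sup>2 + ((norm d)\<^sup>2 - (norm (c d))\<^sup>2))"
    unfolding of_real_add cinner_self[of "w + v", symmetric] cinner_add_left cinner_add_right
    by simp
  also have "norm (c d) \<le> norm d"
    using c orth_proj_in[OF closed(3)] by (simp add: contractions_def d_def)
  then have "of_real ((norm (w + v))\<^sup>2 + ((norm d)\<^sup>2 - (norm (c d))\<^sup>2)) \<in> (\<real>\<^sub>\<ge>\<^sub>0 :: complex set)"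
    unfolding nonneg_Reals_of_real_iff by (simp add: power_mono)
  finally show "(\<Sum>i\<in>insert p ?J. \<Sum>j\<in>insert p ?J. cinner (f i) (A i j (f j))) \<in> \<real>\<^sub>\<ge>\<^sub>0" .
qed

text \<open>The vectors \<open>\<rho>\<^sub>q h\<close> separate the points of \<open>R\<close>, and the maps \<open>c \<circ> P\<^sub>D\<close> are determined on the
  closed span by their values at the generators.\<close>

lemma contraction_unique:
  assumes c: "c \<in> contractions D R" and c': "c' \<in> contractions D R"
    and eq: "\<And>h h'. cinner (W c h) (\<rho> q h') = cinner (W c' h) (\<rho> q h')"
  shows "c = c'"
proof -
  let ?P = "orth_proj D"
  have zero: "c (?P (\<omega> p h)) = c' (?P (\<omega> p h))" for h
  proof -
    define r where "r = c (?P (\<omega> p h)) - c' (?P (\<omega> p h))"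
    have r: "r \<in> R"
      unfolding r_def by (intro closed_csubspace_diff closed contraction_in c c')
    have orth: "cinner r (\<rho> i h') = 0" if "i \<in> insert q C" for i h'
    proof (cases "i = q")
      case True
      then show ?thesis
        using eq[of h h'] by (simp add: r_def W_def cinner_add_left cinner.diff_left)
    next
      case False
      then have "\<rho> i h' \<in> N"
        using that by (auto simp: N_def in_closed_range_span)
      then show ?thesis
        using orth_R[OF _ r] cinner_zero_commute by blast
    qed
    have r_in: "r \<in> closed_range_span (insert q C) \<rho>"
      using r by (simp add: R_def orth_diff_def)
    have "cinner r r = 0"
      by (rule orthogonal_closed_range_span[OF orth r_in])
    then show ?thesis by (simp add: r_def)
  qed
  have M_zero: "?P x = 0" if "x \<in> M" for x
    using that orth_D[of x] closed_csubspace_zero[OF closed(3)]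
    by (intro orth_proj_eqI) (auto simp: cinner_zero_commute[of _ x])
  have "c d = c' d" if d: "d \<in> D" for d
  proof -
    have "c (?P d) = c' (?P d)"
    proof (rule eq_on_closed_range_span[where S = "\<lambda>x. c (?P x)" and T = "\<lambda>x. c' (?P x)"
          and \<omega> = \<omega> and J = "insert p C"])
      show "c (?P (\<omega> i h)) = c' (?P (\<omega> i h))" if "i \<in> insert p C" for i h
      proof (cases "i = p")
        case False
        then have "\<omega> i h \<in> M"
          using that by (auto simp: M_def in_closed_range_span)
        moreover have "c 0 = 0" "c' 0 = 0"
          using bounded_clinear_zero[OF bounded_clinear_contraction_proj[OF closed(3)]] c c'
            M_zero[OF closed_csubspace_zero[OF closed(1)]] by metis+
        ultimately show ?thesis
          by (simp add: M_zero)
      qed (simp add: zero)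
      show "d \<in> closed_range_span (insert p C) \<omega>"
        using d by (simp add: D_def orth_diff_def)
    qed (rule bounded_clinear_contraction_proj[OF closed(3) c]
        bounded_clinear_contraction_proj[OF closed(3) c'])+
    then show ?thesis
      using d by (simp add: orth_proj_ident)
  qed
  moreover have "c \<in> extensional D" "c' \<in> extensional D"
    using c c' by (auto simp: contractions_def PiE_def)
  ultimately show ?thesis
    by (auto intro: extensionalityI)
qed

end

text \<open>Now the matrix is complete, with a realization \<open>\<Omega>\<close> into which those of the two submatrices
  embed.\<close>

locale realization_triple = realization_pair C p q A \<omega> \<rho>
  for C :: "'i set" and p q A and \<omega> \<rho> :: "'i \<Rightarrow> 'h::chilbert_space \<Rightarrow> 'k::chilbert_space" +
  fixes \<Omega> :: "'i \<Rightarrow> 'h \<Rightarrow> 'k"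
  assumes \<Omega>: "realizes (insert p (insert q C)) A \<Omega>"
begin

definition "U_D = identification (insert p C) \<omega> \<Omega>"
definition "U_R = identification (insert q C) \<rho> \<Omega>"

definition compression :: "'k \<Rightarrow> 'k" where
  "compression = (\<lambda>d\<in>D. THE r. r \<in> R \<and> U_R r = orth_proj (U_R ` R) (U_D d))"

lemma realizes_\<Omega>: "realizes (insert p C) A \<Omega>" "realizes (insert q C) A \<Omega>"
  using \<Omega> by (auto simp: realizes_def)

lemma finite_insert_C: "finite (insert p C)" "finite (insert q C)"
  using fin by auto

lemma U_D: "bounded_clinear U_D" and U_D_generator: "i \<in> insert p C \<Longrightarrow> U_D (\<omega> i h) = \<Omega> i h"
  using bounded_clinear_identification[OF finite_insert_C(1) \<omega> realizes_\<Omega>(1)]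
    identification_generator[OF finite_insert_C(1) \<omega> realizes_\<Omega>(1)] by (simp_all add: U_D_def)

lemma U_R: "bounded_clinear U_R" and U_R_generator: "i \<in> insert q C \<Longrightarrow> U_R (\<rho> i h) = \<Omega> i h"
  using bounded_clinear_identification[OF finite_insert_C(2) \<rho> realizes_\<Omega>(2)]
    identification_generator[OF finite_insert_C(2) \<rho> realizes_\<Omega>(2)] by (simp_all add: U_R_def)

lemma U_D_isometric:
  "x \<in> closed_range_span (insert p C) \<omega> \<Longrightarrow> y \<in> closed_range_span (insert p C) \<omega>
    \<Longrightarrow> cinner (U_D x) (U_D y) = cinner x y"
  unfolding U_D_def by (rule identification_isometric[OF finite_insert_C(1) \<omega> realizes_\<Omega>(1)])

lemma U_R_isometric:
  "x \<in> closed_range_span (insert q C) \<rho> \<Longrightarrow> y \<in> closed_range_span (insert q C) \<rho>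
    \<Longrightarrow> cinner (U_R x) (U_R y) = cinner x y"
  unfolding U_R_def by (rule identification_isometric[OF finite_insert_C(2) \<rho> realizes_\<Omega>(2)])

lemma D_subset: "D \<subseteq> closed_range_span (insert p C) \<omega>"
  and R_subset: "R \<subseteq> closed_range_span (insert q C) \<rho>"
  by (auto simp: D_def R_def orth_diff_def)

text \<open>The embedding \<open>U\<^sub>R\<close> is isometric on \<open>R\<close>, so it maps \<open>R\<close> injectively onto a closed subspace and
  the vector \<open>r\<close> in the definition of the compression is unique.\<close>

lemma
  assumes d: "d \<in> D"
  shows compression_in: "compression d \<in> R"
    and cinner_compression: "r \<in> R \<Longrightarrow> cinner r (compression d) = cinner (U_R r) (U_D d)"
proof -
  have iso: "cinner (U_R x) (U_R y) = cinner x y" if "x \<in> R" "y \<in> R" for x y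
    using that R_subset by (intro U_R_isometric) auto
  have cl: "closed_csubspace (U_R ` R)"
    by (rule closed_csubspace_isometric_image[OF U_R closed(4) iso])
  let ?P = "\<lambda>r. r \<in> R \<and> U_R r = orth_proj (U_R ` R) (U_D d)"
  obtain r\<^sub>0 where r: "?P r\<^sub>0"
    using orth_proj_in[OF cl, of "U_D d"] by force
  have "r' = r\<^sub>0" if "?P r'" for r'
  proof -
    have "r' - r\<^sub>0 \<in> R"
      using that r by (intro closed_csubspace_diff closed) auto
    then have "cinner (r' - r\<^sub>0) (r' - r\<^sub>0) = cinner (U_R (r' - r\<^sub>0)) (U_R (r' - r\<^sub>0))"
      by (simp only: iso)
    also have "\<dots> = 0"
      using that r by (simp add: bounded_clinear_diff[OF U_R] cinner.zero_left)
    finally show ?thesis by simp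
  qed
  then have "?P (THE r. ?P r)"
    using theI[of ?P, OF r] by blast
  then have comp: "?P (compression d)"
    using d by (simp add: compression_def)
  then show "compression d \<in> R" by simp
  assume "r \<in> R"
  then show "cinner r (compression d) = cinner (U_R r) (U_D d)"
    using comp cinner_orth_proj[OF cl, of "U_R r" "U_D d"] iso[of r "compression d"] by simp
qed

lemma compression_contraction: "compression \<in> contractions D R"
  unfolding contractions_def
proof (intro CollectI conjI ballI allI)
  show "compression \<in> D \<rightarrow>\<^sub>E R"
    using compression_in by (auto simp: compression_def)
  have eqI: "x = y" if xy: "x \<in> R" "y \<in> R" and eq: "\<And>r. r \<in> R \<Longrightarrow> cinner r x = cinner r y" for x y
    using eq[OF closed_csubspace_diff[OF closed(4) xy]] cinner_eq_zero_iff[of "x - y"]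
    by (simp add: cinner.diff_right)
  show "compression (x + y) = compression x + compression y" if "x \<in> D" "y \<in> D" for x y
    using that
    by (intro eqI) (auto intro!: compression_in closed_csubspace_add
        simp: cinner_compression cinner_add_right bounded_clinear_add[OF U_D] closed_csubspace_add)
  show "compression (a *\<^sub>C x) = a *\<^sub>C compression x" if "x \<in> D" for a x
    using that
    by (intro eqI) (auto intro!: compression_in closed_csubspace_scaleC
        simp: cinner_compression cinner_scaleC_right bounded_clinear_scaleC[OF U_D]
        closed_csubspace_scaleC)
  fix d assume d: "d \<in> D"
  let ?r = "compression d"
  have nU: "norm (U_R ?r) = norm ?r" "norm (U_D d) = norm d"
    using d compression_in[OF d] D_subset R_subset
    by (auto intro!: norm_eq_of_cinner_eq U_R_isometric U_D_isometric)
  have "norm ?r * norm ?r = cmod (cinner ?r ?r)"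
    by (simp add: cinner_self norm_mult power2_eq_square)
  also have "\<dots> = cmod (cinner (U_R ?r) (U_D d))"
    by (simp add: cinner_compression[OF d compression_in[OF d]])
  also have "\<dots> \<le> norm ?r * norm d"
    using cmod_cinner_le[of "U_R ?r" "U_D d"] by (simp add: nU)
  finally show "norm ?r \<le> norm d"
    by (cases "?r = 0") auto
qed

lemma U_D_eq_U_R_V: "x \<in> M \<Longrightarrow> U_D x = U_R (V x)"
  unfolding M_def
  by (rule eq_on_closed_range_span[OF U_D bounded_clinear_compose[OF U_R V]])
    (simp_all add: U_D_generator V_generator U_R_generator)

lemma U_D_orth_U_R_N:
  assumes d: "d \<in> D" and x: "x \<in> N"
  shows "cinner (U_D d) (U_R x) = 0"
proof -
  have "closed_csubspace (U_R -` {y. \<forall>z\<in>{U_D d}. cinner z y = 0})"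
    by (rule closed_csubspace_vimage[OF U_R closed_csubspace_orth])
  moreover have "cinner (U_D d) (U_R (\<rho> i h)) = 0" if i: "i \<in> C" for i h
  proof -
    have "U_R (\<rho> i h) = U_D (\<omega> i h)"
      using i by (simp add: U_R_generator U_D_generator)
    moreover have "\<omega> i h \<in> M"
      using i by (simp add: M_def in_closed_range_span)
    ultimately have "cinner (U_D d) (U_R (\<rho> i h)) = cinner d (\<omega> i h)"
      using M_subset D_subset d by (auto intro!: U_D_isometric)
    also have "\<dots> = 0"
      using orth_D[OF \<open>\<omega> i h \<in> M\<close> d] cinner_zero_commute by blast
    finally show ?thesis .
  qed
  ultimately have "N \<subseteq> U_R -` {y. \<forall>z\<in>{U_D d}. cinner z y = 0}"
    unfolding N_def by (intro closed_range_span_subset) auto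
  with x show ?thesis by auto
qed

text \<open>The entry \<open>\<Omega>\<^sub>p\<^sup>* \<Omega>\<^sub>q\<close> splits along \<open>\<R>(A|C)\<close> into a part determined by the other entries and the
  part given by the compression.\<close>

lemma entry_eq_compression: "cinner h (A p q h') = cinner (W compression h) (\<rho> q h')"
proof -
  let ?x = "orth_proj M (\<omega> p h)" and ?d = "orth_proj D (\<omega> p h)"
  let ?y = "orth_proj N (\<rho> q h')" and ?r = "orth_proj R (\<rho> q h')"
  have x: "?x \<in> M" and d: "?d \<in> D" and y: "?y \<in> N" and r: "?r \<in> R"
    by (auto intro!: orth_proj_in)
  have Vx: "V ?x \<in> closed_range_span (insert q C) \<rho>"
    using V_in_N[OF x] N_subset by auto
  have "cinner h (A p q h') = cinner (\<Omega> p h) (\<Omega> q h')"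
    using \<Omega> by (simp add: realizes_def)
  also have "\<Omega> p h = U_R (V ?x) + U_D ?d"
    using arg_cong[OF split_\<omega>_p[of h], of U_D]
    by (simp add: bounded_clinear_add[OF U_D] U_D_generator U_D_eq_U_R_V[OF x])
  also have "cinner (U_R (V ?x) + U_D ?d) (\<Omega> q h')
      = cinner (U_R (V ?x)) (U_R (\<rho> q h')) + cinner (U_D ?d) (U_R (\<rho> q h'))"
    by (simp add: cinner_add_left U_R_generator)
  also have "cinner (U_R (V ?x)) (U_R (\<rho> q h')) = cinner (V ?x) (\<rho> q h')"
    by (intro U_R_isometric Vx in_closed_range_span) simp
  also have "cinner (U_D ?d) (U_R (\<rho> q h')) = cinner (compression ?d) (\<rho> q h')"
  proof -
    have "U_R (\<rho> q h') = U_R ?y + U_R ?r"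
      by (simp only: bounded_clinear_add[OF U_R, symmetric] split_\<rho>_q)
    then have "cinner (U_D ?d) (U_R (\<rho> q h')) = cinner (U_D ?d) (U_R ?r)"
      by (simp only: cinner_add_right U_D_orth_U_R_N[OF d y] add_0)
    also have "\<dots> = cnj (cinner (U_R ?r) (U_D ?d))"
      by (rule cinner_commute)
    also have "\<dots> = cnj (cinner ?r (compression ?d))"
      by (simp only: cinner_compression[OF d r])
    also have "\<dots> = cinner (compression ?d) ?r"
      by (rule cinner_commute[symmetric])
    also have "\<dots> = cinner (compression ?d) (\<rho> q h')"
      by (rule cinner_orth_proj[OF closed(4) compression_in[OF d]])
    finally show ?thesis .
  qed
  finally show ?thesis
    by (simp add: W_def cinner_add_left)
qed

end

section \<open>Positive definite functions and cliques\<close>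

lemma positive_semidefinite_cong:
  "(\<And>i j. i \<in> I \<Longrightarrow> j \<in> I \<Longrightarrow> A i j = B i j) \<Longrightarrow> positive_semidefinite I A \<longleftrightarrow> positive_semidefinite I B"
  by (simp add: positive_semidefinite_def cong: sum.cong)

lemma positive_semidefinite_reindex:
  assumes f: "inj_on f I" and psd: "positive_semidefinite I (\<lambda>i j. A (f i) (f j))"
  shows "positive_semidefinite (f ` I) A"
  unfolding positive_semidefinite_def
proof
  fix h
  have "(\<Sum>i\<in>I. \<Sum>j\<in>I. cinner (h (f i)) (A (f i) (f j) (h (f j)))) \<in> \<real>\<^sub>\<ge>\<^sub>0"
    using psd unfolding positive_semidefinite_def by (rule spec)
  then show "(\<Sum>i\<in>f ` I. \<Sum>j\<in>f ` I. cinner (h i) (A i j (h j))) \<in> \<real>\<^sub>\<ge>\<^sub>0"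
    by (simp add: sum.reindex[OF f])
qed

lemma positive_semidefinite_subset:
  fixes A :: "'i \<Rightarrow> 'i \<Rightarrow> 'h::chilbert_space \<Rightarrow> 'h"
  assumes "finite I" "J \<subseteq> I" and zero: "\<And>i j. i \<in> I \<Longrightarrow> j \<in> I \<Longrightarrow> A i j 0 = 0"
    and psd: "positive_semidefinite I A"
  shows "positive_semidefinite J A"
  unfolding positive_semidefinite_def
proof
  fix h :: "'i \<Rightarrow> 'h"
  let ?g = "\<lambda>i. if i \<in> J then h i else 0"
  have "(\<Sum>i\<in>I. \<Sum>j\<in>I. cinner (?g i) (A i j (?g j))) \<in> \<real>\<^sub>\<ge>\<^sub>0"
    using psd unfolding positive_semidefinite_def by (rule spec)
  also have "(\<Sum>i\<in>I. \<Sum>j\<in>I. cinner (?g i) (A i j (?g j)))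
      = (\<Sum>i\<in>J. \<Sum>j\<in>I. cinner (?g i) (A i j (?g j)))"
    using assms(1,2) by (intro sum.mono_neutral_right) (auto simp: cinner.zero_left)
  also have "\<dots> = (\<Sum>i\<in>J. \<Sum>j\<in>J. cinner (h i) (A i j (h j)))"
  proof (rule sum.cong[OF refl])
    fix i assume "i \<in> J"
    have "(\<Sum>j\<in>I. cinner (?g i) (A i j (?g j))) = (\<Sum>j\<in>J. cinner (?g i) (A i j (?g j)))"
      using assms(1,2) \<open>i \<in> J\<close>
      by (intro sum.mono_neutral_right) (auto simp: zero cinner.zero_right)
    also have "\<dots> = (\<Sum>j\<in>J. cinner (h i) (A i j (h j)))"
      using \<open>i \<in> J\<close> by (intro sum.cong) auto
    finally show "(\<Sum>j\<in>I. cinner (?g i) (A i j (?g j))) = (\<Sum>j\<in>J. cinner (h i) (A i j (h j)))" .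
  qed
  finally show "(\<Sum>i\<in>J. \<Sum>j\<in>J. cinner (h i) (A i j (h j))) \<in> \<real>\<^sub>\<ge>\<^sub>0" .
qed

text \<open>Repeated indices are harmless: the vectors belonging to the same index are added up.\<close>

lemma positive_semidefinite_pullback:
  fixes A :: "'j \<Rightarrow> 'j \<Rightarrow> 'h::chilbert_space \<Rightarrow> 'h" and f :: "'i \<Rightarrow> 'j"
  assumes fin: "finite I" and A: "\<And>u v. u \<in> f ` I \<Longrightarrow> v \<in> f ` I \<Longrightarrow> bounded_clinear (A u v)"
    and psd: "positive_semidefinite (f ` I) A"
  shows "positive_semidefinite I (\<lambda>i j. A (f i) (f j))"
  unfolding positive_semidefinite_def
proof
  fix h :: "'i \<Rightarrow> 'h"
  let ?H = "\<lambda>u. \<Sum>i | i \<in> I \<and> f i = u. h i"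
  have "(\<Sum>i\<in>I. \<Sum>j\<in>I. cinner (h i) (A (f i) (f j) (h j)))
      = (\<Sum>u\<in>f ` I. \<Sum>i | i \<in> I \<and> f i = u. \<Sum>v\<in>f ` I. \<Sum>j | j \<in> I \<and> f j = v.
          cinner (h i) (A (f i) (f j) (h j)))"
    by (subst sum.image_gen[OF fin, of _ f], intro sum.cong refl, rule sum.image_gen[OF fin])
  also have "\<dots> = (\<Sum>u\<in>f ` I. \<Sum>v\<in>f ` I. cinner (?H u) (A u v (?H v)))"
  proof (rule sum.cong[OF refl])
    fix u assume u: "u \<in> f ` I"
    have "(\<Sum>i | i \<in> I \<and> f i = u. \<Sum>v\<in>f ` I. \<Sum>j | j \<in> I \<and> f j = v.
          cinner (h i) (A (f i) (f j) (h j)))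
        = (\<Sum>i | i \<in> I \<and> f i = u. \<Sum>v\<in>f ` I. cinner (h i) (A u v (?H v)))"
    proof (intro sum.cong refl)
      fix i v assume "i \<in> {i \<in> I. f i = u}" "v \<in> f ` I"
      then show "(\<Sum>j | j \<in> I \<and> f j = v. cinner (h i) (A (f i) (f j) (h j)))
          = cinner (h i) (A u v (?H v))"
        using u by (simp add: bounded_clinear_sum[OF A] cinner.sum_right)
    qed
    also have "\<dots> = (\<Sum>v\<in>f ` I. \<Sum>i | i \<in> I \<and> f i = u. cinner (h i) (A u v (?H v)))"
      by (rule sum.swap)
    also have "\<dots> = (\<Sum>v\<in>f ` I. cinner (?H u) (A u v (?H v)))"
      by (simp only: cinner.sum_left)
    finally show "(\<Sum>i | i \<in> I \<and> f i = u. \<Sum>v\<in>f ` I. \<Sum>j | j \<in> I \<and> f j = v.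
          cinner (h i) (A (f i) (f j) (h j))) = (\<Sum>v\<in>f ` I. cinner (?H u) (A u v (?H v)))" .
  qed
  also have "\<dots> \<in> \<real>\<^sub>\<ge>\<^sub>0"
    using spec[OF psd[unfolded positive_semidefinite_def], of ?H] .
  finally show "(\<Sum>i\<in>I. \<Sum>j\<in>I. cinner (h i) (A (f i) (f j) (h j))) \<in> \<real>\<^sub>\<ge>\<^sub>0" .
qed

lemma positive_definite_iff_finite_sets:
  "positive_definite \<Sigma> \<phi> \<longleftrightarrow> (\<forall>s\<in>\<Sigma>. bounded_clinear (\<phi> s)) \<and>
    (\<forall>S. finite S \<longrightarrow> (\<forall>s\<in>S. \<forall>t\<in>S. inverse s * t \<in> \<Sigma>) \<longrightarrow> positive_semidefinite S (kernel_matrix \<phi>))"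
  (is "_ \<longleftrightarrow> ?B \<and> ?P")
proof
  assume pd: "positive_definite \<Sigma> \<phi>"
  have "positive_semidefinite S (kernel_matrix \<phi>)"
    if "finite S" and S: "\<forall>s\<in>S. \<forall>t\<in>S. inverse s * t \<in> \<Sigma>" for S
  proof -
    obtain f where f: "bij_betw f {..<card S} S"
      using ex_bij_betw_nat_finite[OF \<open>finite S\<close>] by (auto simp: atLeast0LessThan)
    have "positive_semidefinite {..<card S} (\<lambda>i j. \<phi> (inverse (f i) * f j))"
      using pd S bij_betwE[OF f] by (simp add: positive_definite_def)
    then have "positive_semidefinite (f ` {..<card S}) (kernel_matrix \<phi>)"
      using f by (intro positive_semidefinite_reindex) (simp_all add: bij_betw_def kernel_matrix_def)
    then show ?thesis
      using f by (simp add: bij_betw_def)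
  qed
  with pd show "?B \<and> ?P"
    by (simp add: positive_definite_def)
next
  assume BP: "?B \<and> ?P"
  have "positive_semidefinite {..<k} (\<lambda>i j. \<phi> (inverse (s i) * s j))"
    if s: "\<forall>i<k. \<forall>j<k. inverse (s i) * s j \<in> \<Sigma>" for k :: nat and s
  proof -
    have psd: "positive_semidefinite (s ` {..<k}) (kernel_matrix \<phi>)"
      using BP s by blast
    have bcl: "bounded_clinear (kernel_matrix \<phi> t u)" if "t \<in> s ` {..<k}" "u \<in> s ` {..<k}" for t u
      unfolding kernel_matrix_def using conjunct1[OF BP] s that by blast
    have "positive_semidefinite {..<k} (\<lambda>i j. kernel_matrix \<phi> (s i) (s j))"
      by (rule positive_semidefinite_pullback[OF finite_lessThan bcl psd])
    then show ?thesis
      by (simp add: kernel_matrix_def)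
  qed
  with BP show "positive_definite \<Sigma> \<phi>"
    by (simp add: positive_definite_def)
qed

lemma positive_definite_bounded_clinear: "positive_definite \<Sigma> \<phi> \<Longrightarrow> s \<in> \<Sigma> \<Longrightarrow> bounded_clinear (\<phi> s)"
  by (simp add: positive_definite_def)

lemma positive_definite_psd:
  "positive_definite \<Sigma> \<phi> \<Longrightarrow> finite S \<Longrightarrow> (\<And>s t. s \<in> S \<Longrightarrow> t \<in> S \<Longrightarrow> inverse s * t \<in> \<Sigma>)
    \<Longrightarrow> positive_semidefinite S (kernel_matrix \<phi>)"
  by (simp add: positive_definite_iff_finite_sets)

lemma positive_definite_cong_mono:
  assumes pd: "positive_definite \<Sigma> \<phi>" and sub: "\<Sigma>' \<subseteq> \<Sigma>" and eq: "\<And>s. s \<in> \<Sigma>' \<Longrightarrow> \<phi>' s = \<phi> s"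
  shows "positive_definite \<Sigma>' \<phi>'"
  unfolding positive_definite_def
proof (intro conjI ballI allI impI)
  show "bounded_clinear (\<phi>' s)" if "s \<in> \<Sigma>'" for s
    using that pd sub eq by (auto simp: positive_definite_def)
  fix k :: nat and s assume s: "\<forall>i<k. \<forall>j<k. inverse (s i) * s j \<in> \<Sigma>'"
  have "positive_semidefinite {..<k} (\<lambda>i j. \<phi> (inverse (s i) * s j))"
    using pd s sub unfolding positive_definite_def by blast
  then show "positive_semidefinite {..<k} (\<lambda>i j. \<phi>' (inverse (s i) * s j))"
    using s eq by (subst positive_semidefinite_cong[of _ _ "\<lambda>i j. \<phi> (inverse (s i) * s j)"]) auto
qed

lemma realization_realizes:
  fixes \<phi> :: "'a free_group \<Rightarrow> 'h::chilbert_space \<Rightarrow> 'h"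
  assumes "positive_definite \<Sigma> \<phi>" "finite S" "\<And>s t. s \<in> S \<Longrightarrow> t \<in> S \<Longrightarrow> inverse s * t \<in> \<Sigma>"
  shows "realizes S (kernel_matrix \<phi>) (realization S (kernel_matrix \<phi>))"
proof -
  have "\<exists>\<omega> :: 'a free_group \<Rightarrow> 'h \<Rightarrow> ('a free_group, 'h) ell2. realizes S (kernel_matrix \<phi>) \<omega>"
  proof (rule exists_realization[OF assms(2)])
    show "bounded_clinear (kernel_matrix \<phi> s t)" if "s \<in> S" "t \<in> S" for s t
      unfolding kernel_matrix_def
      by (rule positive_definite_bounded_clinear[OF assms(1) assms(3)[OF that]])
    show "positive_semidefinite S (kernel_matrix \<phi>)"
      by (rule positive_definite_psd[OF assms])
  qed
  then show ?thesis
    unfolding realization_def by (rule someI_ex)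
qed

lemma realizes_cong:
  "(\<And>s t. s \<in> S \<Longrightarrow> t \<in> S \<Longrightarrow> A s t = B s t) \<Longrightarrow> realizes S A \<omega> \<longleftrightarrow> realizes S B \<omega>"
  by (simp add: realizes_def)

lemma realization_cong:
  assumes "\<And>s t. s \<in> S \<Longrightarrow> t \<in> S \<Longrightarrow> A s t = B s t"
  shows "realization S A = realization S B"
  by (simp only: realization_def realizes_cong[OF assms])

text \<open>In a realization of the matrix on \<open>{1, s}\<close> the operators \<open>\<phi> s\<close> and \<open>\<phi> (s\<^sup>-\<^sup>1)\<close> are \<open>\<omega>\<^sub>1\<^sup>* \<omega>\<^sub>s\<close> and
  \<open>\<omega>\<^sub>s\<^sup>* \<omega>\<^sub>1\<close>.\<close>

lemma positive_definite_inverse: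
  assumes pd: "positive_definite \<Sigma> \<phi>" and mem: "1 \<in> \<Sigma>" "s \<in> \<Sigma>" "inverse s \<in> \<Sigma>"
  shows "cinner h (\<phi> (inverse s) h') = cinner (\<phi> s h) h'"
proof -
  let ?\<omega> = "realization {1, s} (kernel_matrix \<phi>)"
  have \<omega>: "realizes {1, s} (kernel_matrix \<phi>) ?\<omega>"
    using mem by (intro realization_realizes[OF pd]) (auto simp: free_group.inverse_neutral)
  have "cinner h (\<phi> (inverse s) h') = cinner (?\<omega> s h) (?\<omega> 1 h')"
    using \<omega> by (simp add: realizes_def kernel_matrix_def)
  also have "\<dots> = cnj (cinner (?\<omega> 1 h') (?\<omega> s h))"
    by (rule cinner_commute)
  also have "cinner (?\<omega> 1 h') (?\<omega> s h) = cinner h' (\<phi> s h)"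
    using \<omega> by (simp add: realizes_def kernel_matrix_def free_group.inverse_neutral)
  also have "cnj (cinner h' (\<phi> s h)) = cinner (\<phi> s h) h'"
    by (rule cinner_commute[symmetric])
  finally show ?thesis .
qed

section \<open>One step of the extension\<close>

locale extension_step = lexicographic_order le for le :: "'a::finite ord" +
  fixes \<mu> :: "'a free_group set"
  assumes \<mu>: "\<mu> \<in> F_hat" "\<mu> \<noteq> hat 1"
begin

abbreviation "s\<^sub>\<mu> \<equiv> least le \<mu>"
abbreviation "\<Sigma>\<^sub>\<mu> \<equiv> Sig le \<mu>"
abbreviation "\<Sigma>' \<equiv> Sig le (predecessor le \<mu>)"

definition "common = clique_of le \<mu> - {1, s\<^sub>\<mu>}"

lemma s_\<mu>: "hat s\<^sub>\<mu> = \<mu>" "s\<^sub>\<mu> \<noteq> 1" "s\<^sub>\<mu> \<in> \<mu>" "inverse s\<^sub>\<mu> \<in> \<mu>"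
proof -
  show 1: "hat s\<^sub>\<mu> = \<mu>"
    by (rule hat_least[OF \<mu>(1)])
  then show "s\<^sub>\<mu> \<noteq> 1"
    using \<mu>(2) by metis
  have "s\<^sub>\<mu> \<in> hat s\<^sub>\<mu>" "inverse s\<^sub>\<mu> \<in> hat s\<^sub>\<mu>"
    by (simp_all add: hat_def)
  then show "s\<^sub>\<mu> \<in> \<mu>" "inverse s\<^sub>\<mu> \<in> \<mu>"
    by (simp_all only: 1)
qed

lemma mem_\<mu>_iff: "t \<in> \<mu> \<longleftrightarrow> t = s\<^sub>\<mu> \<or> t = inverse s\<^sub>\<mu>"
  using s_\<mu>(1) unfolding hat_def by blast

lemma mem_\<mu>_iff_hat: "t \<in> \<mu> \<longleftrightarrow> hat t = \<mu>"
proof -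
  have "hat t = \<mu> \<longleftrightarrow> hat t = hat s\<^sub>\<mu>"
    by (simp only: s_\<mu>(1))
  also have "\<dots> \<longleftrightarrow> t \<in> \<mu>"
    unfolding hat_eq_iff mem_\<mu>_iff ..
  finally show ?thesis by (rule sym)
qed

lemma inverse_s_\<mu>_neq: "inverse s\<^sub>\<mu> \<noteq> s\<^sub>\<mu>"
proof
  assume eq: "inverse s\<^sub>\<mu> = s\<^sub>\<mu>"
  show False
    using inverse_prefix_neq[OF s_\<mu>(2), of "word_length s\<^sub>\<mu>"] unfolding eq by simp
qed

lemma mem_\<Sigma>'_iff: "t \<in> \<Sigma>' \<longleftrightarrow> t \<in> \<Sigma>\<^sub>\<mu> \<and> t \<notin> \<mu>"
  by (rule mem_Sig_predecessor_iff[OF \<mu>])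

lemma \<Sigma>'_subset: "\<Sigma>' \<subseteq> \<Sigma>\<^sub>\<mu>"
  by (auto simp: mem_\<Sigma>'_iff)

lemma \<mu>_subset: "\<mu> \<subseteq> \<Sigma>\<^sub>\<mu>"
  by (auto simp: mem_\<mu>_iff mem_Sig_iff s_\<mu>(1))

lemma one_mem: "1 \<in> \<Sigma>'" "1 \<in> \<Sigma>\<^sub>\<mu>"
  by (rule one_mem_Sig[OF predecessor_in_F_hat[OF \<mu>]], rule one_mem_Sig[OF \<mu>(1)])

lemma mem_clique_iff: "t \<in> clique_of le \<mu> \<longleftrightarrow> t \<in> \<Sigma>\<^sub>\<mu> \<and> inverse t * s\<^sub>\<mu> \<in> \<Sigma>\<^sub>\<mu>"
  by (simp add: clique_of_eq[OF \<mu>] mem_Sig_iff)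

lemma clique_mems: "1 \<in> clique_of le \<mu>" "s\<^sub>\<mu> \<in> clique_of le \<mu>"
  using one_mem by (simp_all add: mem_clique_iff free_group.inverse_neutral mem_Sig_iff s_\<mu>(1))

lemma clique_decomposition:
  "clique_of le \<mu> = insert 1 (insert s\<^sub>\<mu> common)"
  "clique_of le \<mu> - {s\<^sub>\<mu>} = insert 1 common" "clique_of le \<mu> - {1} = insert s\<^sub>\<mu> common"
  using clique_mems s_\<mu>(2) by (auto simp: common_def)

lemma finite_clique: "finite (clique_of le \<mu>)"
  by (rule finite_subset[OF _ finite_Sig[OF \<mu>(1)]]) (auto simp: mem_clique_iff)

lemma finite_common: "finite common"
  using finite_clique by (simp add: common_def)

lemma clique_quotient:
  assumes "t \<in> clique_of le \<mu>" "u \<in> clique_of le \<mu>"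
  shows "inverse t * u \<in> \<Sigma>\<^sub>\<mu>" "\<not> {1, s\<^sub>\<mu>} \<subseteq> {t, u} \<Longrightarrow> inverse t * u \<in> \<Sigma>'"
proof -
  have *: "hat_le le (hat (inverse t * u)) \<mu> \<and> (hat (inverse t * u) = \<mu> \<longrightarrow> {t, u} = {1, s\<^sub>\<mu>})"
    using assms unfolding mem_clique_iff mem_Sig_iff
    by (intro common_neighbours_adjacent[OF \<mu> refl]) blast+
  show mem: "inverse t * u \<in> \<Sigma>\<^sub>\<mu>"
    unfolding mem_Sig_iff by (rule conjunct1[OF *])
  show "inverse t * u \<in> \<Sigma>'" if "\<not> {1, s\<^sub>\<mu>} \<subseteq> {t, u}"
    unfolding mem_\<Sigma>'_iff mem_\<mu>_iff_hat using mem conjunct2[OF *] that by (metis order_refl)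
qed

lemma quotient_without_s_\<mu>:
  "t \<in> insert 1 common \<Longrightarrow> u \<in> insert 1 common \<Longrightarrow> inverse t * u \<in> \<Sigma>'"
  using s_\<mu>(2) by (intro clique_quotient(2)) (auto simp: common_def clique_mems)

lemma quotient_without_one:
  "t \<in> insert s\<^sub>\<mu> common \<Longrightarrow> u \<in> insert s\<^sub>\<mu> common \<Longrightarrow> inverse t * u \<in> \<Sigma>'"
  using s_\<mu>(2) by (intro clique_quotient(2)) (auto simp: common_def clique_mems)

definition \<omega> :: "('a free_group \<Rightarrow> 'h \<Rightarrow> 'h) \<Rightarrow> 'a free_group \<Rightarrow> 'h \<Rightarrow> ('a free_group, 'h::chilbert_space) ell2"
  where "\<omega> \<psi> = realization (insert 1 common) (kernel_matrix \<psi>)"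

definition \<rho> :: "('a free_group \<Rightarrow> 'h \<Rightarrow> 'h) \<Rightarrow> 'a free_group \<Rightarrow> 'h \<Rightarrow> ('a free_group, 'h::chilbert_space) ell2"
  where "\<rho> \<psi> = realization (insert s\<^sub>\<mu> common) (kernel_matrix \<psi>)"

lemma kernel_matrix_agree:
  assumes "\<And>t. t \<in> \<Sigma>' \<Longrightarrow> \<psi> t = \<psi>' t"
  shows "t \<in> insert 1 common \<Longrightarrow> u \<in> insert 1 common \<Longrightarrow> kernel_matrix \<psi> t u = kernel_matrix \<psi>' t u"
    and "t \<in> insert s\<^sub>\<mu> common \<Longrightarrow> u \<in> insert s\<^sub>\<mu> common \<Longrightarrow> kernel_matrix \<psi> t u = kernel_matrix \<psi>' t u"
  unfolding kernel_matrix_def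
  by (intro assms quotient_without_s_\<mu> quotient_without_one; assumption)+

lemma \<omega>_\<rho>_cong:
  assumes "\<And>t. t \<in> \<Sigma>' \<Longrightarrow> \<psi> t = \<psi>' t"
  shows "\<omega> \<psi> = \<omega> \<psi>'" "\<rho> \<psi> = \<rho> \<psi>'"
  unfolding \<omega>_def \<rho>_def by (intro realization_cong kernel_matrix_agree[OF assms]; assumption)+

lemma realization_pair_kernel:
  assumes pd: "positive_definite \<Sigma>' \<psi>" and eq: "\<And>t. t \<in> \<Sigma>' \<Longrightarrow> \<Phi> t = \<psi> t"
  shows "realization_pair common 1 s\<^sub>\<mu> (kernel_matrix \<Phi>) (\<omega> \<psi>) (\<rho> \<psi>)"
proof
  have "realizes (insert 1 common) (kernel_matrix \<psi>) (\<omega> \<psi>)"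
    unfolding \<omega>_def by (rule realization_realizes[OF pd])
      (auto simp: finite_common intro: quotient_without_s_\<mu>)
  then show "realizes (insert 1 common) (kernel_matrix \<Phi>) (\<omega> \<psi>)"
    by (simp only: realizes_cong[of "insert 1 common" "kernel_matrix \<Phi>" "kernel_matrix \<psi>",
          OF kernel_matrix_agree(1)[OF eq]])
  have "realizes (insert s\<^sub>\<mu> common) (kernel_matrix \<psi>) (\<rho> \<psi>)"
    unfolding \<rho>_def by (rule realization_realizes[OF pd])
      (auto simp: finite_common intro: quotient_without_one)
  then show "realizes (insert s\<^sub>\<mu> common) (kernel_matrix \<Phi>) (\<rho> \<psi>)"
    by (simp only: realizes_cong[of "insert s\<^sub>\<mu> common" "kernel_matrix \<Phi>" "kernel_matrix \<psi>",
          OF kernel_matrix_agree(2)[OF eq]])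
qed (use finite_common s_\<mu>(2) in \<open>auto simp: common_def\<close>)

lemma D_space_eq:
  "D_space le \<mu> \<psi> = closed_range_span (insert 1 common) (\<omega> \<psi>) \<ominus> closed_range_span common (\<omega> \<psi>)"
  by (simp add: D_space_def Let_def clique_decomposition(2) \<omega>_def flip: common_def)

lemma R_space_eq:
  "R_space le \<mu> \<psi> = closed_range_span (insert s\<^sub>\<mu> common) (\<rho> \<psi>) \<ominus> closed_range_span common (\<rho> \<psi>)"
  by (simp add: R_space_def Let_def clique_decomposition(3) \<rho>_def flip: common_def)

lemma D_R_space_cong:
  assumes "\<And>t. t \<in> \<Sigma>' \<Longrightarrow> \<psi> t = \<psi>' t"
  shows "D_space le \<mu> \<psi> = D_space le \<mu> \<psi>'" "R_space le \<mu> \<psi> = R_space le \<mu> \<psi>'"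
  by (simp_all add: D_space_eq R_space_eq \<omega>_\<rho>_cong[OF assms])

lemma gamma_cong:
  assumes "\<And>t. t \<in> \<Sigma>\<^sub>\<mu> \<Longrightarrow> \<Phi> t = \<Phi>' t"
  shows "gamma le \<mu> \<Phi> = gamma le \<mu> \<Phi>'"
proof -
  have "restrict \<Phi> \<Sigma>' = restrict \<Phi>' \<Sigma>'"
    using assms \<Sigma>'_subset by (intro restrict_ext) auto
  moreover have "realization (clique_of le \<mu>) (kernel_matrix \<Phi>) = realization (clique_of le \<mu>) (kernel_matrix \<Phi>')"
    unfolding kernel_matrix_def by (intro realization_cong assms clique_quotient(1))
  ultimately show ?thesis
    by (simp add: gamma_def)
qed

text \<open>With \<open>p = 1\<close>, \<open>q = s\<^sub>\<mu>\<close> and the common part \<open>C\<^sub>\<mu> - {1, s\<^sub>\<mu>}\<close> the compression is \<open>\<gamma>\<^sub>\<mu>(\<Phi>)\<close>. Replacing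
  \<open>\<Phi>\<close> by its restriction in the realizations of the two submatrices changes nothing, since these only
  involve values on \<open>\<Sigma>\<^sub>\<mu>\<^sub>-\<close>.\<close>

lemma
  assumes pd: "positive_definite \<Sigma>\<^sub>\<mu> \<Phi>"
  shows gamma_contraction: "gamma le \<mu> \<Phi> \<in> contractions (D_space le \<mu> \<Phi>) (R_space le \<mu> \<Phi>)"
    and new_entry_eq_gamma: "cinner h (\<Phi> s\<^sub>\<mu> h')
      = cinner (realization_pair.W common 1 (\<omega> \<Phi>) (\<rho> \<Phi>) (gamma le \<mu> \<Phi>) h) (\<rho> \<Phi> s\<^sub>\<mu> h')"
proof -
  let ?\<Omega> = "realization (clique_of le \<mu>) (kernel_matrix \<Phi>)"
  have \<Omega>: "realizes (insert 1 (insert s\<^sub>\<mu> common)) (kernel_matrix \<Phi>) ?\<Omega>"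
    unfolding clique_decomposition(1)[symmetric]
    by (rule realization_realizes[OF pd finite_clique clique_quotient(1)])
  have "positive_definite \<Sigma>' \<Phi>"
    using positive_definite_cong_mono[OF pd \<Sigma>'_subset] by blast
  then interpret realization_pair common 1 "s\<^sub>\<mu>" "kernel_matrix \<Phi>" "\<omega> \<Phi>" "\<rho> \<Phi>"
    by (rule realization_pair_kernel) simp
  interpret realization_triple common 1 "s\<^sub>\<mu>" "kernel_matrix \<Phi>" "\<omega> \<Phi>" "\<rho> \<Phi>" ?\<Omega>
    by unfold_locales (rule \<Omega>)
  have D: "D_space le \<mu> \<Phi> = D" and R: "R_space le \<mu> \<Phi> = R"
    by (simp_all add: D_space_eq R_space_eq D_def R_def M_def N_def)
  have restr: "D_space le \<mu> (restrict \<Phi> \<Sigma>') = D" "R_space le \<mu> (restrict \<Phi> \<Sigma>') = R"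
    "\<omega> (restrict \<Phi> \<Sigma>') = \<omega> \<Phi>" "\<rho> (restrict \<Phi> \<Sigma>') = \<rho> \<Phi>"
    unfolding D[symmetric] R[symmetric] by (intro D_R_space_cong \<omega>_\<rho>_cong; simp)+
  have gamma: "gamma le \<mu> \<Phi> = compression"
    unfolding gamma_def compression_def Let_def clique_decomposition(2,3) restr
      \<omega>_def[symmetric] \<rho>_def[symmetric] U_D_def U_R_def ..
  show "gamma le \<mu> \<Phi> \<in> contractions (D_space le \<mu> \<Phi>) (R_space le \<mu> \<Phi>)"
    unfolding gamma D R by (rule compression_contraction)
  show "cinner h (\<Phi> s\<^sub>\<mu> h') = cinner (W (gamma le \<mu> \<Phi>) h) (\<rho> \<Phi> s\<^sub>\<mu> h')"
    using entry_eq_compression[of h h']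
    by (simp add: gamma kernel_matrix_def free_group.inverse_neutral)
qed

lemma extension_determined_by_gamma:
  assumes pd: "positive_definite \<Sigma>\<^sub>\<mu> \<Phi>" "positive_definite \<Sigma>\<^sub>\<mu> \<Phi>'"
    and eq: "\<And>t. t \<in> \<Sigma>' \<Longrightarrow> \<Phi> t = \<Phi>' t" and gamma: "gamma le \<mu> \<Phi> = gamma le \<mu> \<Phi>'"
    and t: "t \<in> \<Sigma>\<^sub>\<mu>"
  shows "\<Phi> t = \<Phi>' t"
proof -
  have s: "\<Phi> s\<^sub>\<mu> = \<Phi>' s\<^sub>\<mu>"
  proof (rule ext, rule cinner_ext)
    show "cinner h (\<Phi> s\<^sub>\<mu> h') = cinner h (\<Phi>' s\<^sub>\<mu> h')" for h h'
      unfolding new_entry_eq_gamma[OF pd(1)] new_entry_eq_gamma[OF pd(2)]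
      by (simp only: gamma \<omega>_\<rho>_cong[OF eq])
  qed
  have mem: "1 \<in> \<Sigma>\<^sub>\<mu>" "s\<^sub>\<mu> \<in> \<Sigma>\<^sub>\<mu>" "inverse s\<^sub>\<mu> \<in> \<Sigma>\<^sub>\<mu>"
    using one_mem \<mu>_subset s_\<mu> by auto
  have inv: "\<Phi> (inverse s\<^sub>\<mu>) = \<Phi>' (inverse s\<^sub>\<mu>)"
    by (rule ext, rule cinner_ext)
      (simp only: positive_definite_inverse[OF pd(1) mem] positive_definite_inverse[OF pd(2) mem] s)
  show ?thesis
  proof (cases "t \<in> \<mu>")
    case True
    then show ?thesis
      unfolding mem_\<mu>_iff by (elim disjE) (simp_all only: s inv)
  next
    case False
    with t show ?thesis
      by (intro eq) (simp add: mem_\<Sigma>'_iff)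
  qed
qed

text \<open>A clique of \<open>\<Gamma>\<^sub>\<mu>\<close> that is not a clique of \<open>\<Gamma>\<^sub>\<mu>\<^sub>-\<close> has an edge that a translation carries to
  \<open>{1, s\<^sub>\<mu>}\<close>, so that the translated clique is contained in \<open>C\<^sub>\<mu>\<close>.\<close>

lemma positive_definite_step:
  assumes \<psi>: "positive_definite \<Sigma>' \<Phi>" and bcl: "\<And>t. t \<in> \<mu> \<Longrightarrow> bounded_clinear (\<Phi> t)"
    and psd: "positive_semidefinite (clique_of le \<mu>) (kernel_matrix \<Phi>)"
  shows "positive_definite \<Sigma>\<^sub>\<mu> \<Phi>"
  unfolding positive_definite_iff_finite_sets
proof (intro conjI ballI allI impI)
  show bc: "bounded_clinear (\<Phi> t)" if "t \<in> \<Sigma>\<^sub>\<mu>" for t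
    using that positive_definite_bounded_clinear[OF \<psi>, of t] bcl[of t] mem_\<Sigma>'_iff[of t] by blast
  fix S assume fin: "finite S" and S: "\<forall>t\<in>S. \<forall>u\<in>S. inverse t * u \<in> \<Sigma>\<^sub>\<mu>"
  show "positive_semidefinite S (kernel_matrix \<Phi>)"
  proof (cases "\<forall>t\<in>S. \<forall>u\<in>S. inverse t * u \<in> \<Sigma>'")
    case True
    then show ?thesis
      by (intro positive_definite_psd[OF \<psi> fin]) auto
  next
    case False
    then obtain t u where tu: "t \<in> S" "u \<in> S" "inverse t * u \<in> \<mu>"
      using S mem_\<Sigma>'_iff by blast
    obtain p q where pq: "p \<in> S" "q \<in> S" "inverse p * q = s\<^sub>\<mu>"
    proof (cases "inverse t * u = s\<^sub>\<mu>")
      case False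
      then have "inverse u * t = s\<^sub>\<mu>"
        using tu(3) mem_\<mu>_iff inverse_inverse_mult[of t u] free_group.inverse_inverse by metis
      then show ?thesis
        using that tu by blast
    qed (use that tu in blast)
    let ?f = "\<lambda>t. inverse p * t"
    have quotient: "inverse (?f t) * ?f u = inverse t * u" for t u
      by (metis free_group.inverse_distrib_swap free_group.inverse_inverse free_group.right_inverse
          mult.assoc mult.left_neutral)
    have sub: "?f ` S \<subseteq> clique_of le \<mu>"
    proof
      fix x assume "x \<in> ?f ` S"
      then obtain t where t: "t \<in> S" "x = ?f t" by blast
      then show "x \<in> clique_of le \<mu>"
        using S pq quotient[of t q] by (simp add: mem_clique_iff)
    qed
    have psd': "positive_semidefinite (?f ` S) (kernel_matrix \<Phi>)"
    proof (rule positive_semidefinite_subset[OF finite_clique sub _ psd])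
      show "kernel_matrix \<Phi> t u 0 = 0" if "t \<in> clique_of le \<mu>" "u \<in> clique_of le \<mu>" for t u
        unfolding kernel_matrix_def by (rule bounded_clinear_zero[OF bc[OF clique_quotient(1)[OF that]]])
    qed
    have "bounded_clinear (kernel_matrix \<Phi> t u)" if "t \<in> ?f ` S" "u \<in> ?f ` S" for t u
      unfolding kernel_matrix_def
      by (rule bc[OF clique_quotient(1)[OF subsetD[OF sub that(1)] subsetD[OF sub that(2)]]])
    then have "positive_semidefinite S (\<lambda>t u. kernel_matrix \<Phi> (?f t) (?f u))"
      by (rule positive_semidefinite_pullback[OF fin _ psd'])
    then show ?thesis
      by (rule positive_semidefinite_cong[THEN iffD1, rotated]) (simp only: kernel_matrix_def quotient)
  qed
qed

text \<open>The new value \<open>X = W\<^sup>* \<rho>\<close>, where \<open>W\<close> is formed with \<open>c\<close> and \<open>\<rho>\<close> is taken at \<open>s\<^sub>\<mu>\<close>, is the one that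
  the entry formula prescribes; its adjoint is the value at the inverse.\<close>

lemma exists_extension_with_gamma:
  fixes \<psi> :: "'a free_group \<Rightarrow> 'h::chilbert_space \<Rightarrow> 'h"
  assumes pd: "positive_definite \<Sigma>' \<psi>" and c: "c \<in> contractions (D_space le \<mu> \<psi>) (R_space le \<mu> \<psi>)"
  shows "\<exists>\<Phi>. positive_definite \<Sigma>\<^sub>\<mu> \<Phi> \<and> (\<forall>t\<in>\<Sigma>'. \<Phi> t = \<psi> t) \<and> gamma le \<mu> \<Phi> = c"
proof -
  interpret p: realization_pair common 1 "s\<^sub>\<mu>" "kernel_matrix \<psi>" "\<omega> \<psi>" "\<rho> \<psi>"
    by (rule realization_pair_kernel[OF pd]) simp
  have D: "D_space le \<mu> \<psi> = p.D" and R: "R_space le \<mu> \<psi> = p.R"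
    by (simp_all add: D_space_eq R_space_eq p.D_def p.R_def p.M_def p.N_def)
  note c' = c[unfolded D R]
  obtain W' where W': "bounded_clinear W'" "\<And>h k. cinner (p.W c h) k = cinner h (W' k)"
    using exists_adjoint[OF p.bounded_clinear_W[OF c']] by blast
  have "bounded_clinear (\<rho> \<psi> s\<^sub>\<mu>)"
    using p.\<rho> by (simp add: realizes_def)
  define X where "X h = W' (\<rho> \<psi> s\<^sub>\<mu> h)" for h
  have X: "bounded_clinear X"
    unfolding X_def by (rule bounded_clinear_compose[OF W'(1) \<open>bounded_clinear (\<rho> \<psi> s\<^sub>\<mu>)\<close>])
  obtain X' where X': "bounded_clinear X'" "\<And>h k. cinner (X h) k = cinner h (X' k)"
    using exists_adjoint[OF X] by blast
  define \<Phi> where "\<Phi> = \<psi>(s\<^sub>\<mu> := X, inverse s\<^sub>\<mu> := X')"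
  have \<Phi>_s: "\<Phi> s\<^sub>\<mu> = X" "\<Phi> (inverse s\<^sub>\<mu>) = X'"
    using inverse_s_\<mu>_neq by (auto simp: \<Phi>_def)
  have \<Phi>_eq: "\<Phi> t = \<psi> t" if "t \<in> \<Sigma>'" for t
    using that by (auto simp: \<Phi>_def mem_\<Sigma>'_iff mem_\<mu>_iff)
  interpret f: realization_pair common 1 "s\<^sub>\<mu>" "kernel_matrix \<Phi>" "\<omega> \<psi>" "\<rho> \<psi>"
    by (rule realization_pair_kernel[OF pd \<Phi>_eq])
  have entry: "cinner h (\<Phi> s\<^sub>\<mu> h') = cinner (p.W c h) (\<rho> \<psi> s\<^sub>\<mu> h')" for h h'
    by (simp add: \<Phi>_s X_def W'(2))
  have "positive_semidefinite (insert 1 (insert s\<^sub>\<mu> common)) (kernel_matrix \<Phi>)"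
  proof (rule f.positive_semidefinite_completion[OF c'])
    show "cinner h (kernel_matrix \<Phi> 1 s\<^sub>\<mu> h') = cinner (p.W c h) (\<rho> \<psi> s\<^sub>\<mu> h')" for h h'
      using entry by (simp add: kernel_matrix_def free_group.inverse_neutral)
    show "cinner h' (kernel_matrix \<Phi> s\<^sub>\<mu> 1 h) = cinner (kernel_matrix \<Phi> 1 s\<^sub>\<mu> h') h" for h h'
      by (simp add: kernel_matrix_def free_group.inverse_neutral \<Phi>_s X'(2))
  qed
  then have pd\<Phi>: "positive_definite \<Sigma>\<^sub>\<mu> \<Phi>"
    by (intro positive_definite_step positive_definite_cong_mono[OF pd subset_refl \<Phi>_eq])
      (auto simp: clique_decomposition(1) mem_\<mu>_iff \<Phi>_s X X'(1))
  have "gamma le \<mu> \<Phi> = c"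
  proof (rule p.contraction_unique[OF _ c'])
    note \<omega>_\<rho>_cong[OF \<Phi>_eq] D_R_space_cong[OF \<Phi>_eq]
    note eqs = this
    show "gamma le \<mu> \<Phi> \<in> contractions p.D p.R"
      using gamma_contraction[OF pd\<Phi>] by (simp only: eqs D R)
    show "cinner (p.W (gamma le \<mu> \<Phi>) h) (\<rho> \<psi> s\<^sub>\<mu> h') = cinner (p.W c h) (\<rho> \<psi> s\<^sub>\<mu> h')" for h h'
      using new_entry_eq_gamma[OF pd\<Phi>, of h h'] by (simp only: eqs entry)
  qed
  with pd\<Phi> \<Phi>_eq show ?thesis by blast
qed

lemma zero_contraction: "(\<lambda>d\<in>D_space le \<mu> \<psi>. 0) \<in> contractions (D_space le \<mu> \<psi>) (R_space le \<mu> \<psi>)"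
proof -
  have "closed_csubspace (D_space le \<mu> \<psi>)" "closed_csubspace (R_space le \<mu> \<psi>)"
    by (simp_all add: D_space_eq R_space_eq closed_csubspace_orth_diff closed_csubspace_crs)
  then show ?thesis
    by (auto simp: contractions_def closed_csubspace_zero closed_csubspace_add closed_csubspace_scaleC)
qed

end

section \<open>All steps of the extension\<close>

context lexicographic_order
begin

lemma
  assumes \<nu>: "\<nu> \<in> F_hat" and \<mu>: "\<mu> \<in> hat_above le \<nu>"
  shows hat_above_in_F_hat: "\<mu> \<in> F_hat" and hat_above_neq_one: "\<mu> \<noteq> hat 1"
    and hat_above_step: "extension_step le \<mu>"
    and hat_above_predecessor: "predecessor le \<mu> = \<nu> \<or> predecessor le \<mu> \<in> hat_above le \<nu>"
    and Sig_subset_predecessor: "Sig le \<nu> \<subseteq> Sig le (predecessor le \<mu>)"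
proof -
  show F: "\<mu> \<in> F_hat"
    using \<mu> by (simp add: hat_above_def)
  have less: "hat_less le \<nu> \<mu>"
    using \<mu> by (simp add: hat_above_def)
  show ne: "\<mu> \<noteq> hat 1"
    using less hat_less_iff[OF \<nu> F] hat_one_le[OF \<nu>] by metis
  show "extension_step le \<mu>"
    by unfold_locales (rule F, rule ne)
  have le: "hat_le le \<nu> (predecessor le \<mu>)"
    by (rule predecessor_greatest[OF F ne \<nu> less])
  then show "Sig le \<nu> \<subseteq> Sig le (predecessor le \<mu>)"
    by (rule Sig_mono)
  show "predecessor le \<mu> = \<nu> \<or> predecessor le \<mu> \<in> hat_above le \<nu>"
    using le predecessor_in_F_hat[OF F ne] by (auto simp: hat_above_def hat_less_def)
qed

lemma predecessor_inject:
  assumes \<kappa>: "\<kappa> \<in> F_hat" "\<kappa> \<noteq> hat 1" and \<mu>: "\<mu> \<in> F_hat" "\<mu> \<noteq> hat 1"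
    and eq: "predecessor le \<kappa> = predecessor le \<mu>"
  shows "\<kappa> = \<mu>"
proof (rule hat_le_antisym[OF \<kappa>(1) \<mu>(1)])
  have le: "hat_le le \<mu>' \<kappa>'" if "\<kappa>' \<in> F_hat" "\<kappa>' \<noteq> hat 1" "\<mu>' \<in> F_hat" "\<mu>' \<noteq> hat 1"
    and eq': "predecessor le \<kappa>' = predecessor le \<mu>'" for \<kappa>' \<mu>'
  proof (rule ccontr)
    assume "\<not> ?thesis"
    then have "hat_less le \<kappa>' \<mu>'"
      using hat_less_iff[OF that(1,3)] by blast
    then have "hat_le le \<kappa>' (predecessor le \<kappa>')"
      unfolding eq' by (rule predecessor_greatest[OF that(3,4,1)])
    then show False
      using predecessor_less[OF that(1,2)] hat_less_iff[OF predecessor_in_F_hat[OF that(1,2)] that(1)]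
      by blast
  qed
  show "hat_le le \<kappa> \<mu>" "hat_le le \<mu> \<kappa>"
    using le[OF \<kappa> \<mu> eq] le[OF \<mu> \<kappa> eq[symmetric]] by blast+
qed

text \<open>There are words of any length, so some class lies above \<open>\<nu>\<close>, and only finitely many classes lie
  below a given one.\<close>

lemma exists_successor:
  assumes \<nu>: "\<nu> \<in> F_hat"
  shows "\<exists>\<mu>. \<mu> \<in> hat_above le \<nu> \<and> predecessor le \<mu> = \<nu>"
proof -
  obtain t where t: "\<nu> = hat t"
    using \<nu> by (auto simp: F_hat_def)
  obtain u :: "'a free_group" where "word_length u = Suc (word_length t)"
    using exists_word_length by blast
  then have u: "hat u \<in> hat_above le \<nu>"
    unfolding hat_above_def t by (simp add: hat_less_if_shorter)
  let ?X = "{\<mu> \<in> hat_above le \<nu>. hat_le le \<mu> (hat u)}"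
  have "finite ?X"
    by (rule finite_subset[OF _ finite_hat_le[of "hat u"]]) (auto simp: hat_above_def)
  moreover have "hat u \<in> ?X"
    using u by simp
  ultimately obtain \<mu> where \<mu>: "\<mu> \<in> ?X" "\<forall>\<kappa>\<in>?X. hat_le le \<mu> \<kappa>"
    using exists_hat_min[of ?X] by blast
  have F: "\<mu> \<in> F_hat" and less: "hat_less le \<nu> \<mu>" and u_le: "hat_le le \<mu> (hat u)"
    using \<mu>(1) by (simp_all add: hat_above_def)
  have "predecessor le \<mu> = \<nu>"
  proof (rule predecessor_eqI[OF \<nu> F less])
    fix \<kappa> assume \<kappa>: "\<kappa> \<in> F_hat" "hat_less le \<kappa> \<mu>"
    show "hat_le le \<kappa> \<nu>"
    proof (rule ccontr)
      assume "\<not> ?thesis"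
      then have "hat_less le \<nu> \<kappa>"
        using hat_less_iff[OF \<nu> \<kappa>(1)] by blast
      moreover have "hat_le le \<kappa> (hat u)"
        using hat_le_trans[OF _ u_le] \<kappa>(2) by (simp add: hat_less_def)
      ultimately have "\<kappa> \<in> ?X"
        using \<kappa>(1) by (simp add: hat_above_def)
      then have "hat_le le \<mu> \<kappa>"
        using \<mu>(2) by blast
      then show False
        using \<kappa>(2) hat_less_iff[OF \<kappa>(1) F] by blast
    qed
  qed
  then show ?thesis
    using \<mu>(1) by blast
qed

lemma hat_above_induct:
  assumes \<nu>: "\<nu> \<in> F_hat" and \<mu>: "\<mu> \<in> hat_above le \<nu>"
    and step: "\<And>\<mu>. \<mu> \<in> hat_above le \<nu> \<Longrightarrow>
      (predecessor le \<mu> \<noteq> \<nu> \<Longrightarrow> predecessor le \<mu> \<in> hat_above le \<nu> \<and> P (predecessor le \<mu>)) \<Longrightarrow> P \<mu>"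
  shows "P \<mu>"
  using \<mu>
proof (induction "card (Sig le \<mu>)" arbitrary: \<mu> rule: less_induct)
  case less
  note \<mu> = hat_above_in_F_hat[OF \<nu> less.prems] hat_above_neq_one[OF \<nu> less.prems]
  show ?case
  proof (rule step[OF less.prems])
    assume "predecessor le \<mu> \<noteq> \<nu>"
    then have above: "predecessor le \<mu> \<in> hat_above le \<nu>"
      using hat_above_predecessor[OF \<nu> less.prems] by blast
    moreover have "P (predecessor le \<mu>)"
      by (rule less.hyps[OF card_Sig_less[OF predecessor_in_F_hat[OF \<mu>] \<mu>(1) predecessor_less[OF \<mu>]] above])
    ultimately show "predecessor le \<mu> \<in> hat_above le \<nu> \<and> P (predecessor le \<mu>)" ..
  qed
qed

text \<open>At every step the parameter determines the new value and the previous values determine the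
  spaces on which the parameter lives.\<close>

lemma extensions_determined_by_gammas:
  assumes \<nu>: "\<nu> \<in> F_hat" and \<mu>: "\<mu> \<in> hat_above le \<nu>"
    and pd: "positive_definite (Sig le \<mu>) \<Phi>" "positive_definite (Sig le \<mu>) \<Phi>'"
    and eq: "\<And>s. s \<in> Sig le \<nu> \<Longrightarrow> \<Phi> s = \<Phi>' s"
    and gamma: "\<And>\<kappa>. \<kappa> \<in> hat_above le \<nu> \<Longrightarrow> hat_le le \<kappa> \<mu> \<Longrightarrow> gamma le \<kappa> \<Phi> = gamma le \<kappa> \<Phi>'"
    and s: "s \<in> Sig le \<mu>"
  shows "\<Phi> s = \<Phi>' s"
proof -
  have "positive_definite (Sig le \<mu>) \<Phi> \<longrightarrow> positive_definite (Sig le \<mu>) \<Phi>' \<longrightarrow>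
      (\<forall>\<kappa>\<in>hat_above le \<nu>. hat_le le \<kappa> \<mu> \<longrightarrow> gamma le \<kappa> \<Phi> = gamma le \<kappa> \<Phi>') \<longrightarrow>
      (\<forall>s\<in>Sig le \<mu>. \<Phi> s = \<Phi>' s)"
  proof (rule hat_above_induct[OF \<nu> \<mu>], intro impI ballI)
    fix \<mu> s
    assume \<mu>: "\<mu> \<in> hat_above le \<nu>"
      and IH: "predecessor le \<mu> \<noteq> \<nu> \<Longrightarrow> predecessor le \<mu> \<in> hat_above le \<nu> \<and>
        (positive_definite (Sig le (predecessor le \<mu>)) \<Phi> \<longrightarrow>
         positive_definite (Sig le (predecessor le \<mu>)) \<Phi>' \<longrightarrow>
         (\<forall>\<kappa>\<in>hat_above le \<nu>. hat_le le \<kappa> (predecessor le \<mu>) \<longrightarrow> gamma le \<kappa> \<Phi> = gamma le \<kappa> \<Phi>') \<longrightarrow>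
         (\<forall>s\<in>Sig le (predecessor le \<mu>). \<Phi> s = \<Phi>' s))"
      and pd: "positive_definite (Sig le \<mu>) \<Phi>" "positive_definite (Sig le \<mu>) \<Phi>'"
      and gamma: "\<forall>\<kappa>\<in>hat_above le \<nu>. hat_le le \<kappa> \<mu> \<longrightarrow> gamma le \<kappa> \<Phi> = gamma le \<kappa> \<Phi>'"
      and s: "s \<in> Sig le \<mu>"
    interpret step: extension_step le \<mu>
      by (rule hat_above_step[OF \<nu> \<mu>])
    have "\<Phi> t = \<Phi>' t" if t: "t \<in> Sig le (predecessor le \<mu>)" for t
    proof (cases "predecessor le \<mu> = \<nu>")
      case True
      with t eq show ?thesis by simp
    next
      case False
      have le: "hat_le le (predecessor le \<mu>) \<mu>"
        using predecessor_less[OF step.\<mu>] by (simp add: hat_less_def)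
      have "positive_definite (Sig le (predecessor le \<mu>)) \<Phi>"
        "positive_definite (Sig le (predecessor le \<mu>)) \<Phi>'"
        by (rule positive_definite_cong_mono[OF pd(1) step.\<Sigma>'_subset refl],
            rule positive_definite_cong_mono[OF pd(2) step.\<Sigma>'_subset refl])
      then show ?thesis
        using conjunct2[OF IH[OF False]] gamma hat_le_trans[OF _ le] t by blast
    qed
    then show "\<Phi> s = \<Phi>' s"
      using gamma \<mu> by (intro step.extension_determined_by_gamma[OF pd _ _ s]) simp_all
  qed
  then show ?thesis
    using pd gamma s by blast
qed

text \<open>The classes above \<open>\<nu>\<close> are enumerated by iterating the successor, and the extension is
  constructed by recursion along this enumeration. A finite set of group elements has all its
  quotients in some \<open>\<Sigma>\<^sub>\<mu>\<close>, so the union of the partial extensions is positive definite. Here the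
  parameter \<open>sel \<mu> \<psi>\<close> to be realized at \<open>\<mu>\<close> may depend on the extension \<open>\<psi>\<close> obtained before.\<close>

lemma exists_extension_with_gammas:
  fixes \<phi> :: "'a free_group \<Rightarrow> 'h::chilbert_space \<Rightarrow> 'h"
  assumes \<nu>: "\<nu> \<in> F_hat" and pd: "positive_definite (Sig le \<nu>) \<phi>"
    and sel: "\<And>\<mu> \<psi>. \<mu> \<in> hat_above le \<nu> \<Longrightarrow> sel \<mu> \<psi> \<in> contractions (D_space le \<mu> \<psi>) (R_space le \<mu> \<psi>)"
  shows "\<exists>\<Phi>\<in>extensions (Sig le \<nu>) UNIV \<phi>.
    \<forall>\<mu>\<in>hat_above le \<nu>. gamma le \<mu> \<Phi> = sel \<mu> (restrict \<Phi> (Sig le (predecessor le \<mu>)))"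
proof -
  define nxt where "nxt \<mu> = (SOME \<kappa>. \<kappa> \<in> hat_above le \<mu> \<and> predecessor le \<kappa> = \<mu>)" for \<mu>
  have nxt: "nxt \<mu> \<in> hat_above le \<mu>" "predecessor le (nxt \<mu>) = \<mu>" if "\<mu> \<in> F_hat" for \<mu>
    using someI_ex[OF exists_successor[OF that]] unfolding nxt_def by blast+
  define e where "e n = (nxt ^^ n) \<nu>" for n
  have e_0: "e 0 = \<nu>" and e_Suc: "e (Suc n) = nxt (e n)" for n
    by (simp_all add: e_def)
  have e_F: "e n \<in> F_hat" for n
    by (induction n) (use \<nu> nxt(1) in \<open>auto simp: e_0 e_Suc hat_above_def\<close>)
  have pred_e: "predecessor le (e (Suc n)) = e n" for n
    unfolding e_Suc by (rule nxt(2)[OF e_F])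
  have step: "extension_step le (e (Suc n))" for n
    unfolding e_Suc by (rule hat_above_step[OF e_F nxt(1)[OF e_F]])
  have e_less: "hat_less le (e n) (e (Suc n))" for n
    using nxt(1)[OF e_F[of n]] by (simp add: e_Suc hat_above_def)
  have e_above: "e (Suc n) \<in> hat_above le \<nu>" for n
  proof (induction n)
    case 0
    show ?case using e_less[of 0] e_F by (simp add: hat_above_def e_0)
  next
    case (Suc n)
    then have "hat_le le \<nu> (e (Suc n))" "\<nu> \<noteq> e (Suc n)"
      by (simp_all add: hat_above_def hat_less_def)
    have "\<not> hat_le le (e (Suc (Suc n))) \<nu>"
    proof
      assume "hat_le le (e (Suc (Suc n))) \<nu>"
      then have "hat_le le (e (Suc (Suc n))) (e (Suc n))"
        by (rule hat_le_trans[OF _ \<open>hat_le le \<nu> (e (Suc n))\<close>])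
      then show False
        using e_less[of "Suc n"] hat_less_iff[OF e_F e_F] by blast
    qed
    then show ?case
      using hat_less_iff[OF \<nu> e_F] e_F by (simp add: hat_above_def)
  qed
  have e_surj: "\<exists>n. \<mu> = e (Suc n)" if "\<mu> \<in> hat_above le \<nu>" for \<mu>
  proof (rule hat_above_induct[OF \<nu> that])
    fix \<mu> assume \<mu>: "\<mu> \<in> hat_above le \<nu>"
      and IH: "predecessor le \<mu> \<noteq> \<nu> \<Longrightarrow>
        predecessor le \<mu> \<in> hat_above le \<nu> \<and> (\<exists>n. predecessor le \<mu> = e (Suc n))"
    obtain n where n: "predecessor le \<mu> = e n"
      using IH e_0 by metis
    interpret step: extension_step le "e (Suc n)"
      by (rule step)
    have "\<mu> = e (Suc n)"
      by (rule predecessor_inject[OF hat_above_in_F_hat[OF \<nu> \<mu>] hat_above_neq_one[OF \<nu> \<mu>] step.\<mu>])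
        (simp only: n pred_e)
    then show "\<exists>n. \<mu> = e (Suc n)" ..
  qed
  have Sig_e: "Sig le (e m) \<subseteq> Sig le (e n)" if "m \<le> n" for m n
    using that
  proof (rule lift_Suc_mono_le[rotated])
    show "Sig le (e n) \<subseteq> Sig le (e (Suc n))" for n
      using e_less[of n] by (intro Sig_mono) (simp add: hat_less_def)
  qed
  have cover: "\<exists>n. s \<in> Sig le (e n)" for s
  proof (cases "hat_le le (hat s) \<nu>")
    case True
    then show ?thesis
      by (intro exI[of _ 0]) (simp add: e_0 mem_Sig_iff)
  next
    case False
    then have "hat s \<in> hat_above le \<nu>"
      using hat_less_iff[OF \<nu> hat_in_F_hat] by (simp add: hat_above_def)
    then obtain n where "hat s = e (Suc n)"
      using e_surj by blast
    then show ?thesis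
      by (intro exI[of _ "Suc n"]) (simp add: mem_Sig_iff)
  qed
  let ?P = "\<lambda>n \<psi>. positive_definite (Sig le (e n)) \<psi> \<and> (n = 0 \<longrightarrow> \<psi> = \<phi>)"
  let ?Q = "\<lambda>n \<psi> \<Phi>. (\<forall>s\<in>Sig le (e n). \<Phi> s = \<psi> s) \<and>
    gamma le (e (Suc n)) \<Phi> = sel (e (Suc n)) (restrict \<psi> (Sig le (e n)))"
  have "\<exists>f. \<forall>n. ?P n (f n) \<and> ?Q n (f n) (f (Suc n))"
  proof (rule dependent_nat_choice)
    show "\<exists>\<psi>. ?P 0 \<psi>"
      using pd by (auto simp: e_0)
    fix \<psi> n assume \<psi>: "?P n \<psi>"
    interpret step: extension_step le "e (Suc n)"
      by (rule step)
    have "D_space le (e (Suc n)) (restrict \<psi> (Sig le (e n))) = D_space le (e (Suc n)) \<psi>"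
      "R_space le (e (Suc n)) (restrict \<psi> (Sig le (e n))) = R_space le (e (Suc n)) \<psi>"
      by (intro step.D_R_space_cong; simp add: pred_e)+
    then have "sel (e (Suc n)) (restrict \<psi> (Sig le (e n)))
        \<in> contractions (D_space le (e (Suc n)) \<psi>) (R_space le (e (Suc n)) \<psi>)"
      using sel[OF e_above, of n "restrict \<psi> (Sig le (e n))"] by simp
    then show "\<exists>\<Phi>. ?P (Suc n) \<Phi> \<and> ?Q n \<psi> \<Phi>"
      using step.exists_extension_with_gamma[of \<psi>] \<psi> by (auto simp: pred_e)
  qed
  then obtain f where f: "\<And>n. positive_definite (Sig le (e n)) (f n)" "f 0 = \<phi>"
    "\<And>n s. s \<in> Sig le (e n) \<Longrightarrow> f (Suc n) s = f n s"
    "\<And>n. gamma le (e (Suc n)) (f (Suc n)) = sel (e (Suc n)) (restrict (f n) (Sig le (e n)))"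
    by (metis (no_types, lifting))
  have f_mono: "f n s = f m s" if "m \<le> n" "s \<in> Sig le (e m)" for m n s
    using that
  proof (induction n rule: dec_induct)
    case (step n)
    then show ?case
      using f(3)[of s n] Sig_e[of m n] by auto
  qed simp
  define \<Phi> where "\<Phi> s = f (LEAST n. s \<in> Sig le (e n)) s" for s
  have \<Phi>_eq: "\<Phi> s = f n s" if "s \<in> Sig le (e n)" for n s
    unfolding \<Phi>_def using f_mono[OF Least_le[of "\<lambda>n. s \<in> Sig le (e n)", OF that]
        LeastI[of "\<lambda>n. s \<in> Sig le (e n)", OF that]] by simp
  have "positive_definite UNIV \<Phi>"
    unfolding positive_definite_iff_finite_sets
  proof (intro conjI ballI allI impI)
    fix s
    obtain n where "s \<in> Sig le (e n)"
      using cover by blast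
    then show "bounded_clinear (\<Phi> s)"
      using positive_definite_bounded_clinear[OF f(1)] by (simp add: \<Phi>_eq)
  next
    fix S :: "'a free_group set" assume fin: "finite S"
    have "\<exists>n. X \<subseteq> Sig le (e n)" if "finite X" for X
      using that
    proof (induction X)
      case (insert x X)
      then obtain m n where "X \<subseteq> Sig le (e m)" "x \<in> Sig le (e n)"
        using cover by blast
      then have "insert x X \<subseteq> Sig le (e (max m n))"
        using Sig_e[of m "max m n"] Sig_e[of n "max m n"] by auto
      then show ?case ..
    qed simp
    then obtain n where n: "(\<lambda>(s, t). inverse s * t) ` (S \<times> S) \<subseteq> Sig le (e n)"
      using fin by (metis finite_SigmaI finite_imageI)
    have mem: "inverse s * t \<in> Sig le (e n)" if "s \<in> S" "t \<in> S" for s t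
      using n that by auto
    have "positive_semidefinite S (kernel_matrix (f n))"
      by (rule positive_definite_psd[OF f(1) fin mem])
    then show "positive_semidefinite S (kernel_matrix \<Phi>)"
      by (rule positive_semidefinite_cong[THEN iffD2, rotated])
        (simp add: kernel_matrix_def \<Phi>_eq[OF mem])
  qed
  moreover have "\<Phi> s = \<phi> s" if "s \<in> Sig le \<nu>" for s
    using \<Phi>_eq[of s 0] that by (simp add: e_0 f(2))
  ultimately have "\<Phi> \<in> extensions (Sig le \<nu>) UNIV \<phi>"
    by (simp add: extensions_def)
  moreover have "gamma le \<mu> \<Phi> = sel \<mu> (restrict \<Phi> (Sig le (predecessor le \<mu>)))"
    if \<mu>: "\<mu> \<in> hat_above le \<nu>" for \<mu>
  proof -
    obtain n where n: "\<mu> = e (Suc n)"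
      using e_surj[OF \<mu>] by blast
    interpret step: extension_step le "e (Suc n)"
      by (rule step)
    have "gamma le (e (Suc n)) \<Phi> = gamma le (e (Suc n)) (f (Suc n))"
      by (rule step.gamma_cong[OF \<Phi>_eq])
    moreover have "restrict (f n) (Sig le (e n)) = restrict \<Phi> (Sig le (e n))"
      by (rule restrict_ext) (simp add: \<Phi>_eq)
    ultimately show ?thesis
      by (simp add: n pred_e f(4))
  qed
  ultimately show ?thesis by blast
qed

lemma exists_extension:
  assumes "\<nu> \<in> F_hat" "positive_definite (Sig le \<nu>) \<phi>"
  shows "\<exists>\<Phi>. \<Phi> \<in> extensions (Sig le \<nu>) UNIV \<phi>"
  using exists_extension_with_gammas[OF assms, of "\<lambda>\<mu> \<psi>. \<lambda>d\<in>D_space le \<mu> \<psi>. 0"]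
    extension_step.zero_contraction[OF hat_above_step[OF assms(1)]] by blast

lemma gamma_in_contractions:
  assumes \<nu>: "\<nu> \<in> F_hat" and \<Phi>: "positive_definite UNIV \<Phi>" and \<mu>: "\<mu> \<in> hat_above le \<nu>"
    and eq: "\<And>s. s \<in> Sig le (predecessor le \<mu>) \<Longrightarrow> \<psi> s = \<Phi> s"
  shows "gamma le \<mu> \<Phi> \<in> contractions (D_space le \<mu> \<psi>) (R_space le \<mu> \<psi>)"
proof -
  interpret step: extension_step le \<mu>
    by (rule hat_above_step[OF \<nu> \<mu>])
  have "positive_definite (Sig le \<mu>) \<Phi>"
    by (rule positive_definite_cong_mono[OF \<Phi> subset_UNIV refl])
  from step.gamma_contraction[OF this] show ?thesis
    by (simp only: step.D_R_space_cong[OF eq])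
qed

lemma extensions_agree:
  assumes \<nu>: "\<nu> \<in> F_hat" and \<mu>: "\<mu> \<in> hat_above le \<nu>"
    and \<Phi>: "\<Phi> \<in> extensions (Sig le \<nu>) UNIV \<phi>" and \<Phi>': "\<Phi>' \<in> extensions (Sig le \<nu>) UNIV \<phi>"
    and gamma: "\<And>\<kappa>. \<kappa> \<in> hat_above le \<nu> \<Longrightarrow> hat_le le \<kappa> \<mu> \<Longrightarrow> gamma le \<kappa> \<Phi> = gamma le \<kappa> \<Phi>'"
    and s: "s \<in> Sig le \<mu>"
  shows "\<Phi> s = \<Phi>' s"
proof (rule extensions_determined_by_gammas[OF \<nu> \<mu> _ _ _ gamma s])
  show "positive_definite (Sig le \<mu>) \<Phi>" "positive_definite (Sig le \<mu>) \<Phi>'"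
    using \<Phi> \<Phi>' positive_definite_cong_mono[OF _ subset_UNIV refl] by (auto simp: extensions_def)
qed (use \<Phi> \<Phi>' in \<open>auto simp: extensions_def\<close>)

lemma extensions_eqI:
  assumes \<nu>: "\<nu> \<in> F_hat"
    and \<Phi>: "\<Phi> \<in> extensions (Sig le \<nu>) UNIV \<phi>" and \<Phi>': "\<Phi>' \<in> extensions (Sig le \<nu>) UNIV \<phi>"
    and gamma: "\<And>\<kappa>. \<kappa> \<in> hat_above le \<nu> \<Longrightarrow> gamma le \<kappa> \<Phi> = gamma le \<kappa> \<Phi>'"
  shows "\<Phi> = \<Phi>'"
proof
  fix s
  show "\<Phi> s = \<Phi>' s"
  proof (cases "s \<in> Sig le \<nu>")
    case True
    then show ?thesis
      using \<Phi> \<Phi>' by (simp add: extensions_def)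
  next
    case False
    then have "hat s \<in> hat_above le \<nu>"
      using hat_less_iff[OF \<nu> hat_in_F_hat] by (simp add: hat_above_def mem_Sig_iff)
    then show ?thesis
      by (rule extensions_agree[OF \<nu> _ \<Phi> \<Phi>' gamma]) (simp_all add: mem_Sig_iff)
  qed
qed

text \<open>Consequently the spaces \<open>D(\<psi>)\<close> and \<open>R(\<psi>)\<close>, which a contraction sequence refers to, are those in
  which the parameter of \<open>\<Phi>\<close> at \<open>\<mu>\<close> lives.\<close>

lemma partial_extension_agrees:
  assumes \<nu>: "\<nu> \<in> F_hat" and \<mu>: "\<mu> \<in> hat_above le \<nu>"
    and \<Phi>: "\<Phi> \<in> extensions (Sig le \<nu>) UNIV \<phi>"
    and \<psi>: "\<psi> \<in> extensions (Sig le \<nu>) (Sig le (predecessor le \<mu>)) \<phi>"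
    and gamma: "\<And>\<kappa>. \<kappa> \<in> hat_above le \<nu> \<Longrightarrow> hat_less le \<kappa> \<mu> \<Longrightarrow> gamma le \<kappa> \<psi> = gamma le \<kappa> \<Phi>"
    and s: "s \<in> Sig le (predecessor le \<mu>)"
  shows "\<psi> s = \<Phi> s"
proof (cases "predecessor le \<mu> = \<nu>")
  case True
  then show ?thesis
    using \<Phi> \<psi> s by (simp add: extensions_def)
next
  case False
  then have above: "predecessor le \<mu> \<in> hat_above le \<nu>"
    using hat_above_predecessor[OF \<nu> \<mu>] by blast
  note F = hat_above_in_F_hat[OF \<nu> \<mu>] hat_above_neq_one[OF \<nu> \<mu>]
  have less: "hat_less le \<kappa> \<mu>" if \<kappa>: "\<kappa> \<in> hat_above le \<nu>" "hat_le le \<kappa> (predecessor le \<mu>)" for \<kappa>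
    using hat_less_iff[OF hat_above_in_F_hat[OF \<nu> \<kappa>(1)] F(1)] predecessor_less[OF F]
      hat_less_iff[OF predecessor_in_F_hat[OF F] F(1)] hat_le_trans[OF _ \<kappa>(2)] by blast
  show ?thesis
  proof (rule extensions_determined_by_gammas[OF \<nu> above _ _ _ _ s])
    show "positive_definite (Sig le (predecessor le \<mu>)) \<psi>"
      using \<psi> by (simp add: extensions_def)
    show "positive_definite (Sig le (predecessor le \<mu>)) \<Phi>"
      by (rule positive_definite_cong_mono[OF _ subset_UNIV refl])
        (use \<Phi> in \<open>simp add: extensions_def\<close>)
    show "\<psi> s = \<Phi> s" if "s \<in> Sig le \<nu>" for s
      using \<Phi> \<psi> that by (simp add: extensions_def)
  qed (intro gamma less; assumption)
qed

text \<open>The operator \<open>g \<mu>\<close> is known to be a contraction between the right spaces only for partial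
  extensions that have the earlier parameters. In all other cases the zero operator is selected; by
  induction they do not occur.\<close>

lemma exists_extension_with_contraction_sequence:
  fixes \<phi> :: "'a free_group \<Rightarrow> 'h::chilbert_space \<Rightarrow> 'h"
  assumes \<nu>: "\<nu> \<in> F_hat" and pd: "positive_definite (Sig le \<nu>) \<phi>"
    and g: "g \<in> contraction_sequences le \<nu> \<phi>"
  shows "\<exists>\<Phi>\<in>extensions (Sig le \<nu>) UNIV \<phi>. \<forall>\<mu>\<in>hat_above le \<nu>. gamma le \<mu> \<Phi> = g \<mu>"
proof -
  define sel where "sel \<mu> \<psi> = (if g \<mu> \<in> contractions (D_space le \<mu> \<psi>) (R_space le \<mu> \<psi>) then g \<mu>
      else (\<lambda>d\<in>D_space le \<mu> \<psi>. 0))" for \<mu> and \<psi> :: "'a free_group \<Rightarrow> 'h \<Rightarrow> 'h"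
  have "sel \<mu> \<psi> \<in> contractions (D_space le \<mu> \<psi>) (R_space le \<mu> \<psi>)" if "\<mu> \<in> hat_above le \<nu>" for \<mu> \<psi>
    using extension_step.zero_contraction[OF hat_above_step[OF \<nu> that], of \<psi>]
    by (simp add: sel_def)
  from exists_extension_with_gammas[OF \<nu> pd this]
  obtain \<Phi> where \<Phi>: "\<Phi> \<in> extensions (Sig le \<nu>) UNIV \<phi>"
    and gamma: "\<And>\<mu>. \<mu> \<in> hat_above le \<nu> \<Longrightarrow>
      gamma le \<mu> \<Phi> = sel \<mu> (restrict \<Phi> (Sig le (predecessor le \<mu>)))"
    by blast
  have "gamma le \<mu> \<Phi> = g \<mu>" if "\<mu> \<in> hat_above le \<nu>" for \<mu>
    using that
  proof (induction "card (Sig le \<mu>)" arbitrary: \<mu> rule: less_induct)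
    case less
    let ?\<psi> = "restrict \<Phi> (Sig le (predecessor le \<mu>))"
    note F = hat_above_in_F_hat[OF \<nu> less.prems] hat_above_neq_one[OF \<nu> less.prems]
    have "?\<psi> \<in> extensions (Sig le \<nu>) (Sig le (predecessor le \<mu>)) \<phi>"
      using \<Phi> Sig_subset_predecessor[OF \<nu> less.prems]
        positive_definite_cong_mono[of UNIV \<Phi> "Sig le (predecessor le \<mu>)" ?\<psi>]
      by (auto simp: extensions_def)
    moreover have "gamma le \<kappa> ?\<psi> = g \<kappa>" if \<kappa>: "\<kappa> \<in> hat_above le \<nu>" "hat_less le \<kappa> \<mu>" for \<kappa>
    proof -
      note \<kappa>F = hat_above_in_F_hat[OF \<nu> \<kappa>(1)]
      interpret step: extension_step le \<kappa>
        by (rule hat_above_step[OF \<nu> \<kappa>(1)])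
      have "Sig le \<kappa> \<subseteq> Sig le (predecessor le \<mu>)"
        by (rule Sig_mono[OF predecessor_greatest[OF F \<kappa>F \<kappa>(2)]])
      then have "gamma le \<kappa> ?\<psi> = gamma le \<kappa> \<Phi>"
        by (intro step.gamma_cong) auto
      also have "\<dots> = g \<kappa>"
        by (rule less.hyps[OF card_Sig_less[OF \<kappa>F F(1) \<kappa>(2)] \<kappa>(1)])
      finally show ?thesis .
    qed
    ultimately have "g \<mu> \<in> contractions (D_space le \<mu> ?\<psi>) (R_space le \<mu> ?\<psi>)"
      using g less.prems unfolding contraction_sequences_def by blast
    then show ?case
      by (simp add: gamma[OF less.prems] sel_def)
  qed
  with \<Phi> show ?thesis by blast
qed

lemma gamma_sequence_in_contraction_sequences:
  assumes \<nu>: "\<nu> \<in> F_hat" and \<Phi>: "\<Phi> \<in> extensions (Sig le \<nu>) UNIV \<phi>"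
  shows "(\<lambda>\<mu>\<in>hat_above le \<nu>. gamma le \<mu> \<Phi>) \<in> contraction_sequences le \<nu> \<phi>"
  unfolding contraction_sequences_def
proof (intro CollectI conjI ballI impI)
  fix \<mu> \<psi>
  assume \<mu>: "\<mu> \<in> hat_above le \<nu>"
    and \<psi>: "\<psi> \<in> extensions (Sig le \<nu>) (Sig le (predecessor le \<mu>)) \<phi>"
    and eq: "\<forall>\<mu>'\<in>hat_above le \<nu>. hat_less le \<mu>' \<mu> \<longrightarrow>
      gamma le \<mu>' \<psi> = (\<lambda>\<mu>\<in>hat_above le \<nu>. gamma le \<mu> \<Phi>) \<mu>'"
  have "\<psi> s = \<Phi> s" if "s \<in> Sig le (predecessor le \<mu>)" for s
    using eq by (intro partial_extension_agrees[OF \<nu> \<mu> \<Phi> \<psi> _ that]) simp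
  then have "gamma le \<mu> \<Phi> \<in> contractions (D_space le \<mu> \<psi>) (R_space le \<mu> \<psi>)"
    using \<Phi> by (intro gamma_in_contractions[OF \<nu> _ \<mu>]) (simp_all add: extensions_def)
  then show "(\<lambda>\<mu>\<in>hat_above le \<nu>. gamma le \<mu> \<Phi>) \<mu> \<in> contractions (D_space le \<mu> \<psi>) (R_space le \<mu> \<psi>)"
    using \<mu> by simp
qed simp

lemma bij_betw_gamma_sequences:
  assumes \<nu>: "\<nu> \<in> F_hat" and pd: "positive_definite (Sig le \<nu>) \<phi>"
  shows "bij_betw (\<lambda>\<Phi>. \<lambda>\<mu>\<in>hat_above le \<nu>. gamma le \<mu> \<Phi>)
    (extensions (Sig le \<nu>) UNIV \<phi>) (contraction_sequences le \<nu> \<phi>)"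
  (is "bij_betw ?f ?E ?C")
proof (rule bij_betw_imageI)
  show "inj_on ?f ?E"
  proof (rule inj_onI)
    fix \<Phi> \<Phi>' assume \<Phi>: "\<Phi> \<in> ?E" "\<Phi>' \<in> ?E" and eq: "?f \<Phi> = ?f \<Phi>'"
    show "\<Phi> = \<Phi>'"
    proof (rule extensions_eqI[OF \<nu> \<Phi>])
      show "gamma le \<mu> \<Phi> = gamma le \<mu> \<Phi>'" if "\<mu> \<in> hat_above le \<nu>" for \<mu>
        using fun_cong[OF eq, of \<mu>] that by simp
    qed
  qed
  show "?f ` ?E = ?C"
  proof (intro subset_antisym subsetI)
    show "g \<in> ?C" if "g \<in> ?f ` ?E" for g
      using that gamma_sequence_in_contraction_sequences[OF \<nu>] by blast
    fix g assume g: "g \<in> ?C"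
    then obtain \<Phi> where \<Phi>: "\<Phi> \<in> ?E" "\<And>\<mu>. \<mu> \<in> hat_above le \<nu> \<Longrightarrow> gamma le \<mu> \<Phi> = g \<mu>"
      using exists_extension_with_contraction_sequence[OF \<nu> pd] by blast
    have "g \<in> extensional (hat_above le \<nu>)"
      using g by (simp add: contraction_sequences_def)
    then have "g = ?f \<Phi>"
      by (intro extensionalityI[of g "hat_above le \<nu>"]) (simp_all add: \<Phi>(2))
    with \<Phi>(1) show "g \<in> ?f ` ?E" by blast
  qed
qed

text \<open>One step realizes \<open>c\<close>; the result is then extended with \<open>\<mu>\<close> in the role of \<open>\<nu>\<close>.\<close>

lemma exists_extension_prescribing_next_gamma:
  assumes \<nu>: "\<nu> \<in> F_hat" and \<mu>: "\<mu> \<in> hat_above le \<nu>"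
    and \<psi>: "\<psi> \<in> extensions (Sig le \<nu>) (Sig le (predecessor le \<mu>)) \<phi>"
    and c: "c \<in> contractions (D_space le \<mu> \<psi>) (R_space le \<mu> \<psi>)"
  shows "\<exists>\<Phi>\<in>extensions (Sig le \<nu>) UNIV \<phi>.
    (\<forall>s\<in>Sig le (predecessor le \<mu>). \<Phi> s = \<psi> s) \<and> gamma le \<mu> \<Phi> = c"
proof -
  interpret step: extension_step le \<mu>
    by (rule hat_above_step[OF \<nu> \<mu>])
  have "positive_definite (Sig le (predecessor le \<mu>)) \<psi>"
    using \<psi> by (simp add: extensions_def)
  from step.exists_extension_with_gamma[OF this c]
  obtain \<Phi>' where \<Phi>': "positive_definite (Sig le \<mu>) \<Phi>'"
    "\<And>s. s \<in> Sig le (predecessor le \<mu>) \<Longrightarrow> \<Phi>' s = \<psi> s" "gamma le \<mu> \<Phi>' = c"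
    by blast
  obtain \<Phi> where \<Phi>: "positive_definite UNIV \<Phi>" "\<And>s. s \<in> Sig le \<mu> \<Longrightarrow> \<Phi> s = \<Phi>' s"
    using exists_extension[OF step.\<mu>(1) \<Phi>'(1)] by (auto simp: extensions_def)
  have eq: "\<Phi> s = \<psi> s" if "s \<in> Sig le (predecessor le \<mu>)" for s
    using that step.\<Sigma>'_subset \<Phi>(2) \<Phi>'(2) by (metis subsetD)
  have "\<Phi> s = \<phi> s" if "s \<in> Sig le \<nu>" for s
    using that \<psi> eq Sig_subset_predecessor[OF \<nu> \<mu>] by (simp add: extensions_def subset_iff)
  then have "\<Phi> \<in> extensions (Sig le \<nu>) UNIV \<phi>"
    using \<Phi>(1) by (simp add: extensions_def)
  moreover have "gamma le \<mu> \<Phi> = c"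
    using step.gamma_cong[OF \<Phi>(2)] \<Phi>'(3) by simp
  ultimately show ?thesis
    using eq by blast
qed

end

theorem theorem4p3:
  fixes le :: "'a::finite free_group \<Rightarrow> 'a free_group \<Rightarrow> bool"
    and \<nu> :: "'a free_group set"
    and \<phi> :: "'a free_group \<Rightarrow> 'h::chilbert_space \<Rightarrow> 'h"
  assumes "lexicographic le"
    and "\<nu> \<in> F_hat"
    and "positive_definite (Sig le \<nu>) \<phi>"
    and "\<phi> 1 = id"
  shows "(\<exists>\<Phi>. \<Phi> \<in> extensions (Sig le \<nu>) UNIV \<phi>)
    \<and> bij_betw (\<lambda>\<Phi>. \<lambda>\<mu>\<in>hat_above le \<nu>. gamma le \<mu> \<Phi>)
        (extensions (Sig le \<nu>) UNIV \<phi>) (contraction_sequences le \<nu> \<phi>)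
    \<and> (\<forall>\<Phi>\<in>extensions (Sig le \<nu>) UNIV \<phi>. \<forall>\<mu>\<in>hat_above le \<nu>.
        gamma le \<mu> \<Phi> \<in> contractions
          (D_space le \<mu> (restrict \<Phi> (Sig le (predecessor le \<mu>))))
          (R_space le \<mu> (restrict \<Phi> (Sig le (predecessor le \<mu>)))))
    \<and> (\<forall>\<Phi>\<in>extensions (Sig le \<nu>) UNIV \<phi>. \<forall>\<Phi>'\<in>extensions (Sig le \<nu>) UNIV \<phi>.
        \<forall>\<mu>\<in>hat_above le \<nu>.
        (\<forall>\<mu>'\<in>hat_above le \<nu>. hat_le le \<mu>' \<mu> \<longrightarrow> gamma le \<mu>' \<Phi> = gamma le \<mu>' \<Phi>') \<longrightarrow>
        (\<forall>s\<in>Sig le \<mu>. \<Phi> s = \<Phi>' s))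
    \<and> (\<forall>\<mu>\<in>hat_above le \<nu>.
        \<forall>\<psi>\<in>extensions (Sig le \<nu>) (Sig le (predecessor le \<mu>)) \<phi>.
        \<forall>c\<in>contractions (D_space le \<mu> \<psi>) (R_space le \<mu> \<psi>).
        \<exists>\<Phi>\<in>extensions (Sig le \<nu>) UNIV \<phi>.
          (\<forall>s\<in>Sig le (predecessor le \<mu>). \<Phi> s = \<psi> s) \<and> gamma le \<mu> \<Phi> = c)"
proof -
  interpret lexicographic_order le
    by unfold_locales (rule assms(1))
  note \<nu> = assms(2)
  show ?thesis
  proof (intro conjI ballI impI)
    show "\<exists>\<Phi>. \<Phi> \<in> extensions (Sig le \<nu>) UNIV \<phi>"
      by (rule exists_extension[OF assms(2,3)])
    show "bij_betw (\<lambda>\<Phi>. \<lambda>\<mu>\<in>hat_above le \<nu>. gamma le \<mu> \<Phi>)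
        (extensions (Sig le \<nu>) UNIV \<phi>) (contraction_sequences le \<nu> \<phi>)"
      by (rule bij_betw_gamma_sequences[OF assms(2,3)])
    show "gamma le \<mu> \<Phi> \<in> contractions
          (D_space le \<mu> (restrict \<Phi> (Sig le (predecessor le \<mu>))))
          (R_space le \<mu> (restrict \<Phi> (Sig le (predecessor le \<mu>))))"
      if "\<Phi> \<in> extensions (Sig le \<nu>) UNIV \<phi>" "\<mu> \<in> hat_above le \<nu>" for \<Phi> \<mu>
      using that by (intro gamma_in_contractions[OF \<nu>]) (simp_all add: extensions_def)
    show "\<Phi> s = \<Phi>' s"
      if "\<Phi> \<in> extensions (Sig le \<nu>) UNIV \<phi>" "\<Phi>' \<in> extensions (Sig le \<nu>) UNIV \<phi>"
        "\<mu> \<in> hat_above le \<nu>"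
        "\<forall>\<mu>'\<in>hat_above le \<nu>. hat_le le \<mu>' \<mu> \<longrightarrow> gamma le \<mu>' \<Phi> = gamma le \<mu>' \<Phi>'"
        "s \<in> Sig le \<mu>" for \<Phi> \<Phi>' \<mu> s
      using that(4) by (intro extensions_agree[OF \<nu> that(3,1,2) _ that(5)]) blast
    show "\<exists>\<Phi>\<in>extensions (Sig le \<nu>) UNIV \<phi>.
          (\<forall>s\<in>Sig le (predecessor le \<mu>). \<Phi> s = \<psi> s) \<and> gamma le \<mu> \<Phi> = c"
      if "\<mu> \<in> hat_above le \<nu>"
        "\<psi> \<in> extensions (Sig le \<nu>) (Sig le (predecessor le \<mu>)) \<phi>"
        "c \<in> contractions (D_space le \<mu> \<psi>) (R_space le \<mu> \<psi>)" for \<mu> \<psi> c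
      by (rule exists_extension_prescribing_next_gamma[OF \<nu> that])
  qed
qed

end
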